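(* Let $\mathfrak{g}=\mathfrak{n}^-\oplus\mathfrak{h}\oplus\mathfrak{n}^+$ be the insertion-elimination Lie algebra over $\mathbb{C}$, and let $\eta:\mathfrak{n}^+\to\mathbb{C}$ be a non-zero, depth-bounded Lie algebra homomorphism. Then the space of Whittaker vectors of type $\eta$ in the standard Whittaker module $M_\eta$ is one-dimensional, and $M_\eta$ is a simple $\mathfrak{g}$-module.
   Context: A rooted tree is a finite nonempty connected undirected graph without cycles, with a distinguished vertex called the root; $\mathbb{T}$ denotes the set of all rooted trees, up to isomorphism. For $t\in\mathbb{T}$, $V(t)$ and $E(t)$ are the sets of vertices and edges and $|t|=|V(t)|$. The depth $\mathsf{d}(t)$ is the maximum number of edges of a simple path starting at the root. For $s,t\in\mathbb{T}$ and $v\in V(s)$, $s\cup_v t$ is the rooted tree obtained by joining the root of $t$ to the vertex $v$ of $s$ by a new edge (its root is the root of $s$). For $e\in E(t)$, removing $e$ splits $t$ into two rooted trees: $R_e(t)$, the part containing the root of $t$, and $P_e(t)$, the other part, rooted at its endpoint of $e$. Put $\alpha(t_1,t_2,t_3)=|\{e\in E(t_2): R_e(t_2)=t_3,\ P_e(t_2)=t_1\}|$ and $\beta(t_1,t_2,t_3)=|\{v\in V(t_3): t_1=t_3\cup_v t_2\}|$ (equalities of trees are up to isomorphism). The insertion-elimination Lie algebra $\mathfrak{g}$ is the complex Lie algebra with basis $\{d\}\cup\{D_t^+,D_t^-: t\in\mathbb{T}\}$ and brackets, for $s,t\in\mathbb{T}$: $[D_s^+,D_t^+]=\sum_{r\in\mathbb{T}}(\beta(r,s,t)-\beta(r,t,s))D_r^+$;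 $[D_s^-,D_t^-]=\sum_{r\in\mathbb{T}}(\alpha(t,r,s)-\alpha(s,r,t))D_r^-$; $[D_s^-,D_t^+]=\sum_{r\in\mathbb{T}}\alpha(s,t,r)D_r^+ +\sum_{r\in\mathbb{T}}\beta(s,t,r)D_r^-$ for $s\neq t$; $[D_t^-,D_t^+]=d$; $[d,D_t^-]=-|t|D_t^-$; $[d,D_t^+]=|t|D_t^+$. Let $\mathfrak{n}^{\pm}$ be the span of the $D_t^{\pm}$ ($t\in\mathbb{T}$) and $\mathfrak{h}=\mathbb{C}d$. For a Lie algebra homomorphism $\eta:\mathfrak{n}^+\to\mathbb{C}$ let $\mathbb{C}_\eta$ be the one-dimensional $\mathfrak{n}^+$-module with $x\cdot 1=\eta(x)$. The standard Whittaker module is $M_\eta=U(\mathfrak{g})\otimes_{U(\mathfrak{n}^+)}\mathbb{C}_\eta$. A Whittaker vector of type $\eta$ in a $\mathfrak{g}$-module $V$ is a vector $v\in V$ with $x v=\eta(x)v$ for all $x\in\mathfrak{n}^+$. The homomorphism $\eta$ is depth-bounded if there is a positive integer $M$ such that $\eta(D_t^+)=0$ whenever $\mathsf{d}(t)\geq M$. *)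

theory Defs
  imports Complex_Main "HOL-Library.Poly_Mapping" "HOL-Library.Groups_Big_Fun"
    "HOL-Algebra.QuotRing" "HOL-Algebra.Module" "HOL-Algebra.Free_Abelian_Groups"
begin

section \<open>Rooted trees\<close>

record 'a rgraph =
  verts :: "'a set"
  edges :: "'a set set"
  troot :: 'a

definition walk :: "'a rgraph \<Rightarrow> 'a list \<Rightarrow> bool" where
  "walk G p \<longleftrightarrow> p \<noteq> [] \<and> set p \<subseteq> verts G \<and> successively (\<lambda>u v. {u, v} \<in> edges G) p"

definition simple_path :: "'a rgraph \<Rightarrow> 'a list \<Rightarrow> bool" where
  "simple_path G p \<longleftrightarrow> walk G p \<and> distinct p"

definition reachable :: "'a rgraph \<Rightarrow> 'a \<Rightarrow> 'a set" where
  "reachable G u = {v. \<exists>p. walk G p \<and> hd p = u \<and> last p = v}"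

definition graph_cycle :: "'a rgraph \<Rightarrow> 'a list \<Rightarrow> bool" where
  "graph_cycle G p \<longleftrightarrow> simple_path G p \<and> 3 \<le> length p \<and> {last p, hd p} \<in> edges G"

definition rooted_tree :: "'a rgraph \<Rightarrow> bool" where
  "rooted_tree G \<longleftrightarrow>
     finite (verts G) \<and> troot G \<in> verts G \<and>
     (\<forall>e\<in>edges G. e \<subseteq> verts G \<and> card e = 2) \<and>
     (\<forall>u\<in>verts G. \<forall>v\<in>verts G. v \<in> reachable G u) \<and>
     (\<nexists>p. graph_cycle G p)"

definition tree_iso :: "'a rgraph \<Rightarrow> 'b rgraph \<Rightarrow> bool" where
  "tree_iso G H \<longleftrightarrow> (\<exists>f. bij_betw f (verts G) (verts H) \<and> f (troot G) = troot H \<and>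
     (\<forall>u\<in>verts G. \<forall>v\<in>verts G. {u, v} \<in> edges G \<longleftrightarrow> {f u, f v} \<in> edges H))"

lemma tree_iso_refl: "tree_iso G G"
  unfolding tree_iso_def by (rule exI[of _ id]) auto

lemma tree_iso_sym: "rooted_tree G \<Longrightarrow> tree_iso G H \<Longrightarrow> tree_iso H G"
  unfolding tree_iso_def
proof (elim exE conjE)
  fix f assume G: "rooted_tree G" and f: "bij_betw f (verts G) (verts H)"
    and r: "f (troot G) = troot H"
    and e: "\<forall>u\<in>verts G. \<forall>v\<in>verts G. ({u, v} \<in> edges G) = ({f u, f v} \<in> edges H)"
  let ?g = "inv_into (verts G) f"
  have g: "bij_betw ?g (verts H) (verts G)"
    using f by (rule bij_betw_inv_into)
  moreover have "?g (troot H) = troot G"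
    using G bij_betw_inv_into_left[OF f, of "troot G"] by (simp add: rooted_tree_def r)
  moreover have "({u, v} \<in> edges H) = ({?g u, ?g v} \<in> edges G)"
    if u: "u \<in> verts H" and v: "v \<in> verts H" for u v
  proof -
    have "?g u \<in> verts G" "?g v \<in> verts G"
      using g u v by (simp_all add: bij_betw_apply)
    then have "({?g u, ?g v} \<in> edges G) = ({f (?g u), f (?g v)} \<in> edges H)"
      using e by blast
    then show ?thesis
      using bij_betw_inv_into_right[OF f u] bij_betw_inv_into_right[OF f v] by simp
  qed
  ultimately show "\<exists>g. bij_betw g (verts H) (verts G) \<and> g (troot H) = troot G \<and>
     (\<forall>u\<in>verts H. \<forall>v\<in>verts H. ({u, v} \<in> edges H) = ({g u, g v} \<in> edges G))"
    by blast
qed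

lemma tree_iso_trans: "tree_iso G H \<Longrightarrow> tree_iso H K \<Longrightarrow> tree_iso G K"
  unfolding tree_iso_def
proof (elim exE conjE)
  fix f g assume f: "bij_betw f (verts G) (verts H)" "f (troot G) = troot H"
    "\<forall>u\<in>verts G. \<forall>v\<in>verts G. ({u, v} \<in> edges G) = ({f u, f v} \<in> edges H)"
    and g: "bij_betw g (verts H) (verts K)" "g (troot H) = troot K"
    "\<forall>u\<in>verts H. \<forall>v\<in>verts H. ({u, v} \<in> edges H) = ({g u, g v} \<in> edges K)"
  show "\<exists>h. bij_betw h (verts G) (verts K) \<and> h (troot G) = troot K \<and>
     (\<forall>u\<in>verts G. \<forall>v\<in>verts G. ({u, v} \<in> edges G) = ({h u, h v} \<in> edges K))"
  proof (intro exI[of _ "g \<circ> f"] conjI ballI)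
    show "bij_betw (g \<circ> f) (verts G) (verts K)"
      using f(1) g(1) by (rule bij_betw_trans)
    show "(g \<circ> f) (troot G) = troot K"
      using f(2) g(2) by simp
    fix u v assume u: "u \<in> verts G" and v: "v \<in> verts G"
    then have "f u \<in> verts H" "f v \<in> verts H"
      using f(1) by (simp_all add: bij_betw_apply)
    then show "({u, v} \<in> edges G) = ({(g \<circ> f) u, (g \<circ> f) v} \<in> edges K)"
      using f(3) g(3) u v by simp
  qed
qed

lemma rooted_tree_single: "rooted_tree \<lparr>verts = {v}, edges = {}, troot = v\<rparr>"
proof -
  let ?G = "\<lparr>verts = {v}, edges = {}, troot = v\<rparr>"
  have "walk ?G [v]"
    by (simp add: walk_def)
  then have "v \<in> reachable ?G v"
    unfolding reachable_def by (intro CollectI exI[of _ "[v]"]) simp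
  then show ?thesis
    by (simp add: rooted_tree_def graph_cycle_def)
qed

text \<open>Every finite rooted tree is isomorphic to one whose vertices are natural numbers, so
  \<open>rtree\<close> is the set of all rooted trees up to isomorphism.\<close>

quotient_type rtree = "nat rgraph" / partial:
  "\<lambda>G H. rooted_tree G \<and> rooted_tree H \<and> tree_iso G H"
proof (rule part_equivpI)
  show "\<exists>G::nat rgraph. rooted_tree G \<and> rooted_tree G \<and> tree_iso G G"
    using rooted_tree_single[of "0::nat"] tree_iso_refl by blast
  show "symp (\<lambda>G H :: nat rgraph. rooted_tree G \<and> rooted_tree H \<and> tree_iso G H)"
    by (rule sympI) (use tree_iso_sym in blast)
  show "transp (\<lambda>G H :: nat rgraph. rooted_tree G \<and> rooted_tree H \<and> tree_iso G H)"
    by (rule transpI) (use tree_iso_trans in blast)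
qed

text \<open>The notions below are invariant under isomorphism and are evaluated on the representative
  \<open>rep_rtree t\<close>.\<close>

definition tsize :: "rtree \<Rightarrow> nat" where
  "tsize t = card (verts (rep_rtree t))"

definition depth :: "rtree \<Rightarrow> nat" where
  "depth t = Max {length p - 1 | p. simple_path (rep_rtree t) p \<and> hd p = troot (rep_rtree t)}"

definition join_at :: "'a rgraph \<Rightarrow> 'a \<Rightarrow> 'b rgraph \<Rightarrow> ('a + 'b) rgraph" where
  "join_at S v T = \<lparr>verts = Inl ` verts S \<union> Inr ` verts T,
     edges = insert {Inl v, Inr (troot T)} ((`) Inl ` edges S \<union> (`) Inr ` edges T),
     troot = Inl (troot S)\<rparr>"

definition root_side :: "'a rgraph \<Rightarrow> 'a set \<Rightarrow> 'a set" where
  "root_side G e = reachable (G\<lparr>edges := edges G - {e}\<rparr>) (troot G)"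

definition root_part :: "'a rgraph \<Rightarrow> 'a set \<Rightarrow> 'a rgraph" where
  "root_part G e = \<lparr>verts = root_side G e,
     edges = {f \<in> edges G - {e}. f \<subseteq> root_side G e},
     troot = troot G\<rparr>"

definition pruned_part :: "'a rgraph \<Rightarrow> 'a set \<Rightarrow> 'a rgraph" where
  "pruned_part G e = \<lparr>verts = verts G - root_side G e,
     edges = {f \<in> edges G - {e}. f \<subseteq> verts G - root_side G e},
     troot = the_elem (e - root_side G e)\<rparr>"

definition \<alpha> :: "rtree \<Rightarrow> rtree \<Rightarrow> rtree \<Rightarrow> nat" where
  "\<alpha> t1 t2 t3 = card {e \<in> edges (rep_rtree t2).
     tree_iso (root_part (rep_rtree t2) e) (rep_rtree t3) \<and>
     tree_iso (pruned_part (rep_rtree t2) e) (rep_rtree t1)}"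

definition \<beta> :: "rtree \<Rightarrow> rtree \<Rightarrow> rtree \<Rightarrow> nat" where
  "\<beta> t1 t2 t3 = card {v \<in> verts (rep_rtree t3).
     tree_iso (rep_rtree t1) (join_at (rep_rtree t3) v (rep_rtree t2))}"

section \<open>Lie algebras with a given basis\<close>

text \<open>The vector space with basis \<open>'b\<close> is \<open>'b \<Rightarrow>\<^sub>0 complex\<close>; a bracket on it is given by its values
  on basis vectors.\<close>

abbreviation bvec :: "'b \<Rightarrow> 'b \<Rightarrow>\<^sub>0 complex" where
  "bvec b \<equiv> Poly_Mapping.single b 1"

definition vscale :: "complex \<Rightarrow> ('b \<Rightarrow>\<^sub>0 complex) \<Rightarrow> ('b \<Rightarrow>\<^sub>0 complex)" where
  "vscale c x = Poly_Mapping.map ((*) c) x"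

definition span_of :: "'b set \<Rightarrow> ('b \<Rightarrow>\<^sub>0 complex) set" where
  "span_of B = {x. Poly_Mapping.keys x \<subseteq> B}"

definition bilinear_ext ::
    "('b \<Rightarrow> 'b \<Rightarrow> ('b \<Rightarrow>\<^sub>0 complex)) \<Rightarrow> ('b \<Rightarrow>\<^sub>0 complex) \<Rightarrow> ('b \<Rightarrow>\<^sub>0 complex) \<Rightarrow> ('b \<Rightarrow>\<^sub>0 complex)" where
  "bilinear_ext br x y = (\<Sum>a\<in>Poly_Mapping.keys x. \<Sum>b\<in>Poly_Mapping.keys y.
     vscale (Poly_Mapping.lookup x a * Poly_Mapping.lookup y b) (br a b))"

section \<open>The insertion-elimination Lie algebra\<close>

datatype ie_basis = Dgr | Dplus rtree | Dminus rtree

type_synonym ie_alg = "ie_basis \<Rightarrow>\<^sub>0 complex"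

text \<open>The sums over all trees have finite support, which is what \<^const>\<open>Sum_any\<close> sums over.\<close>

definition bracket_minus_plus :: "rtree \<Rightarrow> rtree \<Rightarrow> ie_alg" where
  "bracket_minus_plus s t =
     (if s = t then bvec Dgr
      else Sum_any (\<lambda>r. Poly_Mapping.single (Dplus r) (of_nat (\<alpha> s t r))) +
           Sum_any (\<lambda>r. Poly_Mapping.single (Dminus r) (of_nat (\<beta> s t r))))"

fun basis_bracket :: "ie_basis \<Rightarrow> ie_basis \<Rightarrow> ie_alg" where
  "basis_bracket (Dplus s) (Dplus t) =
     Sum_any (\<lambda>r. Poly_Mapping.single (Dplus r) (of_nat (\<beta> r s t) - of_nat (\<beta> r t s)))"
| "basis_bracket (Dminus s) (Dminus t) =
     Sum_any (\<lambda>r. Poly_Mapping.single (Dminus r) (of_nat (\<alpha> t r s) - of_nat (\<alpha> s r t)))"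
| "basis_bracket (Dminus s) (Dplus t) = bracket_minus_plus s t"
| "basis_bracket (Dplus t) (Dminus s) = - bracket_minus_plus s t"
| "basis_bracket Dgr (Dminus t) = Poly_Mapping.single (Dminus t) (- of_nat (tsize t))"
| "basis_bracket (Dminus t) Dgr = Poly_Mapping.single (Dminus t) (of_nat (tsize t))"
| "basis_bracket Dgr (Dplus t) = Poly_Mapping.single (Dplus t) (of_nat (tsize t))"
| "basis_bracket (Dplus t) Dgr = Poly_Mapping.single (Dplus t) (- of_nat (tsize t))"
| "basis_bracket Dgr Dgr = 0"

abbreviation ie_bracket :: "ie_alg \<Rightarrow> ie_alg \<Rightarrow> ie_alg" where
  "ie_bracket \<equiv> bilinear_ext basis_bracket"

definition n_plus :: "ie_alg set" where
  "n_plus = span_of (range Dplus)"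

text \<open>Only the values on \<^const>\<open>n_plus\<close> matter; \<open>\<complex>\<close> is the abelian Lie algebra.\<close>

definition n_plus_hom :: "(ie_alg \<Rightarrow> complex) \<Rightarrow> bool" where
  "n_plus_hom \<eta> \<longleftrightarrow>
     (\<forall>x\<in>n_plus. \<forall>y\<in>n_plus. \<eta> (x + y) = \<eta> x + \<eta> y) \<and>
     (\<forall>c. \<forall>x\<in>n_plus. \<eta> (vscale c x) = c * \<eta> x) \<and>
     (\<forall>x\<in>n_plus. \<forall>y\<in>n_plus. \<eta> (ie_bracket x y) = 0)"

definition depth_bounded :: "(ie_alg \<Rightarrow> complex) \<Rightarrow> bool" where
  "depth_bounded \<eta> \<longleftrightarrow> (\<exists>M>0. \<forall>t. M \<le> depth t \<longrightarrow> \<eta> (bvec (Dplus t)) = 0)"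

section \<open>Universal enveloping algebras\<close>

text \<open>The free monoid, whose monoid algebra is the tensor algebra of the space with basis \<open>'b\<close>.\<close>

datatype 'b fword = FWord (letters: "'b list")

instantiation fword :: (type) monoid_add
begin

definition zero_fword :: "'a fword" where
  "zero_fword = FWord []"

definition plus_fword :: "'a fword \<Rightarrow> 'a fword \<Rightarrow> 'a fword" where
  "plus_fword u v = FWord (letters u @ letters v)"

instance
  by standard (simp_all add: zero_fword_def plus_fword_def)

end

definition tensor_algebra :: "'b set \<Rightarrow> ('b fword \<Rightarrow>\<^sub>0 complex) ring" where
  "tensor_algebra B = \<lparr>carrier = {p. \<forall>w\<in>Poly_Mapping.keys p. set (letters w) \<subseteq> B},
     monoid.mult = (*), one = 1, ring.zero = 0, add = (+)\<rparr>"

definition degree_one :: "('b \<Rightarrow>\<^sub>0 complex) \<Rightarrow> ('b fword \<Rightarrow>\<^sub>0 complex)" where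
  "degree_one x = (\<Sum>b\<in>Poly_Mapping.keys x. Poly_Mapping.single (FWord [b]) (Poly_Mapping.lookup x b))"

text \<open>Here the span of \<open>B\<close> is meant to be closed under the bracket; \<open>uea br B\<close> is the
  universal enveloping algebra of this Lie subalgebra.\<close>

definition uea_ideal :: "('b \<Rightarrow> 'b \<Rightarrow> ('b \<Rightarrow>\<^sub>0 complex)) \<Rightarrow> 'b set \<Rightarrow> ('b fword \<Rightarrow>\<^sub>0 complex) set" where
  "uea_ideal br B = Idl\<^bsub>tensor_algebra B\<^esub>
     {degree_one x * degree_one y - degree_one y * degree_one x - degree_one (bilinear_ext br x y)
      | x y. x \<in> span_of B \<and> y \<in> span_of B}"

definition uea :: "('b \<Rightarrow> 'b \<Rightarrow> ('b \<Rightarrow>\<^sub>0 complex)) \<Rightarrow> 'b set \<Rightarrow> ('b fword \<Rightarrow>\<^sub>0 complex) set ring" where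
  "uea br B = tensor_algebra B Quot uea_ideal br B"

definition uea_class ::
    "('b \<Rightarrow> 'b \<Rightarrow> ('b \<Rightarrow>\<^sub>0 complex)) \<Rightarrow> 'b set \<Rightarrow> ('b fword \<Rightarrow>\<^sub>0 complex) \<Rightarrow> ('b fword \<Rightarrow>\<^sub>0 complex) set" where
  "uea_class br B p = uea_ideal br B +>\<^bsub>tensor_algebra B\<^esub> p"

text \<open>The algebra homomorphism from the enveloping algebra of the subalgebra spanned by \<open>B\<close> into
  that of the whole Lie algebra, induced by the inclusion. As in the other maps out of a quotient
  below, the map on representatives induces a single value on each coset, which \<^const>\<open>the_elem\<close>
  extracts.\<close>

definition uea_incl ::
    "('b \<Rightarrow> 'b \<Rightarrow> ('b \<Rightarrow>\<^sub>0 complex)) \<Rightarrow> ('b fword \<Rightarrow>\<^sub>0 complex) set \<Rightarrow> ('b fword \<Rightarrow>\<^sub>0 complex) set" where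
  "uea_incl br X = the_elem (uea_class br UNIV ` X)"

text \<open>The algebra homomorphism from the enveloping algebra to \<open>\<complex>\<close> extending a Lie algebra
  homomorphism \<open>\<eta>\<close>.\<close>

definition word_character :: "(('b \<Rightarrow>\<^sub>0 complex) \<Rightarrow> complex) \<Rightarrow> ('b fword \<Rightarrow>\<^sub>0 complex) \<Rightarrow> complex" where
  "word_character \<eta> p = (\<Sum>w\<in>Poly_Mapping.keys p.
     Poly_Mapping.lookup p w * prod_list (map (\<lambda>b. \<eta> (bvec b)) (letters w)))"

definition uea_character ::
    "(('b \<Rightarrow>\<^sub>0 complex) \<Rightarrow> complex) \<Rightarrow> ('b fword \<Rightarrow>\<^sub>0 complex) set \<Rightarrow> complex" where
  "uea_character \<eta> X = the_elem (word_character \<eta> ` X)"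

section \<open>Tensor products over a ring\<close>

definition complex_ring :: "complex ring" where
  "complex_ring = \<lparr>carrier = UNIV, monoid.mult = (*), one = 1, ring.zero = 0, add = (+)\<rparr>"

text \<open>Tensor product over \<open>A\<close> of a right module \<open>M\<close> and a left module \<open>N\<close>, whose actions are
  \<open>ract\<close> and \<open>lact\<close>. As a quotient of \<^const>\<open>free_Abelian_group\<close> it is written multiplicatively.\<close>

definition tensor_relations ::
    "('a, 'x) ring_scheme \<Rightarrow> ('m, 'y) ring_scheme \<Rightarrow> ('m \<Rightarrow> 'a \<Rightarrow> 'm)
     \<Rightarrow> ('n, 'z) ring_scheme \<Rightarrow> ('a \<Rightarrow> 'n \<Rightarrow> 'n) \<Rightarrow> ('m \<times> 'n \<Rightarrow>\<^sub>0 int) set" where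
  "tensor_relations A M ract N lact =
     {frag_of (m \<oplus>\<^bsub>M\<^esub> m', n) - frag_of (m, n) - frag_of (m', n)
      | m m' n. m \<in> carrier M \<and> m' \<in> carrier M \<and> n \<in> carrier N} \<union>
     {frag_of (m, n \<oplus>\<^bsub>N\<^esub> n') - frag_of (m, n) - frag_of (m, n')
      | m n n'. m \<in> carrier M \<and> n \<in> carrier N \<and> n' \<in> carrier N} \<union>
     {frag_of (ract m a, n) - frag_of (m, lact a n)
      | m a n. m \<in> carrier M \<and> a \<in> carrier A \<and> n \<in> carrier N}"

definition tensor_kernel ::
    "('a, 'x) ring_scheme \<Rightarrow> ('m, 'y) ring_scheme \<Rightarrow> ('m \<Rightarrow> 'a \<Rightarrow> 'm)
     \<Rightarrow> ('n, 'z) ring_scheme \<Rightarrow> ('a \<Rightarrow> 'n \<Rightarrow> 'n) \<Rightarrow> ('m \<times> 'n \<Rightarrow>\<^sub>0 int) set" where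
  "tensor_kernel A M ract N lact =
     generate (free_Abelian_group (carrier M \<times> carrier N)) (tensor_relations A M ract N lact)"

definition tensor_product ::
    "('a, 'x) ring_scheme \<Rightarrow> ('m, 'y) ring_scheme \<Rightarrow> ('m \<Rightarrow> 'a \<Rightarrow> 'm)
     \<Rightarrow> ('n, 'z) ring_scheme \<Rightarrow> ('a \<Rightarrow> 'n \<Rightarrow> 'n) \<Rightarrow> ('m \<times> 'n \<Rightarrow>\<^sub>0 int) set monoid" where
  "tensor_product A M ract N lact =
     free_Abelian_group (carrier M \<times> carrier N) Mod tensor_kernel A M ract N lact"

text \<open>The endomorphism of the tensor product induced by an endomorphism \<open>\<phi>\<close> of the right module.\<close>

definition tensor_map_left ::
    "('a, 'x) ring_scheme \<Rightarrow> ('m, 'y) ring_scheme \<Rightarrow> ('m \<Rightarrow> 'a \<Rightarrow> 'm)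
     \<Rightarrow> ('n, 'z) ring_scheme \<Rightarrow> ('a \<Rightarrow> 'n \<Rightarrow> 'n) \<Rightarrow> ('m \<Rightarrow> 'm)
     \<Rightarrow> ('m \<times> 'n \<Rightarrow>\<^sub>0 int) set \<Rightarrow> ('m \<times> 'n \<Rightarrow>\<^sub>0 int) set" where
  "tensor_map_left A M ract N lact \<phi> X =
     the_elem ((\<lambda>f. tensor_kernel A M ract N lact
                   #>\<^bsub>free_Abelian_group (carrier M \<times> carrier N)\<^esub>
                   frag_extend (\<lambda>(m, n). frag_of (\<phi> m, n)) f) ` X)"

section \<open>Lie algebra modules\<close>

text \<open>In a \<open>module\<close> record the fields \<open>mult\<close> and \<open>one\<close> are irrelevant.\<close>

record ('g, 'v) lie_module = "(complex, 'v) module" +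
  act :: "'g \<Rightarrow> 'v \<Rightarrow> 'v"

definition is_lie_module ::
    "('b \<Rightarrow> 'b \<Rightarrow> ('b \<Rightarrow>\<^sub>0 complex)) \<Rightarrow> ('b \<Rightarrow>\<^sub>0 complex, 'v) lie_module \<Rightarrow> bool" where
  "is_lie_module br V \<longleftrightarrow>
     Module.module complex_ring V \<and>
     (\<forall>x. \<forall>v\<in>carrier V. act V x v \<in> carrier V) \<and>
     (\<forall>x. \<forall>v\<in>carrier V. \<forall>w\<in>carrier V. act V x (v \<oplus>\<^bsub>V\<^esub> w) = act V x v \<oplus>\<^bsub>V\<^esub> act V x w) \<and>
     (\<forall>x c. \<forall>v\<in>carrier V. act V x (c \<odot>\<^bsub>V\<^esub> v) = c \<odot>\<^bsub>V\<^esub> act V x v) \<and>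
     (\<forall>x y. \<forall>v\<in>carrier V. act V (x + y) v = act V x v \<oplus>\<^bsub>V\<^esub> act V y v) \<and>
     (\<forall>c x. \<forall>v\<in>carrier V. act V (vscale c x) v = c \<odot>\<^bsub>V\<^esub> act V x v) \<and>
     (\<forall>x y. \<forall>v\<in>carrier V. act V (bilinear_ext br x y) v =
        act V x (act V y v) \<ominus>\<^bsub>V\<^esub> act V y (act V x v))"

definition lie_submodule :: "'v set \<Rightarrow> ('g, 'v) lie_module \<Rightarrow> bool" where
  "lie_submodule W V \<longleftrightarrow> submodule W complex_ring V \<and> (\<forall>x. \<forall>w\<in>W. act V x w \<in> W)"

definition simple_lie_module ::
    "('b \<Rightarrow> 'b \<Rightarrow> ('b \<Rightarrow>\<^sub>0 complex)) \<Rightarrow> ('b \<Rightarrow>\<^sub>0 complex, 'v) lie_module \<Rightarrow> bool" where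
  "simple_lie_module br V \<longleftrightarrow>
     is_lie_module br V \<and> carrier V \<noteq> {\<zero>\<^bsub>V\<^esub>} \<and>
     (\<forall>W. lie_submodule W V \<longrightarrow> W = {\<zero>\<^bsub>V\<^esub>} \<or> W = carrier V)"

definition one_dimensional :: "'v set \<Rightarrow> ('g, 'v) lie_module \<Rightarrow> bool" where
  "one_dimensional W V \<longleftrightarrow> submodule W complex_ring V \<and>
     (\<exists>w\<in>W. w \<noteq> \<zero>\<^bsub>V\<^esub> \<and> W = {c \<odot>\<^bsub>V\<^esub> w | c. True})"

definition whittaker_vectors :: "(ie_alg \<Rightarrow> complex) \<Rightarrow> (ie_alg, 'v) lie_module \<Rightarrow> 'v set" where
  "whittaker_vectors \<eta> V = {v \<in> carrier V. \<forall>x\<in>n_plus. act V x v = \<eta> x \<odot>\<^bsub>V\<^esub> v}"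

section \<open>The standard Whittaker module\<close>

type_synonym ie_uea = "(ie_basis fword \<Rightarrow>\<^sub>0 complex) set"

abbreviation U_g :: "ie_uea ring" where
  "U_g \<equiv> uea basis_bracket UNIV"

abbreviation U_n_plus :: "ie_uea ring" where
  "U_n_plus \<equiv> uea basis_bracket (range Dplus)"

definition right_mult :: "ie_uea \<Rightarrow> ie_uea \<Rightarrow> ie_uea" where
  "right_mult u a = u \<otimes>\<^bsub>U_g\<^esub> uea_incl basis_bracket a"

definition eta_mult :: "(ie_alg \<Rightarrow> complex) \<Rightarrow> ie_uea \<Rightarrow> complex \<Rightarrow> complex" where
  "eta_mult \<eta> a z = uea_character \<eta> a * z"

definition whittaker_tensor :: "(ie_alg \<Rightarrow> complex) \<Rightarrow> (ie_uea \<times> complex \<Rightarrow>\<^sub>0 int) set monoid" where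
  "whittaker_tensor \<eta> = tensor_product U_n_plus U_g right_mult complex_ring (eta_mult \<eta>)"

definition U_act ::
    "(ie_alg \<Rightarrow> complex) \<Rightarrow> ie_uea \<Rightarrow> (ie_uea \<times> complex \<Rightarrow>\<^sub>0 int) set \<Rightarrow> (ie_uea \<times> complex \<Rightarrow>\<^sub>0 int) set" where
  "U_act \<eta> u = tensor_map_left U_n_plus U_g right_mult complex_ring (eta_mult \<eta>)
     (\<lambda>m. u \<otimes>\<^bsub>U_g\<^esub> m)"

definition whittaker_module ::
    "(ie_alg \<Rightarrow> complex) \<Rightarrow> (ie_alg, (ie_uea \<times> complex \<Rightarrow>\<^sub>0 int) set) lie_module" where
  "whittaker_module \<eta> =
     \<lparr>carrier = carrier (whittaker_tensor \<eta>),
      monoid.mult = undefined, one = undefined,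
      ring.zero = \<one>\<^bsub>whittaker_tensor \<eta>\<^esub>,
      add = monoid.mult (whittaker_tensor \<eta>),
      smult = (\<lambda>c. U_act \<eta> (uea_class basis_bracket UNIV (Poly_Mapping.single 0 c))),
      act = (\<lambda>x. U_act \<eta> (uea_class basis_bracket UNIV (degree_one x)))\<rparr>"

end

theory Submission
  imports Defs "HOL-Library.Multiset" "HOL-Library.Nat_Bijection" "HOL-Computational_Algebra.Polynomial"
begin

text \<open>Let \<open>w\<close> be the canonical generator of the Whittaker module. It is spanned by the vectors
  \<open>f_1 \<dots> f_k p(d) w\<close>, where the \<open>f_i\<close> are letters \<open>D_t\<^sup>-\<close> and \<open>p\<close> is a polynomial. Choose \<open>t0\<close> of maximal
  depth among the trees with \<open>\<eta>(D_t0\<^sup>+) \<noteq> 0\<close>, and let \<open>S_t\<close> be \<open>t0\<close> with \<open>t\<close> hung at a vertex of maximal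
  depth. If cutting branches off \<open>S_t\<close> leaves a tree on which \<open>\<eta>\<close> does not vanish, then this tree does not
  meet the copy of \<open>t\<close>, so it is smaller than \<open>t0\<close> or equal to \<open>t0\<close>. Therefore, to leading order,
  \<open>D^+\<close> at \<open>S_t\<close> acts as a nonzero multiple of differentiation by the letter \<open>D_t\<^sup>-\<close>.
  Such operators reduce any nonzero formal combination of the spanning vectors to some \<open>p(d) w\<close> with \<open>p \<noteq> 0\<close>, and \<open>D^+\<close> at \<open>t0\<close>, minus its eigenvalue, lowers the degree of \<open>p\<close> by one. So
  every nonzero vector generates \<open>w\<close>, and only multiples of \<open>w\<close> are Whittaker vectors.

  Linear independence of the spanning vectors is never used, only \<open>w \<noteq> 0\<close>. For this a module with a
  Whittaker vector of type \<open>\<eta>\<close> suffices: the dual of the natural representation on the space of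
  rooted trees, which is free of rank one over the enveloping algebra of \<open>n\<^sup>+\<close>.\<close>

text \<open>The statement speaks of isomorphism classes of graphs, the argument needs recursion over
  branches. So rooted trees are first identified with hereditary multisets, under which \<alpha> and
  \<beta> become multiplicities in \<open>cuts\<close> and \<open>graft\<close>. Why a remainder of
  \<open>S_t\<close> with nonzero \<eta> avoids the copy of \<open>t\<close>: being connected to the
  root, a remainder that meets the copy contains its root, one level deeper than \<open>t0\<close>
  reaches, and such trees are killed by the choice of \<open>t0\<close>. A cut that removes the
  hanging vertex leaves less than \<open>t0\<close>. The degree of \<open>p\<close> drops because
  \<open>D^+\<close> at \<open>z\<close> passes \<open>p(d)\<close> as \<open>p(d - |z|)\<close>: at
  \<open>t0\<close> this yields the finite difference \<open>p(d - |t0|) - p(d)\<close>, times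
  \<eta> at \<open>t0\<close>. The reduction is purely formal: nonzero coefficients are turned into
  nonzero coefficients until 1 is reached modulo the annihilator of \<open>w\<close>. Hence a
  combination that vanished in the module would put 1 into the annihilator, and
  \<open>w \<noteq> 0\<close> is all that remains. It is shown by a linear functional that respects
  the tensor relations; the recursion defining it on forests is consistent because \<eta> vanishes
  on brackets.\<close>

section \<open>Rooted trees as an inductive type\<close>

datatype mtree = Node (branches: "mtree multiset")

primrec msize :: "mtree \<Rightarrow> nat" where
  "msize (Node F) = Suc (sum_mset (image_mset msize F))"

primrec mheight :: "mtree \<Rightarrow> nat" where
  "mheight (Node F) = Max (insert 0 (Suc ` set_mset (image_mset mheight F)))"

lemma msize_pos [simp]: "0 < msize t"
  by (cases t) simp

lemma msize_branch: "c \<in># F \<Longrightarrow> msize c < msize (Node F)"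
  by (auto dest!: multi_member_split)

text \<open>One entry for each vertex of the second tree, so that the multiplicities are the numbers
  \<beta>.\<close>

function graft :: "mtree \<Rightarrow> mtree \<Rightarrow> mtree multiset" where
  "graft t (Node F) = add_mset (Node (add_mset t F))
     (\<Sum>c\<in>#F. image_mset (\<lambda>c'. Node (add_mset c' (F - {#c#}))) (graft t c))"
  by pat_completeness auto
termination by (relation "measure (\<lambda>(t, u). msize u)") (use msize_branch in auto)

text \<open>One entry for each edge, as the pair of pruned part and root part, so that the
  multiplicities are the numbers \<alpha>.\<close>

function cuts :: "mtree \<Rightarrow> (mtree \<times> mtree) multiset" where
  "cuts (Node F) =
     (\<Sum>c\<in>#F. add_mset (c, Node (F - {#c#}))
        (image_mset (\<lambda>(p, q). (p, Node (add_mset q (F - {#c#})))) (cuts c)))"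
  by pat_completeness auto
termination by (relation "measure msize") (use msize_branch in auto)

section \<open>Parent functions of rooted trees\<close>

text \<open>The number bounds the depth of the unfolding; this makes the recursion over children
  primitive before they are known to be well founded.\<close>

primrec code_upto :: "('a \<Rightarrow> 'a set) \<Rightarrow> nat \<Rightarrow> 'a \<Rightarrow> mtree" where
  "code_upto K 0 v = Node {#}"
| "code_upto K (Suc n) v = Node (image_mset (code_upto K n) (mset_set (K v)))"

definition kids :: "'a rgraph \<Rightarrow> ('a \<Rightarrow> 'a) \<Rightarrow> 'a \<Rightarrow> 'a set" where
  "kids G p v = {c \<in> verts G - {troot G}. p c = v}"

definition code_fun :: "'a rgraph \<Rightarrow> ('a \<Rightarrow> 'a) \<Rightarrow> ('a \<Rightarrow> mtree) \<Rightarrow> bool" where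
  "code_fun G p g \<longleftrightarrow> (\<forall>v\<in>verts G. g v = Node (image_mset g (mset_set (kids G p v))))"

definition tree_code :: "'a rgraph \<Rightarrow> ('a \<Rightarrow> 'a) \<Rightarrow> 'a \<Rightarrow> mtree" where
  "tree_code G p = (SOME g. code_fun G p g)"

text \<open>The rank stands in for acyclicity: it grows by one from parent to child, so induction
  along \<open>p\<close> needs no graph theory. Edges are tied to \<open>p\<close> only in
  \<open>parent_graph\<close>, because \<open>cycle_from_extra_edge\<close> must apply while further
  edges are still conceivable.\<close>

locale parent_fun =
  fixes G :: "'a rgraph" and p :: "'a \<Rightarrow> 'a" and h :: "'a \<Rightarrow> nat"
  assumes fin: "finite (verts G)"
    and root_in: "troot G \<in> verts G"
    and h_root: "h (troot G) = 0"
    and p_in: "v \<in> verts G \<Longrightarrow> v \<noteq> troot G \<Longrightarrow> p v \<in> verts G"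
    and h_p: "v \<in> verts G \<Longrightarrow> v \<noteq> troot G \<Longrightarrow> h v = Suc (h (p v))"
begin

abbreviation "V \<equiv> verts G"
abbreviation "r \<equiv> troot G"
abbreviation "K \<equiv> kids G p"

lemma fin_K [simp]: "finite (K v)"
  using fin by (simp add: kids_def)

lemma K_D: "c \<in> K v \<Longrightarrow> c \<in> V \<and> c \<noteq> r \<and> p c = v \<and> h c = Suc (h v)"
  using h_p by (auto simp: kids_def)

lemma h_le_Max: "v \<in> V \<Longrightarrow> h v \<le> Max (h ` V)"
  using fin by simp

text \<open>Induction from the leaves: ranks are bounded on a finite vertex set, so the distance to
  the maximal rank shrinks from a vertex to its children.\<close>

lemma kids_induct [consumes 1, case_names kids]:
  assumes "v \<in> V" and step: "\<And>v. v \<in> V \<Longrightarrow> (\<And>c. c \<in> K v \<Longrightarrow> P c) \<Longrightarrow> P v"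
  shows "P v"
  using assms(1)
proof (induction "Max (h ` V) - h v" arbitrary: v rule: less_induct)
  case less
  show ?case
  proof (rule step[OF less.prems])
    fix c assume c: "c \<in> K v"
    then have "h c \<le> Max (h ` V)" "h c = Suc (h v)" "c \<in> V"
      using K_D[OF c] h_le_Max[of c] by auto
    then show "P c"
      by (intro less.hyps) auto
  qed
qed

lemma code_fun_tree_code: "code_fun G p (tree_code G p)"
proof -
  \<comment> \<open>The unfolding bound drops by exactly one from a vertex to its children and is
    positive at every vertex, so the case 0 of \<open>code_upto\<close> is never reached.\<close>
  define g where "g v = code_upto K (Suc (Max (h ` V)) - h v) v" for v
  have "g v = Node (image_mset g (mset_set (K v)))" if v: "v \<in> V" for v
  proof -
    have "code_upto K (Suc (Max (h ` V)) - h v) v =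
        Node (image_mset (code_upto K (Max (h ` V) - h v)) (mset_set (K v)))"
      using h_le_Max[OF v] by (simp add: Suc_diff_le)
    moreover have "code_upto K (Max (h ` V) - h v) c = g c" if "c \<in> K v" for c
      using K_D[OF that] by (simp add: g_def)
    moreover have "image_mset (code_upto K (Max (h ` V) - h v)) (mset_set (K v)) =
        image_mset g (mset_set (K v))"
      by (rule image_mset_cong) (use calculation(2) in simp)
    ultimately show ?thesis
      by (simp add: g_def)
  qed
  then have "code_fun G p g"
    by (simp add: code_fun_def)
  then show ?thesis
    unfolding tree_code_def by (rule someI[where P = "code_fun G p"])
qed

abbreviation "code \<equiv> tree_code G p"

lemma code_eq: "v \<in> V \<Longrightarrow> code v = Node (image_mset code (mset_set (K v)))"
  using code_fun_tree_code by (simp add: code_fun_def)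

text \<open>Codes are later computed by exhibiting some other function that satisfies the same
  recursion.\<close>

lemma code_unique:
  assumes "code_fun G p g" "v \<in> V"
  shows "g v = code v"
  using assms(2)
proof (induction rule: kids_induct)
  case (kids v)
  have "image_mset g (mset_set (K v)) = image_mset code (mset_set (K v))"
    by (rule image_mset_cong) (use kids in auto)
  then show ?case
    using kids assms(1) code_eq by (simp add: code_fun_def)
qed

text \<open>An edge determines its lower endpoint, the one of larger rank. This lets \<alpha> be
  counted over vertices instead of edges.\<close>

lemma inj_parent_edge: "inj_on (\<lambda>v. {v, p v}) (V - {r})"
proof (rule inj_onI)
  fix u v assume uv: "u \<in> V - {r}" "v \<in> V - {r}" "{u, p u} = {v, p v}"
  have "h u = Suc (h (p u))" "h v = Suc (h (p v))"
    using h_p uv by auto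
  then show "u = v"
    using uv(3) by (metis doubleton_eq_iff n_not_Suc_n less_irrefl lessI not_less_eq less_SucI)
qed

text \<open>The subtree at \<open>x\<close>. Fixing the number of steps by the ranks avoids a
  transitive closure and makes the subtrees of siblings visibly disjoint.\<close>

definition desc :: "'a \<Rightarrow> 'a set" where
  "desc x = {v \<in> V. h x \<le> h v \<and> (p ^^ (h v - h x)) v = x}"

lemma iter_p: "v \<in> V \<Longrightarrow> k \<le> h v \<Longrightarrow> (p ^^ k) v \<in> V \<and> h ((p ^^ k) v) = h v - k"
proof (induction k)
  case (Suc k)
  then have *: "(p ^^ k) v \<in> V" "h ((p ^^ k) v) = h v - k" by auto
  then have "(p ^^ k) v \<noteq> r"
    using Suc.prems h_root by force
  then show ?case
    using * p_in h_p[of "(p ^^ k) v"] by auto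
qed simp

lemma h0: "v \<in> V \<Longrightarrow> h v = 0 \<longleftrightarrow> v = r"
  using h_p h_root by force

lemma desc_root: "desc r = V"
proof -
  have "(p ^^ h v) v = r" if "v \<in> V" for v
    using iter_p[OF that, of "h v"] h0 by auto
  then show ?thesis
    by (auto simp: desc_def h_root)
qed

lemma desc_self: "x \<in> V \<Longrightarrow> x \<in> desc x"
  by (simp add: desc_def)

lemma desc_sub: "desc x \<subseteq> V"
  by (auto simp: desc_def)

lemma fin_desc [simp]: "finite (desc x)"
  using fin desc_sub finite_subset by blast

lemma desc_p: 
  assumes "v \<in> V" "v \<noteq> r" "v \<noteq> x"
  shows "v \<in> desc x \<longleftrightarrow> p v \<in> desc x"
proof -
  have h: "h v = Suc (h (p v))" "p v \<in> V" using h_p p_in assms by auto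
  show ?thesis
  proof (cases "h x \<le> h (p v)")
    case True
    then have "h v - h x = Suc (h (p v) - h x)"
      using h by simp
    then have "(p ^^ (h v - h x)) v = (p ^^ (h (p v) - h x)) (p v)"
      by (simp add: funpow_Suc_right del: funpow.simps)
    then show ?thesis
      using True h assms by (simp add: desc_def)
  next
    case False
    then have "h x \<le> h v \<Longrightarrow> h x = h v" using h by simp
    then show ?thesis
      using False assms h by (auto simp: desc_def)
  qed
qed

lemma desc_kid: "x \<in> V \<Longrightarrow> c \<in> K x \<Longrightarrow> desc c \<subseteq> desc x - {x}"
proof
  fix v assume x: "x \<in> V" and c: "c \<in> K x" and v: "v \<in> desc c"
  have hc: "h c = Suc (h x)" "p c = x" using K_D[OF c] by auto
  have v': "v \<in> V" "h c \<le> h v" "(p ^^ (h v - h c)) v = c"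
    using v by (auto simp: desc_def)
  have "h v - h x = Suc (h v - h c)"
    using hc v' by simp
  then have "(p ^^ (h v - h x)) v = x"
    using v' hc by simp
  then show "v \<in> desc x - {x}"
    using v' hc by (auto simp: desc_def)
qed

lemma desc_unfold: 
  assumes "x \<in> V"
  shows "desc x = insert x (\<Union>c\<in>K x. desc c)"
proof
  show "insert x (\<Union>c\<in>K x. desc c) \<subseteq> desc x"
    using desc_kid[OF assms] desc_self[OF assms] by auto
  show "desc x \<subseteq> insert x (\<Union>c\<in>K x. desc c)"
  proof
    fix v assume v: "v \<in> desc x"
    then have v': "v \<in> V" "h x \<le> h v" "(p ^^ (h v - h x)) v = x"
      by (auto simp: desc_def)
    show "v \<in> insert x (\<Union>c\<in>K x. desc c)"
    proof (cases "h v - h x")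
      case 0 then show ?thesis using v' by simp
    next
      case (Suc k)
      \<comment> \<open>The ancestor of \<open>v\<close> one level below \<open>x\<close>.\<close>
      define c where "c = (p ^^ k) v"
      have c: "c \<in> V" "h c = h v - k" "h v - k = Suc (h x)"
        using iter_p[of v k] v' Suc by (auto simp: c_def)
      have "p c = x"
        using v' Suc by (simp add: c_def)
      then have "c \<in> K x"
        using c h_root by (auto simp: kids_def)
      moreover have "v \<in> desc c"
      proof -
        have "h v - h c = k" using c Suc by simp
        then show ?thesis
          using c v' by (auto simp: desc_def c_def)
      qed
      ultimately show ?thesis by auto
    qed
  qed
qed

lemma desc_disjoint:
  assumes "c \<in> K x" "c' \<in> K x" "c \<noteq> c'"
  shows "desc c \<inter> desc c' = {}"
  using assms K_D[OF assms(1)] K_D[OF assms(2)] by (auto simp: desc_def)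

lemma mset_desc:
  assumes "x \<in> V"
  shows "mset_set (desc x) = add_mset x (\<Sum>c\<in>#mset_set (K x). mset_set (desc c))"
proof -
  have "mset_set (\<Union>c\<in>C. desc c) = (\<Sum>c\<in>#mset_set C. mset_set (desc c))"
    if C: "finite C" "C \<subseteq> K x" for C
    using C
  proof (induction C rule: finite_induct)
    case (insert c C)
    have "desc c \<inter> (\<Union>c\<in>C. desc c) = {}"
      using desc_disjoint insert by blast
    then have "mset_set (desc c \<union> (\<Union>c\<in>C. desc c)) = mset_set (desc c) + mset_set (\<Union>c\<in>C. desc c)"
      using insert by (intro mset_set_Union) auto
    then show ?case
      using insert by simp
  qed simp
  moreover have "x \<notin> (\<Union>c\<in>K x. desc c)"
    using desc_kid[OF assms] by auto
  ultimately show ?thesis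
    using desc_unfold[OF assms] by (simp add: fin_K)
qed

lemma msize_code:
  assumes "x \<in> V" shows "msize (code x) = card (desc x)"
  using assms
proof (induction rule: kids_induct)
  case (kids x)
  have "card (desc x) = size (mset_set (desc x))" by simp
  also have "\<dots> = Suc (\<Sum>c\<in>#mset_set (K x). card (desc c))"
    by (simp add: mset_desc[OF kids(1)] image_mset.compositionality comp_def)
  also have "(\<Sum>c\<in>#mset_set (K x). card (desc c)) = (\<Sum>c\<in>#mset_set (K x). msize (code c))"
    using kids(2) by (intro arg_cong[of _ _ sum_mset] image_mset_cong) auto
  finally show ?case
    by (simp add: code_eq[OF kids(1)] image_mset.compositionality comp_def)
qed

end

section \<open>Walks, reachability and cycles in graphs with a parent function\<close>

lemma walk_single: "u \<in> verts G \<Longrightarrow> walk G [u]"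
  by (simp add: walk_def)

lemma walk_snoc:
  "walk G w \<Longrightarrow> {last w, b} \<in> edges G \<Longrightarrow> b \<in> verts G \<Longrightarrow> walk G (w @ [b])"
  by (auto simp: walk_def successively_append_iff)

lemma walk_rev: "walk G w \<Longrightarrow> walk G (rev w)"
proof -
  have eq: "(\<lambda>x y. {y, x} \<in> edges G) = (\<lambda>x y. {x, y} \<in> edges G)"
    by (intro ext) (metis insert_commute)
  show "walk G w \<Longrightarrow> walk G (rev w)"
    unfolding walk_def successively_rev eq by simp
qed

lemma reachable_refl: "u \<in> verts G \<Longrightarrow> u \<in> reachable G u"
  unfolding reachable_def using walk_single[of u G] by (intro CollectI exI[of _ "[u]"]) simp

lemma reachable_step:
  "a \<in> reachable G u \<Longrightarrow> {a, b} \<in> edges G \<Longrightarrow> b \<in> verts G \<Longrightarrow> b \<in> reachable G u"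
  unfolding reachable_def
proof (elim CollectE exE conjE, intro CollectI)
  fix w assume "{a, b} \<in> edges G" "b \<in> verts G" "walk G w" "hd w = u" "last w = a"
  then show "\<exists>w. walk G w \<and> hd w = u \<and> last w = b"
    by (intro exI[of _ "w @ [b]"]) (auto simp: walk_def successively_append_iff)
qed

lemma reachable_subset_closed:
  assumes "u \<in> S" "\<And>a b. a \<in> S \<Longrightarrow> a \<in> verts G \<Longrightarrow> b \<in> verts G \<Longrightarrow> {a, b} \<in> edges G \<Longrightarrow> b \<in> S"
  shows "reachable G u \<subseteq> S \<inter> verts G"
proof
  fix v assume "v \<in> reachable G u"
  then obtain w where w: "walk G w" "hd w = u" "last w = v"
    by (auto simp: reachable_def)
  have "w \<noteq> [] \<Longrightarrow> set w \<subseteq> verts G \<Longrightarrow> successively (\<lambda>u v. {u, v} \<in> edges G) w \<Longrightarrow> hd w = u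
    \<Longrightarrow> last w \<in> S \<inter> verts G" for w
  proof (induction w rule: rev_induct)
    case (snoc b w)
    then show ?case
      using assms by (cases "w = []") (auto simp: successively_append_iff)
  qed simp
  then show "v \<in> S \<inter> verts G"
    using w by (auto simp: walk_def)
qed

lemma reachable_trans:
  "a \<in> reachable G u \<Longrightarrow> b \<in> reachable G a \<Longrightarrow> b \<in> reachable G u"
  using reachable_subset_closed[of a "reachable G u" G] reachable_step[of _ G u] by (metis IntD1 subsetD)

lemma reachable_sym: "a \<in> reachable G u \<Longrightarrow> u \<in> reachable G a"
  unfolding reachable_def
proof (elim CollectE exE conjE, intro CollectI)
  fix w assume "walk G w" "hd w = u" "last w = a"
  then show "\<exists>w. walk G w \<and> hd w = a \<and> last w = u"
    using walk_rev[of G w] by (intro exI[of _ "rev w"]) (simp add: hd_rev last_rev)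
qed

context parent_fun
begin

definition up_path :: "'a \<Rightarrow> nat \<Rightarrow> 'a list" where
  "up_path v n = map (\<lambda>i. (p ^^ i) v) [0..<n]"

lemma up_path_distinct: "v \<in> V \<Longrightarrow> n \<le> Suc (h v) \<Longrightarrow> distinct (up_path v n)"
proof -
  assume v: "v \<in> V" and n: "n \<le> Suc (h v)"
  have "inj_on (\<lambda>i. (p ^^ i) v) {0..<n}"
  proof (rule inj_onI)
    fix i j assume ij: "i \<in> {0..<n}" "j \<in> {0..<n}" "(p ^^ i) v = (p ^^ j) v"
    then have "h v - i = h v - j" "i \<le> h v" "j \<le> h v"
      using iter_p[OF v, of i] iter_p[OF v, of j] n by auto
    then show "i = j" by simp
  qed
  then show ?thesis
    by (simp add: up_path_def distinct_map)
qed

lemma up_path_in: "v \<in> V \<Longrightarrow> n \<le> Suc (h v) \<Longrightarrow> set (up_path v n) \<subseteq> V"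
  using iter_p by (auto simp: up_path_def)

lemma up_path_succ:
  assumes "v \<in> V" "n \<le> Suc (h v)" and E: "\<And>v. v \<in> V \<Longrightarrow> v \<noteq> r \<Longrightarrow> {v, p v} \<in> E"
  shows "successively (\<lambda>u v. {u, v} \<in> E) (up_path v n)"
  unfolding successively_conv_nth
proof safe
  fix i assume "Suc i < length (up_path v n)"
  then have i: "Suc i < n" by (simp add: up_path_def)
  then have "(p ^^ i) v \<in> V" "h ((p ^^ i) v) = h v - i" "i < h v"
    using iter_p[OF assms(1), of i] assms(2) by auto
  then show "{up_path v n ! i, up_path v n ! Suc i} \<in> E"
    using i E[of "(p ^^ i) v"] h_root by (force simp: up_path_def simp del: upt_Suc)
qed

lemma iter_p_root: "v \<in> V \<Longrightarrow> (p ^^ h v) v = r"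
  using iter_p[of v "h v"] h0 by auto

text \<open>Climb from \<open>a\<close> and from \<open>b\<close> until the two chains first meet.
  The chains are simple and disjoint before that point, and the extra edge closes them to a
  cycle.\<close>

lemma cycle_from_extra_edge:
  assumes E: "\<And>v. v \<in> V \<Longrightarrow> v \<noteq> r \<Longrightarrow> {v, p v} \<in> edges G"
    and ab: "a \<in> V" "b \<in> V" "a \<noteq> b" "{a, b} \<in> edges G"
    and new: "{a, b} \<notin> (\<lambda>v. {v, p v}) ` (V - {r})"
  shows "\<exists>c. graph_cycle G c"
proof -
  define B where "B = {(p ^^ j) b | j. j \<le> h b}"
  have "(p ^^ h a) a \<in> B"
    using iter_p_root ab by (auto simp: B_def intro!: exI[of _ "h b"])
  \<comment> \<open>\<open>B\<close> consists of the ancestors of \<open>b\<close>; minimality of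
    \<open>k\<close> keeps the chain from \<open>a\<close> away from \<open>B\<close> until its last
    vertex.\<close>
  define k where "k = (LEAST k. (p ^^ k) a \<in> B)"
  have kB: "(p ^^ k) a \<in> B" and k_le: "k \<le> h a" and k_min: "\<And>i. i < k \<Longrightarrow> (p ^^ i) a \<notin> B"
    unfolding k_def using \<open>(p ^^ h a) a \<in> B\<close>
    by (auto intro: LeastI Least_le dest: not_less_Least)
  then obtain j where j: "j \<le> h b" "(p ^^ k) a = (p ^^ j) b"
    by (auto simp: B_def)
  let ?c = "up_path a (Suc k) @ rev (up_path b j)"
  have B_eq: "set (up_path b j) \<subseteq> B"
    using j by (auto simp: B_def up_path_def)
  have xnot: "(p ^^ k) a \<notin> set (up_path b j)"
  proof
    assume "(p ^^ k) a \<in> set (up_path b j)"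
    then obtain i where i: "i < j" "(p ^^ j) b = (p ^^ i) b"
      using j by (auto simp: up_path_def)
    then show False
      using iter_p[OF ab(2), of i] iter_p[OF ab(2), of j] j by auto
  qed
  have "set (up_path a (Suc k)) \<inter> set (up_path b j) = {}"
  proof -
    have "set (up_path a (Suc k)) = insert ((p ^^ k) a) {(p ^^ i) a | i. i < k}"
      by (auto simp: up_path_def less_Suc_eq)
    then show ?thesis
      using B_eq k_min xnot by auto
  qed
  then have dist: "distinct ?c"
    using up_path_distinct ab k_le j by auto
  have succ: "successively (\<lambda>u v. {u, v} \<in> edges G) ?c"
  proof -
    have s1: "successively (\<lambda>u v. {u, v} \<in> edges G) (up_path a (Suc k))"
      by (rule up_path_succ) (use E ab k_le in auto)
    have s2: "successively (\<lambda>u v. {u, v} \<in> edges G) (rev (up_path b j))"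
      unfolding successively_rev
      using up_path_succ[OF ab(2), of j "edges G"] E j by (simp add: insert_commute)
    have "{last (up_path a (Suc k)), hd (rev (up_path b j))} \<in> edges G" if ne: "up_path b j \<noteq> []"
    proof -
      obtain i where i: "j = Suc i"
        using ne by (cases j) (simp_all add: up_path_def)
      have "(p ^^ i) b \<in> V" "h ((p ^^ i) b) = h b - i"
        using iter_p[OF ab(2), of i] i j by auto
      then have "{(p ^^ i) b, p ((p ^^ i) b)} \<in> edges G"
        using E i j h_root by force
      then show ?thesis
        using i j by (simp add: up_path_def hd_rev insert_commute)
    qed
    then show ?thesis
      using s1 s2 by (auto simp: successively_append_iff)
  qed
  have "hd ?c = a"
    by (simp add: up_path_def hd_append upt_conv_Cons del: upt_Suc)
  moreover have "last ?c = b"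
  proof (cases j)
    case 0 then show ?thesis using j by (simp add: up_path_def)
  next
    case (Suc i) then show ?thesis
      by (simp add: up_path_def last_rev upt_conv_Cons del: upt_Suc)
  qed
  \<comment> \<open>A shorter list would mean that \<open>a\<close> and \<open>b\<close> coincide or
    that one is the parent of the other, and then \<open>{a, b}\<close> would be a parent
    edge.\<close>
  moreover have "3 \<le> length ?c"
  proof (rule ccontr)
    assume "\<not> 3 \<le> length ?c"
    then have "k + j < 2"
      by (simp add: up_path_def)
    then consider "k = 0" "j = 0" | "k = 1" "j = 0" | "k = 0" "j = 1"
      by linarith
    then show False
    proof cases
      case 1 then show ?thesis using j ab by simp
    next
      case 2
      then have "p a = b" "a \<noteq> r" using j k_le h_root by auto
      then show ?thesis using new ab by auto
    next
      case 3
      then have "p b = a" "b \<noteq> r" using j h_root by auto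
      then show ?thesis using new ab by (auto simp: insert_commute)
    qed
  qed
  moreover have "set ?c \<subseteq> V"
    using up_path_in ab k_le j by auto
  ultimately show ?thesis
    using dist succ ab(4)
    by (intro exI[of _ ?c]) (auto simp: graph_cycle_def simple_path_def walk_def insert_commute up_path_def)
qed

end

locale parent_graph = parent_fun +
  assumes edges_eq: "edges G = (\<lambda>v. {v, p v}) ` (verts G - {troot G})"
begin

lemma edge_iff:
  "u \<in> V \<Longrightarrow> v \<in> V \<Longrightarrow> {u, v} \<in> edges G \<longleftrightarrow> (u \<noteq> r \<and> p u = v) \<or> (v \<noteq> r \<and> p v = u)"
  by (auto simp: edges_eq doubleton_eq_iff)

lemma root_reaches: "v \<in> V \<Longrightarrow> v \<in> reachable G r"
proof (induction "h v" arbitrary: v)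
  case 0
  then show ?case using h0[of v] reachable_refl[of v G] by simp
next
  case (Suc n)
  then have "v \<noteq> r" using h_root by auto
  then have "p v \<in> reachable G r" "{p v, v} \<in> edges G"
    using Suc h_p p_in edge_iff by auto
  then show ?case
    using reachable_step Suc.prems by metis
qed

text \<open>A vertex of maximal rank on a cycle has two different neighbours there, but each of them
  has to be its parent.\<close>

lemma no_cycle: "\<not> graph_cycle G c"
proof
  assume c: "graph_cycle G c"
  then have c': "c \<noteq> []" "set c \<subseteq> V" "distinct c" "3 \<le> length c"
      "successively (\<lambda>u v. {u, v} \<in> edges G) c" "{last c, hd c} \<in> edges G"
    by (auto simp: graph_cycle_def simple_path_def walk_def)
  have "Max (h ` set c) \<in> h ` set c"
    using c' by (intro Max_in) auto
  then obtain x where x: "x \<in> set c" "h x = Max (h ` set c)" by auto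
  have x_max: "h y \<le> h x" if "y \<in> set c" for y
    using that x by simp
  obtain l m where lm: "c = l @ x # m"
    using x split_list by fast
  \<comment> \<open>The cycle opened at \<open>x\<close>: the two ends of \<open>d\<close> are the
    neighbours of \<open>x\<close>.\<close>
  define d where "d = m @ l"
  have d: "set d \<subseteq> set c" "distinct d" "2 \<le> length d" "x \<in> V"
    using c' lm by (auto simp: d_def)
  have "{x, hd d} \<in> edges G"
    using c'(5,6) lm d(3) by (cases m; cases l) (auto simp: d_def successively_append_iff successively_Cons split: if_splits)
  moreover have "{x, last d} \<in> edges G"
    using c'(5,6) lm d(3) by (cases m rule: rev_cases; cases l rule: rev_cases)
      (auto simp: d_def successively_append_iff successively_Cons insert_commute split: if_splits)
  moreover have "hd d \<in> set d" "last d \<in> set d" using d(3) by (auto intro: hd_in_set last_in_set)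
  then have "hd d \<in> set c" "last d \<in> set c"
    using d(1) by auto
  moreover have "y = p x" if "{x, y} \<in> edges G" "y \<in> set c" for y
  proof -
    have "y \<noteq> r \<Longrightarrow> p y \<noteq> x"
      using h_p[of y] x_max[OF that(2)] that(2) c' by auto
    moreover have "y \<in> V" using that c' by auto
    ultimately show ?thesis
      using that(1) d(4) edge_iff[of x y] by auto
  qed
  ultimately have "hd d = last d" by metis
  then show False
    using d(2,3) by (cases d) (auto split: if_splits)
qed

lemma rooted_tree: "rooted_tree G"
proof -
  have "e \<subseteq> V \<and> card e = 2" if "e \<in> edges G" for e
  proof -
    obtain v where v: "v \<in> V" "v \<noteq> r" "e = {v, p v}"
      using \<open>e \<in> edges G\<close> by (auto simp: edges_eq)
    then have "v \<noteq> p v" using h_p[of v] by auto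
    then show ?thesis using v p_in by simp
  qed
  then show ?thesis
    unfolding rooted_tree_def
    using fin root_in no_cycle reachable_trans[OF reachable_sym[OF root_reaches] root_reaches] by blast
qed

end

text \<open>The rank is the distance from the root, and a parent is the last vertex but one on a
  shortest walk. Any edge other than these would produce a cycle.\<close>

lemma rooted_tree_parent_graph:
  assumes G: "rooted_tree G"
  shows "\<exists>p h. parent_graph G p h"
proof -
  let ?V = "verts G" and ?r = "troot G"
  have ed: "e \<subseteq> ?V \<and> card e = 2" if "e \<in> edges G" for e
    using G that by (auto simp: rooted_tree_def)
  have reach: "v \<in> reachable G ?r" if "v \<in> ?V" for v
    using G that by (auto simp: rooted_tree_def)
  define W where "W v n w \<longleftrightarrow> walk G w \<and> hd w = ?r \<and> last w = v \<and> length w = Suc n" for v n w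
  define h where "h v = (LEAST n. \<exists>w. W v n w)" for v
  have W_ex: "\<exists>w. W v (h v) w" if v: "v \<in> ?V" for v
  proof -
    obtain w where "walk G w" "hd w = ?r" "last w = v"
      using reach[OF v] by (auto simp: reachable_def)
    moreover from this have "length w = Suc (length w - 1)"
      by (simp add: walk_def)
    ultimately have "\<exists>n w. W v n w"
      unfolding W_def by blast
    then show ?thesis
      unfolding h_def by (rule LeastI_ex)
  qed
  have h_le: "h v \<le> n" if "W v n w" for v n w
    unfolding h_def using that by (auto intro: Least_le)
  have root: "?r \<in> ?V" using G by (simp add: rooted_tree_def)
  have "W ?r 0 [?r]"
    using root by (simp add: W_def walk_def)
  then have h_root: "h ?r = 0" using h_le by fastforce
  have "\<exists>u\<in>?V. {u, v} \<in> edges G \<and> h v = Suc (h u)" if v: "v \<in> ?V" "v \<noteq> ?r" for v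
  proof -
    obtain w where w: "W v (h v) w" using W_ex v by blast
    then obtain w' where w': "w = w' @ [v]"
      by (cases w rule: rev_cases) (auto simp: W_def walk_def)
    have "w' \<noteq> []" using w w' v by (auto simp: W_def)
    have hv: "h v \<noteq> 0" using w w' \<open>w' \<noteq> []\<close> by (auto simp: W_def simp flip: length_greater_0_conv)
    have "last w' \<in> set w'" using \<open>w' \<noteq> []\<close> by simp
    then have "walk G w'" and uv: "{last w', v} \<in> edges G" "last w' \<in> ?V"
      using w w' \<open>w' \<noteq> []\<close> by (auto simp: W_def walk_def successively_append_iff)
    then have "W (last w') (h v - 1) w'"
      using w w' \<open>w' \<noteq> []\<close> hv by (auto simp: W_def)
    then have 1: "h (last w') \<le> h v - 1" using h_le by blast
    obtain w'' where w'': "W (last w') (h (last w')) w''"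
      using W_ex uv by blast
    then have "walk G (w'' @ [v])"
      using uv v by (intro walk_snoc) (auto simp: W_def)
    then have "W v (Suc (h (last w'))) (w'' @ [v])"
      using w'' by (auto simp: W_def walk_def)
    then have "h v \<le> Suc (h (last w'))" by (rule h_le)
    then have "h v = Suc (h (last w'))" using 1 hv by linarith
    then show ?thesis using uv by blast
  qed
  then obtain p where p: "\<And>v. v \<in> ?V \<Longrightarrow> v \<noteq> ?r \<Longrightarrow> p v \<in> ?V \<and> {p v, v} \<in> edges G \<and> h v = Suc (h (p v))"
    by metis
  interpret parent_fun G p h
    by standard (use G p h_root root in \<open>auto simp: rooted_tree_def\<close>)
  have E: "{v, p v} \<in> edges G" if "v \<in> V" "v \<noteq> r" for v
    using p that by (simp add: insert_commute)
  have "edges G \<subseteq> (\<lambda>v. {v, p v}) ` (V - {r})"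
  proof
    fix e assume e: "e \<in> edges G"
    then obtain a b where ab: "e = {a, b}" "a \<noteq> b" "a \<in> V" "b \<in> V"
      using ed[OF e] by (auto simp: card_2_iff)
    have "\<not> graph_cycle G c" for c using G by (simp add: rooted_tree_def)
    then show "e \<in> (\<lambda>v. {v, p v}) ` (V - {r})"
      using cycle_from_extra_edge[OF E ab(3,4,2)] e ab(1) by blast
  qed
  then have "parent_graph G p h"
    by unfold_locales (use E in auto)
  then show ?thesis by blast
qed

text \<open>Induction on the second rank. If \<open>p v\<close> differs from \<open>q v\<close>, the
  edge between \<open>v\<close> and \<open>q v\<close> makes \<open>v\<close> the
  \<open>p\<close>-parent of \<open>q v\<close>, hence by induction its \<open>q\<close>-parent, and
  the rank \<open>k\<close> would have to grow in both directions.\<close>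

lemma parent_unique:
  assumes "parent_graph G p h" "parent_graph G q k" "v \<in> verts G" "v \<noteq> troot G"
  shows "p v = q v"
proof -
  interpret P: parent_graph G p h by fact
  interpret Q: parent_graph G q k by fact
  show ?thesis
    using assms(3,4)
  proof (induction "k v" arbitrary: v rule: less_induct)
    case less
    have q: "q v \<in> P.V" "k v = Suc (k (q v))" "{v, q v} \<in> edges G"
      using less.prems Q.p_in Q.h_p Q.edges_eq by auto
    then have "p v = q v \<or> (q v \<noteq> P.r \<and> p (q v) = v)"
      using P.edge_iff[of v "q v"] less.prems by auto
    then show ?case
    proof
      assume a: "q v \<noteq> P.r \<and> p (q v) = v"
      then have "p (q v) = q (q v)"
        using q by (intro less.hyps) auto
      then have "k (q v) = Suc (k v)"
        using Q.h_p[of "q v"] a q by auto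
      then show ?thesis using q by simp
    qed
  qed
qed

text \<open>Used to pair the children of two vertices with equal codes.\<close>

lemma bij_betw_matching:
  assumes "finite A" "finite B" "image_mset f (mset_set A) = image_mset g (mset_set B)"
  shows "\<exists>\<sigma>. bij_betw \<sigma> A B \<and> (\<forall>a\<in>A. g (\<sigma> a) = f a)"
  using assms
proof (induction A arbitrary: B rule: finite_induct)
  case empty
  then have "B = {}" by (metis image_mset_empty image_mset_is_empty_iff mset_set.empty mset_set_empty_iff)
  then show ?case by (auto simp: bij_betw_def)
next
  case (insert a A)
  then have "f a \<in># image_mset g (mset_set B)"
    by (metis finite_insert image_mset_add_mset mset_set.insert union_single_eq_member)
  then obtain b where b: "b \<in> B" "g b = f a"
    using insert.prems by auto
  then have "mset_set B = add_mset b (mset_set (B - {b}))"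
    using insert.prems mset_set.remove by fastforce
  then have "image_mset f (mset_set A) = image_mset g (mset_set (B - {b}))"
    using insert b by simp
  then obtain \<sigma> where s: "bij_betw \<sigma> A (B - {b})" "\<forall>a\<in>A. g (\<sigma> a) = f a"
    using insert.IH[of "B - {b}"] insert.prems by auto
  have "bij_betw (\<sigma>(a := b)) A (B - {b})"
    using s(1) insert.hyps by (subst bij_betw_cong[where g = \<sigma>]) auto
  then have "bij_betw (\<sigma>(a := b)) (A \<union> {a}) ((B - {b}) \<union> {(\<sigma>(a := b)) a})"
    using insert.hyps by (intro notIn_Un_bij_betw) auto
  moreover have "A \<union> {a} = insert a A" "(B - {b}) \<union> {(\<sigma>(a := b)) a} = B"
    using b by auto
  ultimately have "bij_betw (\<sigma>(a := b)) (insert a A) B"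
    by argo
  moreover have "\<forall>x\<in>insert a A. g ((\<sigma>(a := b)) x) = f x"
    using s b insert.hyps by auto
  ultimately show ?case
    by blast
qed

text \<open>The parent function of \<open>H\<close> is pulled back along the isomorphism
  \<open>f\<close>. By uniqueness it agrees with \<open>p\<close>, so \<open>f\<close> maps children
  to children and the codes of \<open>H\<close>, read through \<open>f\<close>, satisfy the
  recursion of the codes of \<open>G\<close>.\<close>

lemma tree_iso_code:
  assumes "parent_graph G p h" "parent_graph H q k" "tree_iso G H"
  shows "tree_code G p (troot G) = tree_code H q (troot H)"
proof -
  interpret P: parent_graph G p h by fact
  interpret Q: parent_graph H q k by fact
  obtain f where f: "bij_betw f P.V Q.V" "f P.r = Q.r"
    and e: "\<And>u v. u \<in> P.V \<Longrightarrow> v \<in> P.V \<Longrightarrow> {u, v} \<in> edges G \<longleftrightarrow> {f u, f v} \<in> edges H"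
    using assms(3) by (auto simp: tree_iso_def)
  define f' where "f' = inv_into P.V f"
  have inj: "f u = f v \<longleftrightarrow> u = v" if "u \<in> P.V" "v \<in> P.V" for u v
    using f(1) that by (auto simp: bij_betw_def inj_on_def)
  have fV: "f v \<in> Q.V" if "v \<in> P.V" for v
    using f(1) that bij_betwE by blast
  have f': "f' y \<in> P.V" "f (f' y) = y" if "y \<in> Q.V" for y
    using f(1) that bij_betw_inv_into_right[OF f(1)] unfolding f'_def
    by (auto simp: bij_betw_def inv_into_into)
  define p' where "p' v = f' (q (f v))" for v
  have p': "p' v \<in> P.V" "f (p' v) = q (f v)" if "v \<in> P.V" "v \<noteq> P.r" for v
  proof -
    have "f v \<noteq> Q.r" using that inj[of v P.r] f(2) P.root_in by auto
    then have "q (f v) \<in> Q.V" using Q.p_in fV that by auto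
    then show "p' v \<in> P.V" "f (p' v) = q (f v)" using f' by (auto simp: p'_def)
  qed
  have nr: "f v = Q.r \<longleftrightarrow> v = P.r" if "v \<in> P.V" for v
    using inj[of v P.r] f(2) P.root_in that by auto
  have "parent_graph G p' (k \<circ> f)"
  proof
    show "finite P.V" "P.r \<in> P.V" using P.fin P.root_in by auto
    show "(k \<circ> f) P.r = 0" using f(2) Q.h_root by simp
    fix v assume v: "v \<in> P.V" "v \<noteq> P.r"
    show "p' v \<in> P.V" using p' v by simp
    show "(k \<circ> f) v = Suc ((k \<circ> f) (p' v))"
      using p' v Q.h_p[of "f v"] fV nr by auto
  next
    show "edges G = (\<lambda>v. {v, p' v}) ` (P.V - {P.r})"
    proof
      show "edges G \<subseteq> (\<lambda>v. {v, p' v}) ` (P.V - {P.r})"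
      proof
        fix x assume x: "x \<in> edges G"
        then obtain v where v: "v \<in> P.V" "v \<noteq> P.r" "x = {v, p v}"
          by (auto simp: P.edges_eq)
        then have pv: "p v \<in> P.V" using P.p_in by simp
        then have "{f v, f (p v)} \<in> edges H" using e v x by auto
        then have "(v \<noteq> P.r \<and> q (f v) = f (p v)) \<or> (p v \<noteq> P.r \<and> q (f (p v)) = f v)"
          using Q.edge_iff[of "f v" "f (p v)"] fV v pv nr by auto
        then have "(v \<noteq> P.r \<and> p' v = p v) \<or> (p v \<noteq> P.r \<and> p' (p v) = v)"
          using p' v pv inj by metis
        then show "x \<in> (\<lambda>v. {v, p' v}) ` (P.V - {P.r})"
        proof
          assume "v \<noteq> P.r \<and> p' v = p v"
          then show ?thesis using v by (intro image_eqI[of _ _ v]) auto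
        next
          assume "p v \<noteq> P.r \<and> p' (p v) = v"
          then show ?thesis using v pv by (intro image_eqI[of _ _ "p v"]) (auto simp: insert_commute)
        qed
      qed
      show "(\<lambda>v. {v, p' v}) ` (P.V - {P.r}) \<subseteq> edges G"
      proof (rule image_subsetI)
        fix v assume "v \<in> P.V - {P.r}"
        then have v: "v \<in> P.V" "v \<noteq> P.r" by auto
        then have "{f v, f (p' v)} \<in> edges H"
          using Q.edges_eq fV nr p' by auto
        then show "{v, p' v} \<in> edges G" using e v p' by auto
      qed
    qed
  qed
  then have pp': "p v = p' v" if "v \<in> P.V" "v \<noteq> P.r" for v
    by (rule parent_unique[OF assms(1) _ that])
  have fp: "f (p v) = q (f v)" if "v \<in> P.V" "v \<noteq> P.r" for v
    using pp' p' that by simp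
  have kids: "kids H q (f v) = f ` kids G p v" if v: "v \<in> P.V" for v
  proof -
    have "y \<in> f ` kids G p v" if y: "y \<in> kids H q (f v)" for y
    proof -
      have y': "y \<in> Q.V" "y \<noteq> Q.r" "q y = f v" using y by (auto simp: kids_def)
      then have "f' y \<in> P.V" "f' y \<noteq> P.r" using f'[of y] f(2) by metis+
      moreover from this have "f (p (f' y)) = f v" using fp f' y' by auto
      then have "p (f' y) = v" using inj P.p_in calculation v by auto
      ultimately show ?thesis
        using f' y' by (force simp: kids_def)
    qed
    then show ?thesis
      using fV nr fp by (auto simp: kids_def)
  qed
  have "code_fun G p (Q.code \<circ> f)"
    unfolding code_fun_def
  proof
    fix v assume v: "v \<in> P.V"
    have "inj_on f (kids G p v)"
      using f(1) by (auto simp: bij_betw_def inj_on_def kids_def)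
    then have "mset_set (kids H q (f v)) = image_mset f (mset_set (kids G p v))"
      by (simp add: kids v image_mset_mset_set)
    then show "(Q.code \<circ> f) v = Node (image_mset (Q.code \<circ> f) (mset_set (kids G p v)))"
      using Q.code_eq[OF fV[OF v]] by (simp add: image_mset.compositionality)
  qed
  then show ?thesis
    using P.code_unique[OF _ P.root_in] f(2) by fastforce
qed

text \<open>Subtrees are matched from the leaves up: children are paired by equal codes, and the
  isomorphisms between paired subtrees are glued along the disjoint sets
  \<open>P.desc c\<close>.\<close>

lemma code_tree_iso:
  assumes "parent_graph G p h" "parent_graph H q k"
    and eq: "tree_code G p (troot G) = tree_code H q (troot H)"
  shows "tree_iso G H"
proof -
  interpret P: parent_graph G p h by fact
  interpret Q: parent_graph H q k by fact
  have "\<exists>f. bij_betw f (P.desc x) (Q.desc y) \<and> f x = y \<and> (\<forall>v\<in>P.desc x - {x}. f (p v) = q (f v))"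
    if "x \<in> P.V" "y \<in> Q.V" "P.code x = Q.code y" for x y
    using that
  proof (induction x arbitrary: y rule: P.kids_induct)
    case (kids x)
    have "image_mset P.code (mset_set (P.K x)) = image_mset Q.code (mset_set (Q.K y))"
      using P.code_eq[OF kids(1)] Q.code_eq[OF kids(3)] kids(4) by simp
    then obtain \<sigma> where s: "bij_betw \<sigma> (P.K x) (Q.K y)" "\<forall>c\<in>P.K x. Q.code (\<sigma> c) = P.code c"
      using bij_betw_matching[OF P.fin_K Q.fin_K] by blast
    have sK: "\<sigma> c \<in> Q.K y" if "c \<in> P.K x" for c using s(1) that bij_betwE by blast
    have "\<exists>f. bij_betw f (P.desc c) (Q.desc (\<sigma> c)) \<and> f c = \<sigma> c \<and> (\<forall>v\<in>P.desc c - {c}. f (p v) = q (f v))"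
      if c: "c \<in> P.K x" for c
      using kids(2)[OF c, of "\<sigma> c"] s(2) c Q.K_D[OF sK[OF c]] by auto
    then obtain F where F: "\<And>c. c \<in> P.K x \<Longrightarrow> bij_betw (F c) (P.desc c) (Q.desc (\<sigma> c)) \<and> F c c = \<sigma> c \<and>
        (\<forall>v\<in>P.desc c - {c}. F c (p v) = q (F c v))"
      by metis
    define f where "f v = (if v = x then y else F (THE c. c \<in> P.K x \<and> v \<in> P.desc c) v)" for v
    have f_F: "f v = F c v" if "c \<in> P.K x" "v \<in> P.desc c" for c v
    proof -
      have "v \<noteq> x" using P.desc_kid[OF kids(1) that(1)] that(2) by auto
      moreover have "(THE c. c \<in> P.K x \<and> v \<in> P.desc c) = c"
        using that P.desc_disjoint by blast
      ultimately show ?thesis by (simp add: f_def)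
    qed
    have fx: "f x = y" by (simp add: f_def)
    have "f ` P.desc x = insert y (\<Union>c\<in>P.K x. F c ` P.desc c)"
      using f_F by (force simp: P.desc_unfold[OF kids(1)] fx image_UN)
    also have "\<dots> = insert y (\<Union>c\<in>P.K x. Q.desc (\<sigma> c))"
      using F by (auto simp: bij_betw_def)
    also have "\<dots> = insert y (\<Union>c\<in>\<sigma> ` P.K x. Q.desc c)"
      by simp
    also have "\<dots> = insert y (\<Union>c\<in>Q.K y. Q.desc c)"
      using s(1) by (simp add: bij_betw_def)
    also have "\<dots> = Q.desc y"
      using Q.desc_unfold[OF kids(3)] by simp
    finally have im: "f ` P.desc x = Q.desc y" .
    \<comment> \<open>Equal codes give subtrees of equal size, so the surjection found above is
      injective.\<close>
    have "card (P.desc x) = card (Q.desc y)"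
      using P.msize_code[OF kids(1)] Q.msize_code[OF kids(3)] kids(4) by simp
    then have "bij_betw f (P.desc x) (Q.desc y)"
      using im by (auto simp: bij_betw_def intro!: eq_card_imp_inj_on)
    moreover have "f (p v) = q (f v)" if v: "v \<in> P.desc x - {x}" for v
    proof -
      obtain c where c: "c \<in> P.K x" "v \<in> P.desc c"
        using v P.desc_unfold[OF kids(1)] by auto
      show ?thesis
      proof (cases "v = c")
        case True
        then show ?thesis
          using F[OF c(1)] f_F[OF c] P.K_D[OF c(1)] Q.K_D[OF sK[OF c(1)]] fx by auto
      next
        case False
        have vV: "v \<in> P.V" "v \<noteq> P.r"
          using c P.desc_sub P.h_root False P.K_D[OF c(1)] by (auto simp: P.desc_def)
        then have "p v \<in> P.desc c" using P.desc_p[of v c] False c by simp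
        then show ?thesis
          using F[OF c(1)] f_F[OF c(1)] c False by auto
      qed
    qed
    ultimately show ?case using fx by blast
  qed
  from this[OF P.root_in Q.root_in eq] obtain f where
    f: "bij_betw f P.V Q.V" "f P.r = Q.r" "\<And>v. v \<in> P.V \<Longrightarrow> v \<noteq> P.r \<Longrightarrow> f (p v) = q (f v)"
    unfolding P.desc_root Q.desc_root by auto
  have inj: "f u = f v \<longleftrightarrow> u = v" if "u \<in> P.V" "v \<in> P.V" for u v
    using f(1) that by (auto simp: bij_betw_def inj_on_def)
  have fV: "f v \<in> Q.V" if "v \<in> P.V" for v
    using f(1) that bij_betwE by blast
  have "{u, v} \<in> edges G \<longleftrightarrow> {f u, f v} \<in> edges H" if uv: "u \<in> P.V" "v \<in> P.V" for u v
  proof -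
    have "(f a \<noteq> Q.r \<and> q (f a) = f b) \<longleftrightarrow> (a \<noteq> P.r \<and> p a = b)" if "a \<in> P.V" "b \<in> P.V" for a b
      using inj that f P.root_in P.p_in by metis
    then show ?thesis
      using P.edge_iff[OF uv] Q.edge_iff[OF fV[OF uv(1)] fV[OF uv(2)]] uv by auto
  qed
  then show ?thesis
    unfolding tree_iso_def using f by blast
qed

lemma tree_iso_iff_code:
  assumes "parent_graph G p h" "parent_graph H q k"
  shows "tree_iso G H \<longleftrightarrow> tree_code G p (troot G) = tree_code H q (troot H)"
  using tree_iso_code[OF assms] code_tree_iso[OF assms] by blast

lemma sum_mset_mset_set: "(\<Sum>x\<in>#mset_set A. f x) = (\<Sum>x\<in>A. f x)"
  by (simp add: sum_unfold_sum_mset)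

lemma image_mset_sum: "image_mset f (sum g A) = (\<Sum>a\<in>A. image_mset f (g a))"
  by (induction A rule: infinite_finite_induct) auto

lemma image_mset_minus_one:
  assumes "finite A" "c \<in> A"
  shows "image_mset f (mset_set A) - {#f c#} = image_mset f (mset_set (A - {c}))"
  using assms by (simp add: mset_set.remove)

lemma (in parent_fun) desc_antisym: "v \<in> desc x \<Longrightarrow> x \<in> desc v \<Longrightarrow> v = x"
  by (auto simp: desc_def)

section \<open>Codes of joined trees\<close>

context
  fixes S :: "'a rgraph" and p h and T :: "'b rgraph" and q k
  assumes S: "parent_graph S p h" and T: "parent_graph T q k"
begin

interpretation S: parent_graph S p h by (rule S)
interpretation T: parent_graph T q k by (rule T)

definition join_parent :: "'a \<Rightarrow> 'a + 'b \<Rightarrow> 'a + 'b" where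
  "join_parent v x = (case x of Inl a \<Rightarrow> Inl (p a) | Inr b \<Rightarrow> if b = T.r then Inl v else Inr (q b))"

definition join_rank :: "'a \<Rightarrow> 'a + 'b \<Rightarrow> nat" where
  "join_rank v x = (case x of Inl a \<Rightarrow> h a | Inr b \<Rightarrow> Suc (h v) + k b)"

lemma join_parent_graph:
  assumes v: "v \<in> S.V"
  shows "parent_graph (join_at S v T) (join_parent v) (join_rank v)"
proof
  let ?J = "join_at S v T"
  show "finite (verts ?J)" "troot ?J \<in> verts ?J" "join_rank v (troot ?J) = 0"
    using S.fin T.fin S.root_in S.h_root by (auto simp: join_at_def join_rank_def)
  fix x assume x: "x \<in> verts ?J" "x \<noteq> troot ?J"
  show "join_parent v x \<in> verts ?J"
    using x v S.p_in T.p_in by (auto simp: join_at_def join_parent_def)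
  show "join_rank v x = Suc (join_rank v (join_parent v x))"
  proof (cases x)
    case (Inl a)
    then show ?thesis
      using x S.h_p[of a] by (auto simp: join_at_def join_parent_def join_rank_def)
  next
    case (Inr b)
    then show ?thesis
      using x T.h_p[of b] T.h_root by (auto simp: join_at_def join_parent_def join_rank_def)
  qed
next
  let ?J = "join_at S v T"
  have V: "verts ?J - {troot ?J} = insert (Inr T.r) (Inl ` (S.V - {S.r}) \<union> Inr ` (T.V - {T.r}))"
    using T.root_in by (auto simp: join_at_def)
  have "(\<lambda>x. {x, join_parent v x}) ` (Inl ` (S.V - {S.r})) = (`) Inl ` edges S"
    by (force simp: S.edges_eq join_parent_def image_image)
  moreover have "(\<lambda>x. {x, join_parent v x}) ` (Inr ` (T.V - {T.r})) = (`) Inr ` edges T"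
    by (force simp: T.edges_eq join_parent_def image_image)
  ultimately show "edges ?J = (\<lambda>x. {x, join_parent v x}) ` (verts ?J - {troot ?J})"
    unfolding V image_insert image_Un by (auto simp: join_at_def join_parent_def)
qed

abbreviation "join_code v \<equiv> tree_code (join_at S v T) (join_parent v)"

context
  fixes v assumes v: "v \<in> S.V"
begin

interpretation J: parent_graph "join_at S v T" "join_parent v" "join_rank v"
  by (rule join_parent_graph[OF v])

lemma kids_join_Inr: "y \<in> T.V \<Longrightarrow> J.K (Inr y) = Inr ` T.K y"
  by (auto simp: kids_def join_at_def join_parent_def split: if_splits)

lemma kids_join_Inl: "x \<in> S.V \<Longrightarrow> J.K (Inl x) = Inl ` S.K x \<union> (if x = v then {Inr T.r} else {})"
  using T.root_in by (auto simp: kids_def join_at_def join_parent_def split: if_splits)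

lemma join_code_Inr: "y \<in> T.V \<Longrightarrow> join_code v (Inr y) = T.code y"
proof (induction y rule: T.kids_induct)
  case (kids y)
  have "image_mset (\<lambda>x. join_code v (Inr x)) (mset_set (T.K y)) = image_mset T.code (mset_set (T.K y))"
    by (rule image_mset_cong) (use kids in auto)
  moreover have "Inr y \<in> J.V" using kids by (simp add: join_at_def)
  ultimately show ?case
    using J.code_eq[of "Inr y"] T.code_eq[OF kids(1)]
    by (simp add: kids_join_Inr kids(1) image_mset_mset_set[symmetric] image_mset.compositionality comp_def)
qed

lemma join_code_Inl: "x \<in> S.V \<Longrightarrow> join_code v (Inl x) =
    Node (image_mset (\<lambda>c. join_code v (Inl c)) (mset_set (S.K x)) + (if x = v then {#T.code T.r#} else {#}))"
proof -
  assume x: "x \<in> S.V"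
  have "Inl x \<in> J.V" using x by (simp add: join_at_def)
  moreover have "mset_set (J.K (Inl x)) = image_mset Inl (mset_set (S.K x)) + (if x = v then {#Inr T.r#} else {#})"
  proof -
    have "mset_set (insert (Inr T.r) (Inl ` A) :: ('a + 'b) set) = add_mset (Inr T.r) (mset_set (Inl ` A))"
      if "finite A" for A
      using that by (intro mset_set.insert) auto
    then show ?thesis
      unfolding kids_join_Inl[OF x] by (simp add: image_mset_mset_set)
  qed
  ultimately show ?thesis
    using J.code_eq[of "Inl x"]
    by (auto simp: image_mset.compositionality comp_def join_code_Inr T.root_in)
qed

lemma join_code_not_desc: "x \<in> S.V \<Longrightarrow> v \<notin> S.desc x \<Longrightarrow> join_code v (Inl x) = S.code x"
proof (induction x rule: S.kids_induct)
  case (kids x)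
  have "image_mset (\<lambda>c. join_code v (Inl c)) (mset_set (S.K x)) = image_mset S.code (mset_set (S.K x))"
    by (rule image_mset_cong) (use kids S.desc_kid in auto)
  then show ?case
    using kids S.desc_self join_code_Inl[OF kids(1)] S.code_eq[OF kids(1)] by auto
qed

end

lemma join_code_at: "x \<in> S.V \<Longrightarrow> join_code x (Inl x) = Node (add_mset (T.code T.r) (image_mset S.code (mset_set (S.K x))))"
proof -
  assume x: "x \<in> S.V"
  have "image_mset (\<lambda>c. join_code x (Inl c)) (mset_set (S.K x)) = image_mset S.code (mset_set (S.K x))"
  proof (rule image_mset_cong)
    fix c assume "c \<in># mset_set (S.K x)"
    then have c: "c \<in> S.K x" by simp
    then show "join_code x (Inl c) = S.code c"
      using S.K_D[OF c] S.desc_kid[OF x c] by (intro join_code_not_desc[OF x]) auto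
  qed
  then show ?thesis
    using join_code_Inl[OF x x] by simp
qed

lemma join_code_kid:
  assumes x: "x \<in> S.V" and c: "c \<in> S.K x" and v: "v \<in> S.desc c"
  shows "join_code v (Inl x) = Node (add_mset (join_code v (Inl c)) (image_mset S.code (mset_set (S.K x)) - {#S.code c#}))"
proof -
  have vV: "v \<in> S.V" "x \<noteq> v" using v S.desc_sub S.desc_kid[OF x c] by auto
  have "image_mset (\<lambda>c. join_code v (Inl c)) (mset_set (S.K x - {c})) = image_mset S.code (mset_set (S.K x - {c}))"
    by (rule image_mset_cong, rule join_code_not_desc[OF vV(1)])
      (use v c S.desc_disjoint S.K_D in auto)
  moreover have "mset_set (S.K x) = add_mset c (mset_set (S.K x - {c}))"
    using c by (simp add: mset_set.remove)
  ultimately show ?thesis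
    using join_code_Inl[OF vV(1) x] vV c by (simp add: image_mset_minus_one)
qed

text \<open>The vertices below \<open>x\<close> are \<open>x\<close> itself and those below its
  children: joining at \<open>x\<close> adds a branch, joining below a child changes one branch.
  These are the two parts of the equation for \<open>graft\<close>.\<close>

lemma graft_join_desc:
  "x \<in> S.V \<Longrightarrow> image_mset (\<lambda>v. join_code v (Inl x)) (mset_set (S.desc x)) = graft (T.code T.r) (S.code x)"
proof (induction x rule: S.kids_induct)
  case (kids x)
  let ?F = "image_mset S.code (mset_set (S.K x))" and ?t = "T.code T.r"
  have "image_mset (\<lambda>v. join_code v (Inl x)) (mset_set (S.desc c)) =
      image_mset (\<lambda>c'. Node (add_mset c' (?F - {#S.code c#}))) (graft ?t (S.code c))" if c: "c \<in> S.K x" for c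
  proof -
    have "image_mset (\<lambda>v. join_code v (Inl x)) (mset_set (S.desc c)) =
      image_mset (\<lambda>v. Node (add_mset (join_code v (Inl c)) (?F - {#S.code c#}))) (mset_set (S.desc c))"
      by (rule image_mset_cong) (use join_code_kid[OF kids(1) c] in auto)
    also have "\<dots> = image_mset (\<lambda>c'. Node (add_mset c' (?F - {#S.code c#})))
        (image_mset (\<lambda>v. join_code v (Inl c)) (mset_set (S.desc c)))"
      by (simp add: image_mset.compositionality comp_def)
    finally show ?thesis using kids(2)[OF c] by simp
  qed
  then have "image_mset (\<lambda>v. join_code v (Inl x)) (mset_set (S.desc x)) =
      add_mset (Node (add_mset ?t ?F))
        (\<Sum>c\<in>S.K x. image_mset (\<lambda>c'. Node (add_mset c' (?F - {#S.code c#}))) (graft ?t (S.code c)))"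
    using join_code_at[OF kids(1)]
    by (simp add: S.mset_desc[OF kids(1)] sum_mset_mset_set image_mset_sum)
  then show ?case
    by (simp add: S.code_eq[OF kids(1)] image_mset.compositionality comp_def sum_mset_mset_set)
qed

lemma graft_join:
  "image_mset (\<lambda>v. join_code v (troot (join_at S v T))) (mset_set S.V) = graft (T.code T.r) (S.code S.r)"
  using graft_join_desc[OF S.root_in] by (simp add: S.desc_root join_at_def)

end

section \<open>Removing an edge: the two parts and their codes\<close>

context parent_graph
begin

context
  fixes v assumes v: "v \<in> V" "v \<noteq> r"
begin

text \<open>The removed edge is the only one that leaves the subtree at \<open>v\<close>;
  conversely, the climb to the root from outside the subtree never uses that edge.\<close>

lemma root_side_edge: "root_side G {v, p v} = V - desc v"
proof
  let ?G = "G\<lparr>edges := edges G - {{v, p v}}\<rparr>"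
  have "r \<in> V - desc v"
    using root_in v h0 by (auto simp: desc_def h_root)
  moreover have "b \<in> V - desc v"
    if "a \<in> V - desc v" "b \<in> V" "{a, b} \<in> edges G - {{v, p v}}" for a b
  proof -
    have "(a \<noteq> r \<and> p a = b \<and> a \<noteq> v) \<or> (b \<noteq> r \<and> p b = a \<and> b \<noteq> v)"
      using that edge_iff[of a b] by (auto simp: insert_commute)
    then show ?thesis
      using that desc_p[of a v] desc_p[of b v] by auto
  qed
  ultimately have "reachable ?G r \<subseteq> (V - desc v) \<inter> verts ?G"
    by (intro reachable_subset_closed) auto
  then show "root_side G {v, p v} \<subseteq> V - desc v"
    by (simp add: root_side_def)
  show "V - desc v \<subseteq> root_side G {v, p v}"
  proof
    fix u assume "u \<in> V - desc v"
    then show "u \<in> root_side G {v, p v}"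
      unfolding root_side_def
    proof (induction "h u" arbitrary: u)
      case 0
      then show ?case using h0[of u] reachable_refl[of u ?G] by simp
    next
      case (Suc n)
      then have u: "u \<in> V" "u \<noteq> r" "u \<noteq> v" using h_root desc_self[OF v(1)] by auto
      then have pu: "p u \<in> V - desc v" "h u = Suc (h (p u))"
        using Suc.prems desc_p[of u v] p_in h_p by auto
      then have "p u \<in> reachable ?G r" using Suc by auto
      moreover have "{p u, u} \<noteq> {v, p v}"
        using u pu desc_self[OF v(1)] by (auto simp: doubleton_eq_iff)
      then have "{p u, u} \<in> edges ?G" using edge_iff[of "p u" u] u pu by auto
      ultimately show ?case using reachable_step[of "p u" ?G r u] u by simp
    qed
  qed
qed

lemma cut_parent_graph: "parent_graph (root_part G {v, p v}) p h"
proof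
  let ?R = "root_part G {v, p v}"
  have rv: "r \<notin> desc v" using v h0 by (auto simp: desc_def h_root)
  have V: "verts ?R = V - desc v" "troot ?R = r"
    by (simp_all add: root_part_def root_side_edge)
  show "finite (verts ?R)" "troot ?R \<in> verts ?R" "h (troot ?R) = 0"
    using fin root_in rv h_root by (auto simp: V)
  fix x assume x: "x \<in> verts ?R" "x \<noteq> troot ?R"
  then have "x \<noteq> v" using desc_self[OF v(1)] by (auto simp: V)
  then show "p x \<in> verts ?R" "h x = Suc (h (p x))"
    using x p_in[of x] h_p[of x] desc_p[of x v] by (auto simp: V)
next
  let ?R = "root_part G {v, p v}"
  have "f \<in> (\<lambda>v. {v, p v}) ` (V - desc v - {r})" if "f \<in> edges G" "f \<subseteq> V - desc v" for f
    using that by (auto simp: edges_eq)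
  moreover have "{x, p x} \<in> edges G - {{v, p v}} \<and> {x, p x} \<subseteq> V - desc v" if "x \<in> V - desc v - {r}" for x
  proof -
    have "x \<noteq> v" using that desc_self[OF v(1)] by auto
    then have "p x \<in> V - desc v" using that desc_p[of x v] p_in by auto
    then show ?thesis using that desc_self[OF v(1)] by (auto simp: edges_eq doubleton_eq_iff)
  qed
  ultimately show "edges ?R = (\<lambda>v. {v, p v}) ` (verts ?R - {troot ?R})"
    by (auto simp: root_part_def root_side_edge)
qed

lemma pruned_parent_graph: "parent_graph (pruned_part G {v, p v}) p (\<lambda>x. h x - h v)"
  and pruned_root: "troot (pruned_part G {v, p v}) = v"
  and pruned_verts: "verts (pruned_part G {v, p v}) = desc v"
proof -
  let ?P = "pruned_part G {v, p v}"
  have pv: "p v \<notin> desc v" using v h_p[OF v] by (auto simp: desc_def)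
  have "{v, p v} - (V - desc v) = {v}"
    using v pv p_in desc_self by auto
  then show root: "troot ?P = v"
    by (simp add: pruned_part_def root_side_edge)
  show V: "verts ?P = desc v"
    using desc_sub by (auto simp: pruned_part_def root_side_edge)
  have pd: "x \<in> V \<and> p x \<in> desc v \<and> x \<noteq> r \<and> h v \<le> h (p x)" if "x \<in> desc v" "x \<noteq> v" for x
  proof -
    have "x \<in> V" "x \<noteq> r" using that v h_root by (auto simp: desc_def)
    then show ?thesis using desc_p[of x v] that by (auto simp: desc_def)
  qed
  show "parent_graph ?P p (\<lambda>x. h x - h v)"
  proof
    show "finite (verts ?P)" "troot ?P \<in> verts ?P" "h (troot ?P) - h v = 0"
      using v desc_self by (auto simp: V root)
    fix x assume "x \<in> verts ?P" "x \<noteq> troot ?P"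
    then show "p x \<in> verts ?P" "h x - h v = Suc (h (p x) - h v)"
      using pd[of x] h_p[of x] by (auto simp: V root)
  next
    have "f \<in> (\<lambda>v. {v, p v}) ` (desc v - {v})" if "f \<in> edges G - {{v, p v}}" "f \<subseteq> desc v" for f
      using that by (auto simp: edges_eq)
    moreover have "{x, p x} \<in> edges G - {{v, p v}} \<and> {x, p x} \<subseteq> V - (V - desc v)" if "x \<in> desc v - {v}" for x
      using pd[of x] that desc_sub pv by (auto simp: edges_eq doubleton_eq_iff)
    ultimately show "edges ?P = (\<lambda>v. {v, p v}) ` (verts ?P - {troot ?P})"
      unfolding V root by (auto simp: pruned_part_def root_side_edge)
  qed
qed

text \<open>Every vertex of the subtree keeps all its children, so the old codes satisfy the
  recursion there, and codes are unique.\<close>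

lemma pruned_code: "x \<in> desc v \<Longrightarrow> tree_code (pruned_part G {v, p v}) p x = code x"
proof -
  let ?P = "pruned_part G {v, p v}"
  interpret P: parent_graph ?P p "\<lambda>x. h x - h v" by (rule pruned_parent_graph)
  assume x: "x \<in> desc v"
  have "code_fun ?P p code"
    unfolding code_fun_def
  proof
    fix y assume y: "y \<in> P.V"
    have "c \<in> desc v \<and> c \<noteq> v \<longleftrightarrow> c \<in> V \<and> c \<noteq> r" if pc: "p c = y" for c
    proof
      assume "c \<in> desc v \<and> c \<noteq> v"
      then show "c \<in> V \<and> c \<noteq> r"
        using desc_sub h_root by (auto simp: desc_def)
    next
      assume c: "c \<in> V \<and> c \<noteq> r"
      then have "h c = Suc (h y)" "h v \<le> h y"
        using h_p[of c] y pc by (auto simp: pruned_verts desc_def)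
      then have "c \<noteq> v" by auto
      then show "c \<in> desc v \<and> c \<noteq> v"
        using desc_p[of c v] c y pc by (simp add: pruned_verts)
    qed
    then have "P.K y = K y"
      by (auto simp: kids_def pruned_verts pruned_root)
    then show "code y = Node (image_mset code (mset_set (P.K y)))"
      using code_eq y desc_sub by (auto simp: pruned_verts)
  qed
  then show ?thesis
    using P.code_unique x by (simp add: pruned_verts)
qed

interpretation R: parent_graph "root_part G {v, p v}" p h by (rule cut_parent_graph)

abbreviation "cut_code \<equiv> tree_code (root_part G {v, p v}) p"

lemma kids_cut: "R.K x = K x - (if x = p v then {v} else {})" if x: "x \<in> V" "x \<notin> desc v"
proof -
  have "c \<notin> desc v" if "c \<in> K x" "c \<noteq> v" for c
    using K_D[OF that(1)] desc_p[of c v] x that by auto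
  then show ?thesis
    using v desc_self[OF v(1)] by (auto simp: kids_def root_part_def root_side_edge)
qed

lemma cut_code_eq: "x \<in> V \<Longrightarrow> x \<notin> desc v \<Longrightarrow>
    cut_code x = Node (image_mset cut_code (mset_set (K x - (if x = p v then {v} else {}))))"
  using R.code_eq[of x] kids_cut[of x] by (simp add: root_part_def root_side_edge)

lemma cut_code_not_desc: "x \<in> V \<Longrightarrow> v \<notin> desc x \<Longrightarrow> x \<notin> desc v \<Longrightarrow> cut_code x = code x"
proof (induction x rule: kids_induct)
  case (kids x)
  have pv: "x \<noteq> p v" 
    using kids(3) v desc_kid[OF kids(1), of v] desc_self[of v] by (auto simp: kids_def)
  have "cut_code c = code c" if c: "c \<in> K x" for c
  proof -
    have "c \<noteq> v" using pv K_D[OF c] by auto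
    then have "c \<notin> desc v" using K_D[OF c] desc_p[of c v] kids by auto
    then show ?thesis using kids(2)[OF c] kids(3) desc_kid[OF kids(1) c] by auto
  qed
  then have "image_mset cut_code (mset_set (K x)) = image_mset code (mset_set (K x))"
    by (intro image_mset_cong) auto
  then show ?case
    using cut_code_eq[OF kids(1,4)] pv code_eq[OF kids(1)] by simp
qed

lemma cut_code_kid:
  assumes x: "x \<in> V" and c: "c \<in> K x" and vc: "v \<in> desc c"
  shows "cut_code x = Node ((if c = v then {#} else {#cut_code c#}) + (image_mset code (mset_set (K x)) - {#code c#}))"
proof -
  have vx: "v \<in> desc x" "v \<noteq> x" using desc_kid[OF x c] vc by auto
  then have xd: "x \<notin> desc v" using desc_antisym by blast
  have "cut_code c' = code c'" if c': "c' \<in> K x - {c}" for c'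
  proof (rule cut_code_not_desc)
    show "c' \<in> V" using c' K_D by auto
    show "v \<notin> desc c'" using desc_disjoint[OF c, of c'] c' vc by auto
    have "c' \<noteq> v" using \<open>v \<notin> desc c'\<close> desc_self[OF v(1)] by auto
    then show "c' \<notin> desc v" using desc_p[of c' v] K_D[of c' x] c' xd by auto
  qed
  then have eq: "image_mset cut_code (mset_set (K x - {c})) = image_mset code (mset_set (K x)) - {#code c#}"
    using c by (subst image_mset_minus_one) (auto intro!: image_mset_cong)
  show ?thesis
  proof (cases "c = v")
    case True
    then have "x = p v" using K_D[OF c] by auto
    then show ?thesis using cut_code_eq[OF x xd] eq True by simp
  next
    case False
    have "x \<noteq> p v"
    proof
      assume "x = p v"
      then have "v \<in> K x" using v by (auto simp: kids_def)
      then show False using desc_disjoint[OF c _ False] vc desc_self[OF v(1)] by auto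
    qed
    moreover have "mset_set (K x) = add_mset c (mset_set (K x - {c}))"
      using c by (simp add: mset_set.remove)
    ultimately show ?thesis using cut_code_eq[OF x xd] eq False by simp
  qed
qed

end

lemma mset_desc_minus: "x \<in> V \<Longrightarrow> mset_set (desc x) = add_mset x (mset_set (desc x - {x}))"
  using desc_self by (simp add: mset_set.remove)

text \<open>Each edge below \<open>x\<close> is indexed by its lower endpoint \<open>v\<close>.
  Either \<open>v\<close> is a child \<open>c\<close> of \<open>x\<close> and the branch disappears,
  or \<open>v\<close> lies strictly below \<open>c\<close> and the cut happens inside that branch,
  as in the equation for \<open>cuts\<close>.\<close>

lemma cuts_desc:
  "x \<in> V \<Longrightarrow> image_mset (\<lambda>v. (code v, cut_code v x)) (mset_set (desc x - {x})) = cuts (code x)"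
proof (induction x rule: kids_induct)
  case (kids x)
  let ?F = "image_mset code (mset_set (K x))"
  have "image_mset (\<lambda>v. (code v, cut_code v x)) (mset_set (desc c)) =
      add_mset (code c, Node (?F - {#code c#}))
        (image_mset (\<lambda>(p, q). (p, Node (add_mset q (?F - {#code c#})))) (cuts (code c)))" if c: "c \<in> K x" for c
  proof -
    have cV: "c \<in> V" "c \<noteq> r" using K_D[OF c] by auto
    have "cut_code v x = Node (add_mset (cut_code v c) (?F - {#code c#}))" if "v \<in> desc c - {c}" for v
    proof -
      have "v \<in> V" "v \<noteq> r" "v \<noteq> c" "v \<in> desc c"
        using that h_root K_D[OF c] by (auto simp: desc_def)
      then show ?thesis
        using cut_code_kid[OF _ _ kids(1) c, of v] by simp
    qed
    then have "image_mset (\<lambda>v. (code v, cut_code v x)) (mset_set (desc c - {c})) =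
      image_mset (\<lambda>v. (code v, Node (add_mset (cut_code v c) (?F - {#code c#})))) (mset_set (desc c - {c}))"
      by (intro image_mset_cong) auto
    also have "\<dots> = image_mset (\<lambda>(p, q). (p, Node (add_mset q (?F - {#code c#})))) (cuts (code c))"
      by (simp add: kids(2)[OF c, symmetric] image_mset.compositionality comp_def)
    finally show ?thesis
      using cut_code_kid[OF cV kids(1) c desc_self[OF cV(1)]] by (simp add: mset_desc_minus[OF cV(1)])
  qed
  moreover have "mset_set (desc x - {x}) = (\<Sum>c\<in>K x. mset_set (desc c))"
    using mset_desc[OF kids(1)] mset_desc_minus[OF kids(1)] by (simp add: sum_mset_mset_set)
  ultimately show ?case
    by (simp add: code_eq[OF kids(1)] image_mset_sum image_mset.compositionality comp_def sum_mset_mset_set)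
qed

lemma height_code: "x \<in> V \<Longrightarrow> \<exists>v\<in>V. h v = h x + mheight (code x)"
proof (induction x rule: kids_induct)
  case (kids x)
  let ?A = "insert 0 (Suc ` mheight ` code ` K x)"
  have eq: "mheight (code x) = Max ?A"
    by (simp add: code_eq[OF kids(1)])
  have "Max ?A \<in> ?A" by (rule Max_in) auto
  then show ?case
  proof
    assume "Max ?A = 0"
    then show ?thesis using kids(1) eq by auto
  next
    assume "Max ?A \<in> Suc ` mheight ` code ` K x"
    then obtain c where c: "c \<in> K x" "Max ?A = Suc (mheight (code c))" by auto
    then show ?thesis using kids(2)[OF c(1)] K_D[OF c(1)] eq by auto
  qed
qed

lemma simple_path_up: "v \<in> V \<Longrightarrow> \<exists>w. simple_path G w \<and> hd w = r \<and> length w = Suc (h v)"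
proof (intro exI conjI)
  assume v: "v \<in> V"
  let ?w = "rev (up_path v (Suc (h v)))"
  have "walk G (up_path v (Suc (h v)))"
    using up_path_in[OF v] up_path_succ[OF v, of "Suc (h v)" "edges G"] edge_iff p_in
      iter_p_root[OF v] root_in
    by (auto simp: walk_def up_path_def)
  then show "simple_path G ?w"
    using up_path_distinct[OF v] by (simp add: simple_path_def walk_rev)
  show "hd ?w = r"
    using iter_p_root[OF v] by (simp add: hd_rev up_path_def)
  show "length ?w = Suc (h v)"
    by (simp add: up_path_def)
qed

end

section \<open>Transfer to \<open>rtree\<close>: codes, size, depth and structure constants\<close>

lemma count_image_mset_set: "finite A \<Longrightarrow> count (image_mset f (mset_set A)) y = card {a \<in> A. f a = y}"
proof -
  assume "finite A"
  moreover have "f -` {y} \<inter> A = {a \<in> A. f a = y}" by auto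
  ultimately show ?thesis
    by (simp add: count_image_mset)
qed

text \<open>A join has its vertices in a sum type; relabelling by \<open>sum_encode\<close> brings
  it back to natural numbers, the vertices of the representatives.\<close>

lemma parent_graph_relabel:
  assumes "parent_graph G p h" "inj f"
  shows "parent_graph \<lparr>verts = f ` verts G, edges = (`) f ` edges G, troot = f (troot G)\<rparr>
      (f \<circ> p \<circ> inv_into UNIV f) (h \<circ> inv_into UNIV f)"
    and "tree_iso G \<lparr>verts = f ` verts G, edges = (`) f ` edges G, troot = f (troot G)\<rparr>"
proof -
  interpret parent_graph G p h by fact
  have inv_f [simp]: "inv_into UNIV f (f x) = x" for x using assms(2) by simp
  have eq [simp]: "f x = f y \<longleftrightarrow> x = y" for x y using assms(2) by (auto dest: injD)
  show "parent_graph \<lparr>verts = f ` verts G, edges = (`) f ` edges G, troot = f (troot G)\<rparr>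
      (f \<circ> p \<circ> inv_into UNIV f) (h \<circ> inv_into UNIV f)"
  proof
    fix v assume "v \<in> verts \<lparr>verts = f ` verts G, edges = (`) f ` edges G, troot = f (troot G)\<rparr>"
      "v \<noteq> troot \<lparr>verts = f ` verts G, edges = (`) f ` edges G, troot = f (troot G)\<rparr>"
    then obtain u where u: "u \<in> V" "u \<noteq> r" "v = f u" by auto
    then show "(f \<circ> p \<circ> inv_into UNIV f) v \<in> verts \<lparr>verts = f ` verts G, edges = (`) f ` edges G, troot = f (troot G)\<rparr>"
      "(h \<circ> inv_into UNIV f) v = Suc ((h \<circ> inv_into UNIV f) ((f \<circ> p \<circ> inv_into UNIV f) v))"
      using p_in h_p[of u] by auto
  next
    have "f ` V - {f r} = f ` (V - {r})" by auto
    then show "edges \<lparr>verts = f ` verts G, edges = (`) f ` edges G, troot = f (troot G)\<rparr> =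
      (\<lambda>v. {v, (f \<circ> p \<circ> inv_into UNIV f) v}) ` (verts \<lparr>verts = f ` verts G, edges = (`) f ` edges G, troot = f (troot G)\<rparr> -
        {troot \<lparr>verts = f ` verts G, edges = (`) f ` edges G, troot = f (troot G)\<rparr>})"
      by (simp add: edges_eq image_image)
  qed (use fin root_in h_root in auto)
  have inj_f: "inj ((`) f)"
    using inj_image_eq_iff[OF assms(2)] by (intro injI) simp
  have "{f u, f v} \<in> (`) f ` edges G \<longleftrightarrow> {u, v} \<in> edges G" for u v
  proof -
    have "f ` {u, v} \<in> (`) f ` edges G \<longleftrightarrow> {u, v} \<in> edges G"
      by (simp only: inj_image_mem_iff[OF inj_f])
    then show ?thesis by simp
  qed
  then show "tree_iso G \<lparr>verts = f ` verts G, edges = (`) f ` edges G, troot = f (troot G)\<rparr>"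
    unfolding tree_iso_def
    by (intro exI[of _ f]) (auto simp: bij_betw_def inj_on_def)
qed

definition tree_parent :: "rtree \<Rightarrow> nat \<Rightarrow> nat" where
  "tree_parent t = (SOME p. \<exists>h. parent_graph (rep_rtree t) p h)"

definition tree_rank :: "rtree \<Rightarrow> nat \<Rightarrow> nat" where
  "tree_rank t = (SOME h. parent_graph (rep_rtree t) (tree_parent t) h)"

definition tcode :: "rtree \<Rightarrow> mtree" where
  "tcode t = tree_code (rep_rtree t) (tree_parent t) (troot (rep_rtree t))"

lemma rooted_tree_rep: "rooted_tree (rep_rtree t)"
  using Quotient3_rep_reflp[OF Quotient3_rtree] by blast

lemma parent_graph_rep: "parent_graph (rep_rtree t) (tree_parent t) (tree_rank t)"
proof -
  have "\<exists>p h. parent_graph (rep_rtree t) p h"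
    using rooted_tree_parent_graph rooted_tree_rep by blast
  then have "\<exists>h. parent_graph (rep_rtree t) (tree_parent t) h"
    unfolding tree_parent_def by (rule someI_ex)
  then show ?thesis
    unfolding tree_rank_def by (rule someI_ex)
qed

lemma tcode_inject [simp]: "tcode s = tcode t \<longleftrightarrow> s = t"
proof
  assume "tcode s = tcode t"
  then have "tree_iso (rep_rtree s) (rep_rtree t)"
    using code_tree_iso[OF parent_graph_rep parent_graph_rep] by (simp add: tcode_def)
  then show "s = t"
    using Quotient3_rel_rep[OF Quotient3_rtree, of s t] rooted_tree_rep by blast
qed simp

text \<open>A node is realised by joining its branches to the root one at a time, starting from a
  single vertex.\<close>

lemma ex_graph_code:
  "\<exists>(G :: nat rgraph) p h. parent_graph G p h \<and> tree_code G p (troot G) = x"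
proof (induction x)
  case (Node F)
  then show ?case
  proof (induction F)
    case empty
    let ?G = "\<lparr>verts = {0::nat}, edges = {}, troot = 0\<rparr>"
    interpret parent_graph ?G id id
      by unfold_locales auto
    have "code 0 = Node {#}"
      using code_eq[of 0] by (simp add: kids_def)
    then show ?case
      using parent_graph_axioms by fastforce
  next
    case (add y F)
    obtain S :: "nat rgraph" and p h where S: "parent_graph S p h" "tree_code S p (troot S) = Node F"
      using add by auto
    obtain T :: "nat rgraph" and q k where T: "parent_graph T q k" "tree_code T q (troot T) = y"
      using add.prems[of y] by auto
    interpret S: parent_graph S p h by (rule S(1))
    let ?J = "join_at S S.r T"
    have J: "parent_graph ?J (join_parent p T q S.r) (join_rank h k S.r)"
      using join_parent_graph[OF S(1) T(1) S.root_in] .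
    have cJ: "tree_code ?J (join_parent p T q S.r) (troot ?J) = Node (add_mset y F)"
      using join_code_at[OF S(1) T(1) S.root_in] S(2) T(2) S.code_eq[OF S.root_in]
      by (simp add: join_at_def)
    let ?G = "\<lparr>verts = sum_encode ` verts ?J, edges = (`) sum_encode ` edges ?J, troot = sum_encode (troot ?J)\<rparr>"
    note G = parent_graph_relabel[OF J inj_sum_encode[of UNIV]]
    show ?case
      using G(1) tree_iso_code[OF J G] cJ by metis
  qed
qed

lemma tcode_surj: "\<exists>t. tcode t = x"
proof -
  obtain G :: "nat rgraph" and p h where G: "parent_graph G p h" "tree_code G p (troot G) = x"
    using ex_graph_code by blast
  have G': "rooted_tree G" using G(1) by (rule parent_graph.rooted_tree)
  then have "tree_iso (rep_rtree (abs_rtree G)) G"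
    using Quotient3_rep_abs[OF Quotient3_rtree, of G] tree_iso_refl by blast
  then have "tcode (abs_rtree G) = x"
    unfolding tcode_def using tree_iso_code[OF parent_graph_rep G(1)] G(2) by simp
  then show ?thesis ..
qed

lemma tsize_tcode: "tsize t = msize (tcode t)"
proof -
  interpret parent_graph "rep_rtree t" "tree_parent t" "tree_rank t" by (rule parent_graph_rep)
  show ?thesis
    using msize_code[OF root_in] by (simp add: tsize_def tcode_def desc_root)
qed

text \<open>The inequality through which depth-boundedness bounds the height of all trees with
  nonzero character.\<close>

lemma mheight_le_depth: "mheight (tcode t) \<le> depth t"
proof -
  interpret parent_graph "rep_rtree t" "tree_parent t" "tree_rank t" by (rule parent_graph_rep)
  obtain v where v: "v \<in> V" "tree_rank t v = mheight (tcode t)"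
    using height_code[OF root_in] by (auto simp: tcode_def h_root)
  let ?A = "{length p - 1 | p. simple_path (rep_rtree t) p \<and> hd p = r}"
  \<comment> \<open>The maximum in \<open>depth\<close> is informative only over a finite set, and a
    simple path cannot be longer than the number of vertices.\<close>
  have "length w \<le> card V" if "simple_path (rep_rtree t) w" for w
    using that distinct_card[of w] card_mono[OF fin, of "set w"] by (auto simp: simple_path_def walk_def)
  then have "?A \<subseteq> {..card V}" by (auto intro: le_trans[OF diff_le_self])
  then have "finite ?A" by (rule finite_subset) simp
  moreover have "mheight (tcode t) \<in> ?A"
    using simple_path_up[OF v(1)] v(2) by force
  ultimately show ?thesis
    unfolding depth_def by (rule Max_ge)
qed

text \<open>With \<open>\<alpha>_count\<close> this expresses the structure constants as
  multiplicities, so that brackets can be computed on \<open>mtree\<close>.\<close>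

lemma \<beta>_count: "\<beta> s t u = count (graft (tcode t) (tcode u)) (tcode s)"
proof -
  note U = parent_graph_rep[of u] and T = parent_graph_rep[of t] and S = parent_graph_rep[of s]
  interpret U: parent_graph "rep_rtree u" "tree_parent u" "tree_rank u" by (rule U)
  let ?c = "\<lambda>v. tree_code (join_at (rep_rtree u) v (rep_rtree t))
    (join_parent (tree_parent u) (rep_rtree t) (tree_parent t) v)
    (troot (join_at (rep_rtree u) v (rep_rtree t)))"
  have "tree_iso (rep_rtree s) (join_at (rep_rtree u) v (rep_rtree t)) \<longleftrightarrow> ?c v = tcode s"
    if "v \<in> U.V" for v
    using tree_iso_iff_code[OF S join_parent_graph[OF U T that]] by (auto simp: tcode_def)
  then have "\<beta> s t u = card {v \<in> U.V. ?c v = tcode s}"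
    unfolding \<beta>_def by (intro arg_cong[of _ _ card]) auto
  also have "\<dots> = count (image_mset ?c (mset_set U.V)) (tcode s)"
    by (simp add: count_image_mset_set U.fin)
  finally show ?thesis
    using graft_join[OF U T] by (simp add: tcode_def)
qed

lemma \<alpha>_count: "\<alpha> s t u = count (cuts (tcode t)) (tcode s, tcode u)"
proof -
  interpret T: parent_graph "rep_rtree t" "tree_parent t" "tree_rank t" by (rule parent_graph_rep)
  let ?e = "\<lambda>v. {v, tree_parent t v}"
  have iso: "tree_iso (root_part (rep_rtree t) (?e v)) (rep_rtree u) \<longleftrightarrow> T.cut_code v T.r = tcode u"
    "tree_iso (pruned_part (rep_rtree t) (?e v)) (rep_rtree s) \<longleftrightarrow> T.code v = tcode s"
    if v: "v \<in> T.V - {T.r}" for v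
    using tree_iso_iff_code[OF T.cut_parent_graph[of v] parent_graph_rep[of u]]
      tree_iso_iff_code[OF T.pruned_parent_graph[of v] parent_graph_rep[of s]]
      T.pruned_root[of v] T.pruned_code[of v v] T.desc_self v
    by (auto simp: tcode_def root_part_def)
  have "\<alpha> s t u = card (?e ` {v \<in> T.V - {T.r}. (T.code v, T.cut_code v T.r) = (tcode s, tcode u)})"
    unfolding \<alpha>_def T.edges_eq
    by (intro arg_cong[of _ _ card]) (use iso in auto)
  also have "\<dots> = card {v \<in> T.V - {T.r}. (T.code v, T.cut_code v T.r) = (tcode s, tcode u)}"
    by (intro card_image inj_on_subset[OF T.inj_parent_edge]) auto
  also have "\<dots> = count (image_mset (\<lambda>v. (T.code v, T.cut_code v T.r)) (mset_set (T.V - {T.r}))) (tcode s, tcode u)"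
    by (simp add: count_image_mset_set T.fin)
  finally show ?thesis
    using T.cuts_desc[OF T.root_in] by (simp add: T.desc_root tcode_def)
qed

section \<open>Linear extension\<close>

text \<open>Scalar multiplication is a parameter, so that the same lemmas serve linear maps between
  spaces with \<open>vscale\<close> and linear functionals to the complex numbers.\<close>

definition lin_ext :: "(complex \<Rightarrow> 'b \<Rightarrow> 'b) \<Rightarrow> ('k \<Rightarrow> 'b) \<Rightarrow> ('k \<Rightarrow>\<^sub>0 complex) \<Rightarrow> 'b::comm_monoid_add" where
  "lin_ext s g x = (\<Sum>k\<in>Poly_Mapping.keys x. s (Poly_Mapping.lookup x k) (g k))"

definition scalar_action :: "(complex \<Rightarrow> 'b \<Rightarrow> 'b::ab_group_add) \<Rightarrow> bool" where
  "scalar_action s \<longleftrightarrow> (\<forall>a b v. s (a + b) v = s a v + s b v) \<and> (\<forall>a b v. s (a * b) v = s a (s b v)) \<and>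
     (\<forall>a v w. s a (v + w) = s a v + s a w) \<and> (\<forall>v. s 1 v = v)"

lemma scalar_actionD:
  assumes "scalar_action s"
  shows "s (a + b) v = s a v + s b v" "s (a * b) v = s a (s b v)" "s a (v + w) = s a v + s a w"
    "s 1 v = v" "s 0 v = 0" "s a 0 = 0" "s (- a) v = - s a v" "s a (- v) = - s a v"
    "s a (v - w) = s a v - s a w" "s (a - b) v = s a v - s b v"
proof -
  show 1: "s (a + b) v = s a v + s b v" and "s (a * b) v = s a (s b v)"
    and 3: "s a (v + w) = s a v + s a w" and "s 1 v = v" for a b v w
    using assms by (auto simp: scalar_action_def)
  show 0: "s 0 v = 0" for v using 1[of 0 0 v] by simp
  show 4: "s a 0 = 0" for a using 3[of a 0 0] by simp
  show 6: "s (- a) v = - s a v" for a using 1[of a "- a" v] 0 by (simp add: eq_neg_iff_add_eq_0 add.commute)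
  show "s (a - b) v = s a v - s b v" using 1[of a "- b" v] 6[of b] by simp
  show 5: "s a (- v) = - s a v" for v using 3[of a v "- v"] 4 by (simp add: eq_neg_iff_add_eq_0 add.commute)
  show "s a (v - w) = s a v - s a w" using 3[of a v "- w"] 5 by simp
qed

lemma scalar_action_sum: "scalar_action s \<Longrightarrow> s a (sum f A) = (\<Sum>i\<in>A. s a (f i))"
  by (induction A rule: infinite_finite_induct) (simp_all add: scalar_actionD)

lemma poly_expand: "(x :: 'k \<Rightarrow>\<^sub>0 complex) = (\<Sum>k\<in>Poly_Mapping.keys x. Poly_Mapping.single k (Poly_Mapping.lookup x k))"
proof (rule poly_mapping_eqI)
  fix j
  have "(\<Sum>k\<in>Poly_Mapping.keys x. Poly_Mapping.lookup (Poly_Mapping.single k (Poly_Mapping.lookup x k)) j) =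
     (\<Sum>k\<in>Poly_Mapping.keys x. if k = j then Poly_Mapping.lookup x k else 0)"
    by (rule sum.cong) (auto simp: lookup_single when_def)
  then show "Poly_Mapping.lookup x j = Poly_Mapping.lookup (\<Sum>k\<in>Poly_Mapping.keys x. Poly_Mapping.single k (Poly_Mapping.lookup x k)) j"
    by (simp add: lookup_sum in_keys_iff)
qed

lemma poly_induct [case_names zero add single]:
  assumes "P 0" "\<And>x y. P x \<Longrightarrow> P y \<Longrightarrow> P (x + y)" "\<And>k c. P (Poly_Mapping.single k c)"
  shows "P (x :: 'k \<Rightarrow>\<^sub>0 complex)"
proof -
  have "P (\<Sum>k\<in>A. Poly_Mapping.single k (Poly_Mapping.lookup x k))" for A
    by (induction A rule: infinite_finite_induct) (auto intro: assms)
  then show ?thesis using poly_expand[of x] by metis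
qed

context
  fixes s :: "complex \<Rightarrow> 'b \<Rightarrow> 'b::ab_group_add"
  assumes s: "scalar_action s"
begin

lemma lin_ext_superset:
  assumes "finite A" "Poly_Mapping.keys x \<subseteq> A"
  shows "lin_ext s g x = (\<Sum>k\<in>A. s (Poly_Mapping.lookup x k) (g k))"
  unfolding lin_ext_def using assms
  by (intro sum.mono_neutral_left) (auto simp: in_keys_iff scalar_actionD[OF s])

lemma lin_ext_add: "lin_ext s g (x + y) = lin_ext s g x + lin_ext s g y"
proof -
  let ?A = "Poly_Mapping.keys x \<union> Poly_Mapping.keys y"
  have "lin_ext s g (x + y) = (\<Sum>k\<in>?A. s (Poly_Mapping.lookup (x + y) k) (g k))"
    using keys_add[of x y] by (intro lin_ext_superset) auto
  also have "\<dots> = lin_ext s g x + lin_ext s g y"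
    by (simp add: lin_ext_superset[of ?A] lookup_add scalar_actionD[OF s] sum.distrib)
  finally show ?thesis .
qed

lemma lin_ext_single [simp]: "lin_ext s g (Poly_Mapping.single k c) = s c (g k)"
  by (simp add: lin_ext_def scalar_actionD[OF s])

lemma lin_ext_zero [simp]: "lin_ext s g 0 = 0"
  by (simp add: lin_ext_def)

lemma lin_ext_minus: "lin_ext s g (- x) = - lin_ext s g x"
  using lin_ext_add[of g x "- x"] by (simp add: eq_neg_iff_add_eq_0 add.commute)

lemma lin_ext_diff: "lin_ext s g (x - y) = lin_ext s g x - lin_ext s g y"
  using lin_ext_add[of g x "- y"] lin_ext_minus[of g y] by simp

lemma lin_ext_sum: "lin_ext s g (sum f A) = (\<Sum>i\<in>A. lin_ext s g (f i))"
  by (induction A rule: infinite_finite_induct) (auto simp: lin_ext_add)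

lemma lin_ext_sum_mset: "lin_ext s g (\<Sum>i\<in>#A. f i) = (\<Sum>i\<in>#A. lin_ext s g (f i))"
  by (induction A) (auto simp: lin_ext_add)

lemma lin_ext_vscale: "lin_ext s g (vscale c x) = s c (lin_ext s g x)"
proof -
  have l: "Poly_Mapping.lookup (vscale c x) k = c * Poly_Mapping.lookup x k" for k
    by (simp add: vscale_def map.rep_eq when_def)
  then have "Poly_Mapping.keys (vscale c x) \<subseteq> Poly_Mapping.keys x"
    by (auto simp: in_keys_iff)
  then have "lin_ext s g (vscale c x) = (\<Sum>k\<in>Poly_Mapping.keys x. s (Poly_Mapping.lookup (vscale c x) k) (g k))"
    by (intro lin_ext_superset) auto
  also have "\<dots> = s c (lin_ext s g x)"
    by (simp add: l lin_ext_def scalar_actionD[OF s] scalar_action_sum[OF s])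
  finally show ?thesis .
qed

end

lemma lookup_vscale: "Poly_Mapping.lookup (vscale c x) k = c * Poly_Mapping.lookup x k"
  by (simp add: vscale_def map.rep_eq when_def)

lemma scalar_action_vscale: "scalar_action vscale"
  by (auto simp: scalar_action_def lookup_vscale lookup_add algebra_simps intro!: poly_mapping_eqI)

lemma scalar_action_times: "scalar_action ((*) :: complex \<Rightarrow> _)"
  by (auto simp: scalar_action_def algebra_simps)

lemma vscale_conv_mult: "vscale c (x :: 'k::monoid_add \<Rightarrow>\<^sub>0 complex) = Poly_Mapping.single 0 c * x"
proof -
  note [simp] = scalar_actionD[OF scalar_action_vscale]
  have vs: "vscale c (Poly_Mapping.single k a) = Poly_Mapping.single k (c * a)" for k :: 'k and a
    by (auto simp: lookup_vscale lookup_single when_def intro!: poly_mapping_eqI)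
  show ?thesis
    by (induction x rule: poly_induct) (simp_all add: vs mult_single distrib_left)
qed

lemma single_zero_commute:
  "Poly_Mapping.single 0 c * x = x * Poly_Mapping.single 0 (c::complex)" for x :: "'k::monoid_add \<Rightarrow>\<^sub>0 complex"
  by (induction x rule: poly_induct) (simp_all add: distrib_left distrib_right mult_single mult.commute)

lemma vscale_mult_left: "vscale c x * y = vscale c (x * y)" for x :: "'k::monoid_add \<Rightarrow>\<^sub>0 complex"
  by (simp add: vscale_conv_mult mult.assoc)

lemma vscale_mult_right: "x * vscale c y = vscale c (x * y)" for x :: "'k::monoid_add \<Rightarrow>\<^sub>0 complex"
  by (metis single_zero_commute vscale_conv_mult mult.assoc)

definition linear_map :: "(('k \<Rightarrow>\<^sub>0 complex) \<Rightarrow> ('l \<Rightarrow>\<^sub>0 complex)) \<Rightarrow> bool" where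
  "linear_map f \<longleftrightarrow> (\<forall>x y. f (x + y) = f x + f y) \<and> (\<forall>c x. f (vscale c x) = vscale c (f x))"

lemma linear_mapD:
  assumes "linear_map f"
  shows "f (x + y) = f x + f y" "f (vscale c x) = vscale c (f x)" "f 0 = 0" "f (- x) = - f x"
    "f (x - y) = f x - f y" "f (sum g A) = (\<Sum>i\<in>A. f (g i))" "f (\<Sum>i\<in>#B. g' i) = (\<Sum>i\<in>#B. f (g' i))"
proof -
  show 1: "f (x + y) = f x + f y" and "f (vscale c x) = vscale c (f x)" for x y
    using assms by (auto simp: linear_map_def)
  show 0: "f 0 = 0" using 1[of 0 0] by simp
  show 2: "f (- x) = - f x" for x using 1[of x "- x"] 0 by (simp add: eq_neg_iff_add_eq_0 add.commute)
  show "f (x - y) = f x - f y" using 1[of x "- y"] 2 by simp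
  show "f (sum g A) = (\<Sum>i\<in>A. f (g i))"
    by (induction A rule: infinite_finite_induct) (auto simp: 0 1)
  show "f (\<Sum>i\<in>#B. g' i) = (\<Sum>i\<in>#B. f (g' i))"
    by (induction B) (auto simp: 0 1)
qed

lemma single_conv_vscale: "Poly_Mapping.single k c = vscale c (bvec k)"
  by (auto simp: lookup_vscale lookup_single when_def intro!: poly_mapping_eqI)

lemma linear_map_eqI:
  assumes "linear_map f" "linear_map g" "\<And>k. k \<in> Poly_Mapping.keys x \<Longrightarrow> f (bvec k) = g (bvec k)"
  shows "f x = g x"
proof -
  have "f (\<Sum>k\<in>Poly_Mapping.keys x. vscale (Poly_Mapping.lookup x k) (bvec k)) =
      g (\<Sum>k\<in>Poly_Mapping.keys x. vscale (Poly_Mapping.lookup x k) (bvec k))"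
    using assms by (simp add: linear_mapD)
  then show ?thesis
    using poly_expand[of x] by (simp add: single_conv_vscale[symmetric])
qed

lemma linear_map_lin_ext: "linear_map (lin_ext vscale g)"
  by (simp add: linear_map_def lin_ext_add[OF scalar_action_vscale] lin_ext_vscale[OF scalar_action_vscale])

lemma lin_ext_bvec: "lin_ext vscale g (bvec k) = g k"
  by (simp add: lin_ext_single[OF scalar_action_vscale] scalar_actionD[OF scalar_action_vscale])

lemma linear_map_comp: "linear_map f \<Longrightarrow> linear_map g \<Longrightarrow> linear_map (\<lambda>x. f (g x))"
  by (simp add: linear_map_def)

lemma linear_map_add: "linear_map f \<Longrightarrow> linear_map g \<Longrightarrow> linear_map (\<lambda>x. f x + g x)"
  by (simp add: linear_map_def algebra_simps scalar_actionD[OF scalar_action_vscale])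

lemma linear_map_diff: "linear_map f \<Longrightarrow> linear_map g \<Longrightarrow> linear_map (\<lambda>x. f x - g x)"
  by (simp add: linear_map_def scalar_actionD[OF scalar_action_vscale])

lemma linear_map_vscale: "linear_map f \<Longrightarrow> linear_map (\<lambda>x. vscale c (f x))"
  by (auto simp: linear_map_def scalar_actionD[OF scalar_action_vscale] lookup_vscale intro!: poly_mapping_eqI)

lemma linear_map_sum: "(\<And>i. i \<in> A \<Longrightarrow> linear_map (f i)) \<Longrightarrow> linear_map (\<lambda>x. \<Sum>i\<in>A. f i x)"
proof (induction A rule: infinite_finite_induct)
  case (insert a A) then show ?case using linear_map_add[of "f a"] by simp
qed (simp_all add: linear_map_def scalar_actionD[OF scalar_action_vscale])

lemma linear_map_mult: "linear_map (\<lambda>x. a * x :: 'k::monoid_add \<Rightarrow>\<^sub>0 complex)"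
  by (simp add: linear_map_def distrib_left vscale_mult_right)

section \<open>Derivations of the forest algebra\<close>

type_synonym forest_alg = "mtree multiset \<Rightarrow>\<^sub>0 complex"

definition derivation :: "(forest_alg \<Rightarrow> forest_alg) \<Rightarrow> bool" where
  "derivation d \<longleftrightarrow> linear_map d \<and> (\<forall>x y. d (x * y) = d x * y + x * d y)"

text \<open>The derivation of the polynomial algebra with trees as variables that extends
  \<open>g\<close> from the variables: the Leibniz sum over the factors of a monomial.\<close>

definition der :: "(mtree \<Rightarrow> forest_alg) \<Rightarrow> forest_alg \<Rightarrow> forest_alg" where
  "der g = lin_ext vscale (\<lambda>F. \<Sum>c\<in>#F. g c * bvec (F - {#c#}))"

lemma linear_der: "linear_map (der g)"
  unfolding der_def by (rule linear_map_lin_ext)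

lemma der_monomial: "der g (bvec F) = (\<Sum>c\<in>#F. g c * bvec (F - {#c#}))"
  by (simp add: der_def lin_ext_bvec)

lemma bvec_add: "bvec (F + G) = bvec F * bvec (G :: 'k::monoid_add)"
  by (simp add: mult_single)

lemma derivation_der: "derivation (der g)"
  unfolding derivation_def
proof (intro conjI allI linear_der)
  fix x y
  have mono: "der g (bvec F * bvec G) = der g (bvec F) * bvec G + bvec F * der g (bvec G)" for F G
  proof -
    have 1: "(\<Sum>c\<in>#F. g c * bvec (F + G - {#c#})) = (\<Sum>c\<in>#F. g c * bvec (F - {#c#})) * bvec G"
      unfolding sum_mset_distrib_right
      by (intro arg_cong[of _ _ sum_mset] image_mset_cong) (simp add: mult.assoc mult_single)
    have 2: "(\<Sum>c\<in>#G. g c * bvec (F + G - {#c#})) = bvec F * (\<Sum>c\<in>#G. g c * bvec (G - {#c#}))"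
      unfolding sum_mset_distrib_left
      by (intro arg_cong[of _ _ sum_mset] image_mset_cong) (simp add: mult.left_commute mult_single)
    show ?thesis
      unfolding bvec_add[symmetric] der_monomial by (simp add: 1 2)
  qed
  have lin1: "linear_map (\<lambda>x. der g (x * y))" "linear_map (\<lambda>x. der g x * y + x * der g y)" for y
    by (simp_all add: linear_map_def linear_mapD[OF linear_der] distrib_left distrib_right add.assoc add.commute add.left_commute vscale_mult_left
        scalar_actionD[OF scalar_action_vscale])
  have lin2: "linear_map (\<lambda>y. der g (x * y))" "linear_map (\<lambda>y. der g x * y + x * der g y)" for x
    by (simp_all add: linear_map_def linear_mapD[OF linear_der] distrib_left distrib_right add.assoc add.commute add.left_commute vscale_mult_right
        scalar_actionD[OF scalar_action_vscale])
  show "der g (x * y) = der g x * y + x * der g y"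
    by (rule linear_map_eqI[OF lin1], rule linear_map_eqI[OF lin2], rule mono)
qed

lemma derivation_one: "derivation d \<Longrightarrow> d 1 = 0"
proof -
  assume "derivation d"
  then have "d (1 * 1) = d 1 * 1 + 1 * d 1" unfolding derivation_def by blast
  then show ?thesis by simp
qed

lemma der_gen: "der g (bvec {#c#}) = g c"
  by (simp add: der_monomial)

text \<open>Agreement is asked only on the trees that occur in \<open>F\<close>: in an induction
  over trees nothing more than the branches is available.\<close>

lemma derivation_eq_on:
  assumes d: "derivation d" and e: "derivation e" and eq: "\<And>c. c \<in># F \<Longrightarrow> d (bvec {#c#}) = e (bvec {#c#})"
  shows "d (bvec F) = e (bvec F)"
  using eq
proof (induction F)
  case empty
  then show ?case using derivation_one[OF d] derivation_one[OF e] by (metis single_one zero_multiset_def)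
next
  case (add c F)
  have "bvec (add_mset c F) = bvec {#c#} * bvec F"
    by (simp add: mult_single)
  then show ?case
    using d e add by (simp add: derivation_def)
qed

lemma derivation_eqI:
  assumes "derivation d" "derivation e" "\<And>c. d (bvec {#c#}) = e (bvec {#c#})"
  shows "d x = e x"
  by (rule linear_map_eqI) (use assms derivation_eq_on in \<open>auto simp: derivation_def\<close>)

lemma derivation_commutator:
  assumes "derivation d" "derivation e"
  shows "derivation (\<lambda>x. d (e x) - e (d x))"
  using assms unfolding derivation_def
  by (auto simp: linear_mapD linear_map_comp linear_map_diff algebra_simps)

lemma derivation_add: "derivation d \<Longrightarrow> derivation e \<Longrightarrow> derivation (\<lambda>x. d x + e x)"
  by (auto simp: derivation_def linear_map_add algebra_simps)

lemma derivation_diff: "derivation d \<Longrightarrow> derivation e \<Longrightarrow> derivation (\<lambda>x. d x - e x)"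
  by (auto simp: derivation_def linear_map_diff algebra_simps)

lemma derivation_vscale: "derivation d \<Longrightarrow> derivation (\<lambda>x. vscale c (d x))"
  by (auto simp: derivation_def linear_map_vscale vscale_mult_left vscale_mult_right
      scalar_actionD[OF scalar_action_vscale])

lemma derivation_zero: "derivation (\<lambda>x. 0)"
  by (simp add: derivation_def linear_map_def scalar_actionD[OF scalar_action_vscale])

lemma derivation_sum_mset: "(\<And>i. i \<in># A \<Longrightarrow> derivation (f i)) \<Longrightarrow> derivation (\<lambda>x. \<Sum>i\<in>#A. f i x)"
  by (induction A) (use derivation_add derivation_zero in auto)

lemma derivation_sum: "(\<And>i. i \<in> A \<Longrightarrow> derivation (f i)) \<Longrightarrow> derivation (\<lambda>x. \<Sum>i\<in>A. f i x)"
  by (induction A rule: infinite_finite_induct) (use derivation_add derivation_zero in auto)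

section \<open>Grafting and cutting\<close>

lemma graft_imp_cut: "x \<in># graft p q \<Longrightarrow> (p, q) \<in># cuts x"
proof (induction q arbitrary: x)
  case (Node F)
  from Node.prems consider "x = Node (add_mset p F)"
    | c c' where "c \<in># F" "c' \<in># graft p c" "x = Node (add_mset c' (F - {#c#}))"
    by (auto simp: in_Union_mset_iff)
  then show ?case
  proof cases
    case 1
    then show ?thesis by simp
  next
    case 2
    then have "(p, c) \<in># cuts c'" using Node.IH by blast
    then have "(p, Node F) \<in># image_mset (\<lambda>(p, q). (p, Node (add_mset q (F - {#c#})))) (cuts c')"
      using 2(1) by (force simp: image_iff)
    then show ?thesis using 2(3) by simp
  qed
qed

lemma cut_imp_graft: "(p, q) \<in># cuts x \<Longrightarrow> x \<in># graft p q"
proof (induction x arbitrary: q)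
  case (Node F)
  then consider "p \<in># F" "q = Node (F - {#p#})"
    | c q' where "c \<in># F" "(p, q') \<in># cuts c" "q = Node (add_mset q' (F - {#c#}))"
    by (auto simp: in_Union_mset_iff)
  then show ?case
  proof cases
    case 1
    then show ?thesis by simp
  next
    case 2
    then have "c \<in># graft p q'" using Node.IH by blast
    then have "Node F \<in># image_mset (\<lambda>c'. Node (add_mset c' (F - {#c#}))) (graft p q')"
      using 2(1) by force
    then show ?thesis using 2(3) by simp
  qed
qed

text \<open>Only the supports agree: for a root with two leaves, cutting a leaf has multiplicity 2,
  while grafting it back at the root of the remainder has multiplicity 1.\<close>

lemma cut_iff_graft: "(p, q) \<in># cuts x \<longleftrightarrow> x \<in># graft p q"
  using graft_imp_cut cut_imp_graft by blast

lemma msize_graft: "x \<in># graft p q \<Longrightarrow> msize x = msize p + msize q"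
proof (induction q arbitrary: x)
  case (Node F)
  then consider "x = Node (add_mset p F)"
    | c c' where "c \<in># F" "c' \<in># graft p c" "x = Node (add_mset c' (F - {#c#}))"
    by (auto simp: in_Union_mset_iff)
  then show ?case
  proof cases
    case 2
    then show ?thesis using Node.IH by (auto dest!: multi_member_split)
  qed simp
qed

section \<open>Creation and annihilation operators\<close>

text \<open>A forest stands for the tree obtained by adding a root below it. On the space of trees
  \<open>D_t\<^sup>+\<close> grafts \<open>t\<close> at all vertices and \<open>D_s\<^sup>-\<close> removes all branches \<open>s\<close>. In terms of forests, which form a
  polynomial algebra, grafting at the root is multiplication by \<open>t\<close>, and everything else is a
  derivation; commutators of derivations can be compared on single trees by induction.\<close>

definition graft_gen :: "mtree \<Rightarrow> mtree \<Rightarrow> forest_alg" where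
  "graft_gen t c = (\<Sum>x\<in>#graft t c. bvec {#x#})"

text \<open>The term 1 stands for cutting off the whole tree \<open>c\<close> at the root added
  below the forest.\<close>

definition cut_gen :: "mtree \<Rightarrow> mtree \<Rightarrow> forest_alg" where
  "cut_gen s c = (if c = s then 1 else 0) + (\<Sum>(p, q)\<in>#cuts c. if p = s then bvec {#q#} else 0)"

definition size_gen :: "mtree \<Rightarrow> forest_alg" where
  "size_gen c = vscale (of_nat (msize c)) (bvec {#c#})"

definition create :: "mtree \<Rightarrow> forest_alg \<Rightarrow> forest_alg" where
  "create t x = bvec {#t#} * x + der (graft_gen t) x"

abbreviation annih :: "mtree \<Rightarrow> forest_alg \<Rightarrow> forest_alg" where
  "annih s \<equiv> der (cut_gen s)"

text \<open>The summand \<open>x\<close> counts the added root.\<close>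

definition grade :: "forest_alg \<Rightarrow> forest_alg" where
  "grade x = x + der size_gen x"

text \<open>The operator often written \<open>B_+\<close>, which joins the trees of a forest to a
  new root. It links the action on a forest of branches to the action on the single tree.\<close>

definition bplus :: "forest_alg \<Rightarrow> forest_alg" where
  "bplus = lin_ext vscale (\<lambda>F. bvec {#Node F#})"

lemmas vscale_simps = scalar_actionD[OF scalar_action_vscale]

lemma linear_bplus: "linear_map bplus"
  unfolding bplus_def by (rule linear_map_lin_ext)

lemma bplus_bvec: "bplus (bvec F) = bvec {#Node F#}"
  by (simp add: bplus_def lin_ext_bvec)

lemma linear_create: "linear_map (create t)"
  unfolding create_def by (intro linear_map_add linear_map_mult linear_der)

lemma linear_grade: "linear_map grade"
  unfolding grade_def by (intro linear_map_add linear_der) (simp add: linear_map_def)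

lemma sum_mset_bind: "(\<Sum>y\<in>#(\<Sum>c\<in>#F. g c). f y) = (\<Sum>c\<in>#F. \<Sum>y\<in>#g c. (f y :: 'b::comm_monoid_add))"
  by (induction F) auto

lemma create_bvec: "create t (bvec G) = (\<Sum>x\<in>#graft t (Node G). bvec (branches x))"
proof -
  have "der (graft_gen t) (bvec G) = (\<Sum>c\<in>#G. \<Sum>x\<in>#graft t c. bvec (add_mset x (G - {#c#})))"
    unfolding der_monomial graft_gen_def
    by (intro arg_cong[of _ _ sum_mset] image_mset_cong) (simp add: sum_mset_distrib_right mult_single)
  then show ?thesis
    by (simp add: create_def mult_single sum_mset_bind image_mset.compositionality comp_def)
qed

lemma annih_bvec: "annih s (bvec G) = (\<Sum>(p, q)\<in>#cuts (Node G). if p = s then bvec (branches q) else 0)"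
proof -
  have "annih s (bvec G) = (\<Sum>c\<in>#G. (if c = s then bvec (G - {#c#}) else 0) +
      (\<Sum>(p, q)\<in>#cuts c. if p = s then bvec (add_mset q (G - {#c#})) else 0))"
    unfolding der_monomial cut_gen_def
    by (intro arg_cong[of _ _ sum_mset] image_mset_cong)
      (auto simp: sum_mset_distrib_right mult_single distrib_right case_prod_unfold if_distrib[of "\<lambda>x. x * _"] cong: if_cong)
  then show ?thesis
    by (simp add: sum_mset_bind image_mset.compositionality comp_def case_prod_unfold cong: if_cong)
qed


section \<open>Commutators, by induction over trees\<close>

abbreviation "dg t \<equiv> der (graft_gen t)"

text \<open>This intertwining drives the inductions: the derivation part acts on the tree
  \<open>Node F\<close> as the full operator acts on the forest \<open>F\<close>.\<close>

lemma graft_bplus: "dg t (bplus x) = bplus (create t x)"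
proof (rule linear_map_eqI[of "\<lambda>x. dg t (bplus x)" "\<lambda>x. bplus (create t x)"])
  fix F
  have "bplus (create t (bvec F)) = (\<Sum>x\<in>#graft t (Node F). bvec {#x#})"
    by (simp only: create_bvec linear_mapD[OF linear_bplus] bplus_bvec mtree.collapse)
  then show "dg t (bplus (bvec F)) = bplus (create t (bvec F))"
    by (simp add: bplus_bvec der_gen graft_gen_def del: graft.simps)
qed (rule linear_map_comp[OF linear_der linear_bplus] linear_map_comp[OF linear_bplus linear_create])+

text \<open>What is left when a whole tree is cut off at the added root: the empty forest 1 if the
  tree is \<open>s\<close>, and 0 otherwise.\<close>

definition counit :: "mtree \<Rightarrow> forest_alg \<Rightarrow> forest_alg" where
  "counit s = lin_ext vscale (\<lambda>F. if Node F = s then 1 else 0)"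

lemma linear_counit: "linear_map (counit s)"
  unfolding counit_def by (rule linear_map_lin_ext)

lemma counit_bvec: "counit s (bvec F) = (if Node F = s then 1 else 0)"
  by (simp add: counit_def lin_ext_bvec)

lemma annih_bplus: "annih s (bplus x) = counit s x + bplus (annih s x)"
proof (rule linear_map_eqI[of "\<lambda>x. annih s (bplus x)" "\<lambda>x. counit s x + bplus (annih s x)"])
  fix F
  have "bplus (annih s (bvec F)) = (\<Sum>(p, q)\<in>#cuts (Node F). if p = s then bvec {#q#} else 0)"
    unfolding annih_bvec linear_mapD[OF linear_bplus]
    by (intro arg_cong[of _ _ sum_mset] image_mset_cong)
      (auto simp: bplus_bvec linear_mapD[OF linear_bplus])
  then show "annih s (bplus (bvec F)) = counit s (bvec F) + bplus (annih s (bvec F))"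
    by (simp add: bplus_bvec der_gen cut_gen_def counit_bvec del: cuts.simps)
qed (rule linear_map_comp[OF linear_der linear_bplus]
    linear_map_add[OF linear_counit linear_map_comp[OF linear_bplus linear_der]])+

lemma sum_mset_indicator:
  "(\<Sum>y\<in>#X. if y = a then 1 else 0) = vscale (of_nat (count X a)) (1 :: forest_alg)"
  by (induction X) (simp_all add: vscale_simps)

lemma counit_create: "counit s (create t (bvec G)) = vscale (of_nat (count (graft t (Node G)) s)) 1"
  by (simp add: create_bvec linear_mapD[OF linear_counit] counit_bvec sum_mset_indicator del: graft.simps)

lemma counit_annih: "counit s (annih t (bvec G)) = vscale (of_nat (count (cuts (Node G)) (t, s))) 1"
proof -
  have "counit s (annih t (bvec G)) = (\<Sum>y\<in>#cuts (Node G). if y = (t, s) then 1 else 0)"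
    unfolding annih_bvec linear_mapD[OF linear_counit]
  proof (intro arg_cong[of _ _ sum_mset] image_mset_cong)
    fix y assume "y \<in># cuts (Node G)"
    obtain p q where "y = (p, q)" by (cases y)
    then show "counit s (case y of (p, q) \<Rightarrow> if p = t then bvec (branches q) else 0) = (if y = (t, s) then 1 else 0)"
      by (cases "p = t") (auto simp: counit_bvec linear_mapD[OF linear_counit])
  qed
  then show ?thesis by (simp only: sum_mset_indicator)
qed

lemma dg_mult: "dg t (x * y) = dg t x * y + x * dg t y"
  using derivation_der by (auto simp: derivation_def)

lemma annih_mult: "annih t (x * y) = annih t x * y + x * annih t y"
  using derivation_der by (auto simp: derivation_def)

lemma sum_create: "(\<Sum>r\<in>#A. create r x) = (\<Sum>r\<in>#A. bvec {#r#}) * x + (\<Sum>r\<in>#A. dg r x)"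
  by (simp add: create_def sum_mset.distrib sum_mset_distrib_right)

text \<open>Multiplications commute, so the two operators differ from their derivation parts only by
  the grafts of one generator onto the other. The hypothesis concerns a single \<open>x\<close>,
  since inside the induction it is known only for forests of branches.\<close>

lemma create_create:
  assumes "dg s (dg t x) - dg t (dg s x) = (\<Sum>r\<in>#graft s t. dg r x) - (\<Sum>r\<in>#graft t s. dg r x)"
  shows "create s (create t x) - create t (create s x) =
    (\<Sum>r\<in>#graft s t. create r x) - (\<Sum>r\<in>#graft t s. create r x)"
proof -
  have e: "create s (create t x) = bvec {#s#} * bvec {#t#} * x + bvec {#s#} * dg t x + bvec {#t#} * dg s x +
      (\<Sum>r\<in>#graft s t. bvec {#r#}) * x + dg s (dg t x)" for s t
    unfolding create_def linear_mapD[OF linear_der] dg_mult der_gen graft_gen_def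
    by (simp add: distrib_left mult.assoc)
  have "create s (create t x) - create t (create s x) = (\<Sum>r\<in>#graft s t. bvec {#r#}) * x
      - (\<Sum>r\<in>#graft t s. bvec {#r#}) * x + (dg s (dg t x) - dg t (dg s x))"
    unfolding e by (simp add: mult.commute[of "bvec {#t#}" "bvec {#s#}"])
  then show ?thesis
    unfolding assms sum_create by simp
qed

text \<open>Both sides are derivations, so single trees suffice. By \<open>graft_bplus\<close> the
  tree \<open>Node G\<close> leads to \<open>create\<close> on \<open>G\<close>, where
  \<open>create_create\<close> applies with the induction hypothesis for the branches. This is the
  pre-Lie identity of grafting in operator form.\<close>

lemma dg_commutator:
  "dg s (dg t x) - dg t (dg s x) = (\<Sum>r\<in>#graft s t. dg r x) - (\<Sum>r\<in>#graft t s. dg r x)"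
proof -
  have D: "derivation (\<lambda>x. dg s (dg t x) - dg t (dg s x))"
    "derivation (\<lambda>x. (\<Sum>r\<in>#graft s t. dg r x) - (\<Sum>r\<in>#graft t s. dg r x))"
    by (rule derivation_commutator[OF derivation_der derivation_der]
        derivation_diff[OF derivation_sum_mset[OF derivation_der] derivation_sum_mset[OF derivation_der]])+
  have "dg s (dg t (bvec {#c#})) - dg t (dg s (bvec {#c#})) =
    (\<Sum>r\<in>#graft s t. dg r (bvec {#c#})) - (\<Sum>r\<in>#graft t s. dg r (bvec {#c#}))" for c
  proof (induction c)
    case (Node G)
    have "create s (create t (bvec G)) - create t (create s (bvec G)) =
      (\<Sum>r\<in>#graft s t. create r (bvec G)) - (\<Sum>r\<in>#graft t s. create r (bvec G))"
      by (rule create_create, rule derivation_eq_on[OF D]) (use Node in auto)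
    from arg_cong[OF this, of bplus]
    have "bplus (create s (create t (bvec G))) - bplus (create t (create s (bvec G))) =
      (\<Sum>r\<in>#graft s t. bplus (create r (bvec G))) - (\<Sum>r\<in>#graft t s. bplus (create r (bvec G)))"
      by (simp only: linear_mapD[OF linear_bplus])
    then show ?case
      by (simp add: graft_bplus flip: bplus_bvec)
  qed
  then show ?thesis by (rule derivation_eqI[OF D])
qed

lemma create_commutator:
  "create s (create t x) - create t (create s x) =
    (\<Sum>r\<in>#graft s t. create r x) - (\<Sum>r\<in>#graft t s. create r x)"
  by (rule create_create[OF dg_commutator])

definition cut_rests :: "mtree \<Rightarrow> mtree \<Rightarrow> mtree multiset" where
  "cut_rests s t = image_mset snd (filter_mset (\<lambda>y. fst y = s) (cuts t))"

lemma count_cut_rests: "count (cut_rests s t) q = count (cuts t) (s, q)"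
proof -
  have "count (image_mset snd (filter_mset (\<lambda>y. fst y = s) X)) q = count X (s, q)" for X :: "(mtree \<times> mtree) multiset"
    by (induction X) auto
  then show ?thesis by (simp add: cut_rests_def)
qed

lemma sum_cut_rests: "(\<Sum>(p, q)\<in>#cuts t. if p = s then f q else 0) = (\<Sum>q\<in>#cut_rests s t. (f q :: forest_alg))"
proof -
  have "(\<Sum>(p, q)\<in>#X. if p = s then f q else 0) = (\<Sum>q\<in>#image_mset snd (filter_mset (\<lambda>y. fst y = s) X). f q)" for X
    by (induction X) auto
  then show ?thesis by (simp add: cut_rests_def)
qed

lemma finite_graft_inverse: "finite {r. s \<in># graft t r}"
proof (rule finite_subset)
  show "{r. s \<in># graft t r} \<subseteq> snd ` set_mset (cuts s)"
    using cut_iff_graft by force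
qed simp

text \<open>The part of \<open>[D_s\<^sup>-, D_t\<^sup>+]\<close> in the span of the
  \<open>D_r\<^sup>-\<close>, with coefficients \<beta>.\<close>

definition mixed_terms :: "mtree \<Rightarrow> mtree \<Rightarrow> forest_alg \<Rightarrow> forest_alg" where
  "mixed_terms s t x = (\<Sum>r | s \<in># graft t r. vscale (of_nat (count (graft t r) s)) (annih r x))"

lemma annih_create:
  assumes "annih s (dg t x) - dg t (annih s x) = (\<Sum>q\<in>#cut_rests s t. dg q x) + mixed_terms s t x +
      (if s = t then der size_gen x else 0)"
  shows "annih s (create t x) - create t (annih s x) = (\<Sum>q\<in>#cut_rests s t. create q x) + mixed_terms s t x +
      (if s = t then grade x else 0)"
proof -
  have "annih s (create t x) = (if s = t then x else 0) + (\<Sum>q\<in>#cut_rests s t. bvec {#q#}) * x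
      + bvec {#t#} * annih s x + annih s (dg t x)"
    unfolding create_def linear_mapD[OF linear_der] annih_mult der_gen cut_gen_def sum_cut_rests
    by (cases "s = t") (simp_all add: distrib_right)
  then have "annih s (create t x) - create t (annih s x) = (if s = t then x else 0) +
      (\<Sum>q\<in>#cut_rests s t. bvec {#q#}) * x + (annih s (dg t x) - dg t (annih s x))"
    unfolding create_def[of t "annih s x"] by simp
  then show ?thesis
    unfolding assms sum_create grade_def by simp
qed

lemma mixed_terms_bplus:
  "mixed_terms s t (bplus (bvec G)) = vscale (of_nat (count (graft t (Node G)) s)) 1 + bplus (mixed_terms s t (bvec G))"
proof -
  have "(\<Sum>r | s \<in># graft t r. vscale (of_nat (count (graft t r) s)) (counit r (bvec G))) =
    (\<Sum>r | s \<in># graft t r. if r = Node G then vscale (of_nat (count (graft t (Node G)) s)) 1 else 0)"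
    by (intro sum.cong) (auto simp: counit_bvec vscale_simps)
  also have "\<dots> = vscale (of_nat (count (graft t (Node G)) s)) 1"
    by (auto simp: finite_graft_inverse vscale_simps not_in_iff simp del: graft.simps)
  finally show ?thesis
    by (simp add: mixed_terms_def annih_bplus vscale_simps linear_mapD[OF linear_bplus] sum.distrib del: graft.simps)
qed

lemma derivation_mixed: "derivation (mixed_terms s t)"
  unfolding mixed_terms_def by (intro derivation_sum derivation_vscale derivation_der)

lemma size_bplus: "der size_gen (bplus (bvec G)) = bplus (grade (bvec G))"
proof -
  have "der size_gen (bvec G) = vscale (of_nat (\<Sum>c\<in>#G. msize c)) (bvec G)"
  proof -
    have "der size_gen (bvec G) = (\<Sum>c\<in>#G. vscale (of_nat (msize c)) (bvec G))"
      unfolding der_monomial size_gen_def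
      by (intro arg_cong[of _ _ sum_mset] image_mset_cong) (simp add: vscale_mult_left mult_single)
    also have "(\<Sum>c\<in>#A. vscale (of_nat (msize c)) (bvec G)) = vscale (of_nat (\<Sum>c\<in>#A. msize c)) (bvec G)" for A
      by (induction A) (simp_all add: vscale_simps)
    finally show ?thesis .
  qed
  then show ?thesis
    by (simp add: bplus_bvec der_gen size_gen_def grade_def linear_mapD[OF linear_bplus] vscale_simps)
qed

text \<open>The same induction. New constant terms arise from \<open>annih_bplus\<close>:
  \<open>counit s\<close> after \<open>create t\<close> counts the grafts of \<open>t\<close> onto
  \<open>Node G\<close> that give \<open>s\<close>, and this is also the constant term of
  \<open>mixed_terms\<close> at that tree.\<close>

lemma annih_dg_commutator:
  "annih s (dg t x) - dg t (annih s x) = (\<Sum>q\<in>#cut_rests s t. dg q x) + mixed_terms s t x +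
      (if s = t then der size_gen x else 0)"
proof -
  have D1: "derivation (\<lambda>x. if s = t then der size_gen x else 0)"
    by (cases "s = t") (simp_all add: derivation_der derivation_zero)
  have D: "derivation (\<lambda>x. annih s (dg t x) - dg t (annih s x))"
    "derivation (\<lambda>x. (\<Sum>q\<in>#cut_rests s t. dg q x) + mixed_terms s t x + (if s = t then der size_gen x else 0))"
    by (rule derivation_commutator[OF derivation_der derivation_der]
        derivation_add[OF derivation_add[OF derivation_sum_mset[OF derivation_der] derivation_mixed] D1])+
  have "annih s (dg t (bvec {#c#})) - dg t (annih s (bvec {#c#})) =
    (\<Sum>q\<in>#cut_rests s t. dg q (bvec {#c#})) + mixed_terms s t (bvec {#c#}) +
      (if s = t then der size_gen (bvec {#c#}) else 0)" for c
  proof (induction c)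
    case (Node G)
    have "annih s (create t (bvec G)) - create t (annih s (bvec G)) = (\<Sum>q\<in>#cut_rests s t. create q (bvec G))
        + mixed_terms s t (bvec G) + (if s = t then grade (bvec G) else 0)"
      by (rule annih_create, rule derivation_eq_on[OF D]) (use Node in auto)
    from arg_cong[OF this, of bplus]
    have "bplus (annih s (create t (bvec G))) - bplus (create t (annih s (bvec G))) =
       (\<Sum>q\<in>#cut_rests s t. bplus (create q (bvec G))) + bplus (mixed_terms s t (bvec G))
       + bplus (if s = t then grade (bvec G) else 0)"
      by (simp only: linear_mapD[OF linear_bplus])
    moreover have "dg t (counit s (bvec G)) = 0"
      using derivation_one[OF derivation_der, of "graft_gen t"]
      by (simp add: counit_bvec linear_mapD[OF linear_der])
    ultimately show ?case
      by (auto simp: graft_bplus annih_bplus counit_create mixed_terms_bplus size_bplus linear_mapD[OF linear_der]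
          linear_mapD[OF linear_bplus] simp del: graft.simps simp flip: bplus_bvec)
  qed
  then show ?thesis by (rule derivation_eqI[OF D])
qed

lemma annih_create_commutator:
  "annih s (create t x) - create t (annih s x) = (\<Sum>q\<in>#cut_rests s t. create q x) + mixed_terms s t x +
      (if s = t then grade x else 0)"
  by (rule annih_create[OF annih_dg_commutator])

text \<open>One of the two sums in \<open>[D_s\<^sup>-, D_t\<^sup>-]\<close>, with coefficients
  \<alpha>.\<close>

definition cut_terms :: "mtree \<Rightarrow> mtree \<Rightarrow> forest_alg \<Rightarrow> forest_alg" where
  "cut_terms t s x = (\<Sum>r\<in>set_mset (graft t s). vscale (of_nat (count (cuts r) (t, s))) (annih r x))"

lemma derivation_cut_terms: "derivation (cut_terms t s)"
  unfolding cut_terms_def by (intro derivation_sum derivation_vscale derivation_der)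

lemma cut_terms_bplus:
  "cut_terms t s (bplus (bvec G)) = vscale (of_nat (count (cuts (Node G)) (t, s))) 1 + bplus (cut_terms t s (bvec G))"
proof -
  have "(\<Sum>r\<in>set_mset (graft t s). vscale (of_nat (count (cuts r) (t, s))) (counit r (bvec G))) =
    (\<Sum>r\<in>set_mset (graft t s). if r = Node G then vscale (of_nat (count (cuts (Node G)) (t, s))) 1 else 0)"
    by (intro sum.cong) (auto simp: counit_bvec vscale_simps)
  also have "\<dots> = vscale (of_nat (count (cuts (Node G)) (t, s))) 1"
    by (auto simp: vscale_simps not_in_iff simp flip: cut_iff_graft simp del: cuts.simps)
  finally show ?thesis
    by (simp add: cut_terms_def annih_bplus vscale_simps linear_mapD[OF linear_bplus] sum.distrib del: cuts.simps)
qed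

text \<open>Again the induction through \<open>bplus\<close>; the constant terms on both sides count
  the cuts of \<open>Node G\<close> into \<open>s\<close> and \<open>t\<close>.\<close>

lemma annih_commutator:
  "annih s (annih t x) - annih t (annih s x) = cut_terms t s x - cut_terms s t x"
proof -
  have D: "derivation (\<lambda>x. annih s (annih t x) - annih t (annih s x))"
    "derivation (\<lambda>x. cut_terms t s x - cut_terms s t x)"
    by (rule derivation_commutator[OF derivation_der derivation_der]
        derivation_diff[OF derivation_cut_terms derivation_cut_terms])+
  have "annih s (annih t (bvec {#c#})) - annih t (annih s (bvec {#c#})) =
     cut_terms t s (bvec {#c#}) - cut_terms s t (bvec {#c#})" for c
  proof (induction c)
    case (Node G)
    have "annih s (annih t (bvec G)) - annih t (annih s (bvec G)) = cut_terms t s (bvec G) - cut_terms s t (bvec G)"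
      by (rule derivation_eq_on[OF D]) (use Node in auto)
    from arg_cong[OF this, of bplus]
    have "bplus (annih s (annih t (bvec G))) - bplus (annih t (annih s (bvec G))) =
        bplus (cut_terms t s (bvec G)) - bplus (cut_terms s t (bvec G))"
      by (simp only: linear_mapD[OF linear_bplus])
    moreover have "annih t (counit s (bvec G)) = 0" for s t
      using derivation_one[OF derivation_der, of "cut_gen t"]
      by (simp add: counit_bvec linear_mapD[OF linear_der])
    ultimately show ?case
      by (simp add: annih_bplus counit_annih cut_terms_bplus linear_mapD[OF linear_der]
          linear_mapD[OF linear_bplus] algebra_simps del: cuts.simps flip: bplus_bvec)
  qed
  then show ?thesis by (rule derivation_eqI[OF D])
qed

lemma grade_create_commutator: "grade (create t x) - create t (grade x) = vscale (of_nat (msize t)) (create t x)"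
proof -
  let ?D = "der size_gen"
  have D: "derivation (\<lambda>x. ?D (dg t x) - dg t (?D x))" "derivation (\<lambda>x. vscale (of_nat (msize t)) (dg t x))"
    by (rule derivation_commutator[OF derivation_der derivation_der] derivation_vscale[OF derivation_der])+
  have "?D (dg t (bvec {#c#})) - dg t (?D (bvec {#c#})) = vscale (of_nat (msize t)) (dg t (bvec {#c#}))" for c
  proof -
    have "?D (dg t (bvec {#c#})) = (\<Sum>x\<in>#graft t c. vscale (of_nat (msize x)) (bvec {#x#}))"
      by (simp add: der_gen graft_gen_def linear_mapD[OF linear_der] size_gen_def)
    also have "\<dots> = (\<Sum>x\<in>#graft t c. vscale (of_nat (msize t + msize c)) (bvec {#x#}))"
      by (intro arg_cong[of _ _ sum_mset] image_mset_cong) (simp add: msize_graft)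
    also have "(\<Sum>x\<in>#A. vscale (of_nat (msize t + msize c)) (bvec {#x#})) =
        vscale (of_nat (msize t + msize c)) (\<Sum>x\<in>#A. bvec {#x#})" for A
      by (induction A) (simp_all add: vscale_simps)
    finally show ?thesis
      by (simp add: der_gen graft_gen_def linear_mapD[OF linear_der] size_gen_def vscale_simps)
  qed
  then have "?D (dg t x) - dg t (?D x) = vscale (of_nat (msize t)) (dg t x)"
    by (rule derivation_eqI[OF D])
  moreover have "?D (x * y) = ?D x * y + x * ?D y" for x y
    using derivation_der by (auto simp: derivation_def)
  ultimately show ?thesis
    by (simp add: grade_def create_def linear_mapD[OF linear_der] der_gen size_gen_def vscale_simps vscale_mult_left vscale_mult_right algebra_simps)
qed

lemma grade_annih_commutator: "grade (annih t x) - annih t (grade x) = - vscale (of_nat (msize t)) (annih t x)"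
proof -
  let ?D = "der size_gen"
  have D: "derivation (\<lambda>x. ?D (annih t x) - annih t (?D x))" "derivation (\<lambda>x. vscale (- of_nat (msize t)) (annih t x))"
    by (rule derivation_commutator[OF derivation_der derivation_der] derivation_vscale[OF derivation_der])+
  have "?D (annih t (bvec {#c#})) - annih t (?D (bvec {#c#})) = vscale (- of_nat (msize t)) (annih t (bvec {#c#}))" for c
  proof -
    have "?D (\<Sum>q\<in>#cut_rests t c. bvec {#q#}) =
        vscale (of_nat (msize c) - of_nat (msize t)) (\<Sum>q\<in>#cut_rests t c. bvec {#q#})"
    proof -
      have q: "of_nat (msize q) = (of_nat (msize c) - of_nat (msize t) :: complex)" if "q \<in># cut_rests t c" for q
      proof -
        have "(t, q) \<in># cuts c" using that count_cut_rests[of t c q] by (metis count_eq_zero_iff)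
        then show ?thesis using msize_graft[of c t q] cut_iff_graft by simp
      qed
      have "?D (\<Sum>q\<in>#cut_rests t c. bvec {#q#}) = (\<Sum>q\<in>#cut_rests t c. vscale (of_nat (msize q)) (bvec {#q#}))"
        by (simp add: der_gen linear_mapD[OF linear_der] size_gen_def)
      also have "\<dots> = (\<Sum>q\<in>#cut_rests t c. vscale (of_nat (msize c) - of_nat (msize t)) (bvec {#q#}))"
        by (intro arg_cong[of _ _ sum_mset] image_mset_cong) (simp only: q)
      also have "(\<Sum>q\<in>#A. vscale a (bvec {#q#})) = vscale a (\<Sum>q\<in>#A. bvec {#q#})" for A a
        by (induction A) (simp_all add: vscale_simps)
      finally show ?thesis .
    qed
    moreover have "?D 1 = 0" by (rule derivation_one[OF derivation_der])
    ultimately show ?thesis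
      unfolding size_gen_def[of c] der_gen linear_mapD[OF linear_der] cut_gen_def sum_cut_rests
      by (cases "t = c") (simp_all add: linear_mapD[OF linear_der] vscale_simps)
  qed
  then have "?D (annih t x) - annih t (?D x) = vscale (- of_nat (msize t)) (annih t x)"
    by (rule derivation_eqI[OF D])
  then show ?thesis
    by (simp add: grade_def linear_mapD[OF linear_der] vscale_simps algebra_simps)
qed

section \<open>The representation of the Lie algebra on forests\<close>

definition tdecode :: "mtree \<Rightarrow> rtree" where
  "tdecode y = (THE t. tcode t = y)"

lemma tdecode_tcode [simp]: "tdecode (tcode t) = t"
  by (simp add: tdecode_def)

lemma tcode_tdecode [simp]: "tcode (tdecode y) = y"
  using tcode_surj[of y] by auto

fun rho :: "ie_basis \<Rightarrow> forest_alg \<Rightarrow> forest_alg" where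
  "rho Dgr = grade"
| "rho (Dplus t) = create (tcode t)"
| "rho (Dminus t) = annih (tcode t)"

definition lie_op :: "ie_alg \<Rightarrow> forest_alg \<Rightarrow> forest_alg" where
  "lie_op x h = lin_ext vscale (\<lambda>b. rho b h) x"

lemma linear_rho: "linear_map (rho b)"
  by (cases b) (simp_all add: linear_grade linear_create linear_der)

lemma linear_lie_op1: "linear_map (\<lambda>x. lie_op x h)"
  unfolding lie_op_def by (rule linear_map_lin_ext)

lemma linear_lie_op2: "linear_map (lie_op x)"
  unfolding lie_op_def lin_ext_def
  by (intro linear_map_sum linear_map_vscale linear_rho)

lemma lie_op_single: "lie_op (Poly_Mapping.single b c) h = vscale c (rho b h)"
  by (simp add: lie_op_def lin_ext_single[OF scalar_action_vscale])

lemma sum_mset_vscale: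
  assumes "finite A" "set_mset X \<subseteq> A"
  shows "(\<Sum>y\<in>#X. g y) = (\<Sum>y\<in>A. vscale (of_nat (count X y)) (g y :: 'k \<Rightarrow>\<^sub>0 complex))"
  using assms(2)
proof (induction X)
  case (add x X)
  have "(\<Sum>y\<in>A. vscale (of_nat (count (add_mset x X) y)) (g y)) =
    (\<Sum>y\<in>A. (if y = x then g x else 0) + vscale (of_nat (count X y)) (g y))"
    by (intro sum.cong) (auto simp: vscale_simps)
  then show ?case
    using add assms(1) by (simp add: sum.distrib)
qed (simp add: vscale_simps)

text \<open>Turns the sums over all rooted trees in the brackets into sums over codes, taken over
  any finite set that contains the support.\<close>

lemma Sum_any_trees:
  assumes "finite A" "\<And>y. k (tdecode y) \<noteq> 0 \<Longrightarrow> y \<in> A"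
  shows "Sum_any (\<lambda>r. Poly_Mapping.single (B r) (k r)) =
    (\<Sum>y\<in>A. vscale (k (tdecode y)) (bvec (B (tdecode y))))"
proof -
  have "{r. Poly_Mapping.single (B r) (k r) \<noteq> 0} \<subseteq> tdecode ` A"
  proof
    fix r assume "r \<in> {r. Poly_Mapping.single (B r) (k r) \<noteq> 0}"
    then have "k (tdecode (tcode r)) \<noteq> 0" by auto
    then have "tcode r \<in> A" by (rule assms(2))
    then show "r \<in> tdecode ` A" by (intro image_eqI[of _ _ "tcode r"]) auto
  qed
  then have "Sum_any (\<lambda>r. Poly_Mapping.single (B r) (k r)) = (\<Sum>r\<in>tdecode ` A. Poly_Mapping.single (B r) (k r))"
    using assms(1) by (intro Sum_any.expand_superset) auto
  also have "\<dots> = (\<Sum>y\<in>A. Poly_Mapping.single (B (tdecode y)) (k (tdecode y)))"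
    by (subst sum.reindex) (auto intro: inj_on_inverseI[of _ tcode])
  finally show ?thesis
    by (simp only: single_conv_vscale[of _ "k _"])
qed

lemma lie_op_Sum_any:
  assumes "finite A" "\<And>y. k (tdecode y) \<noteq> 0 \<Longrightarrow> y \<in> A"
  shows "lie_op (Sum_any (\<lambda>r. Poly_Mapping.single (B r) (k r))) h =
    (\<Sum>y\<in>A. vscale (k (tdecode y)) (rho (B (tdecode y)) h))"
  by (subst Sum_any_trees[OF assms]) (simp_all add: linear_mapD[OF linear_lie_op1] lie_op_single vscale_simps)

lemma lie_op_plus_plus: "lie_op (basis_bracket (Dplus s) (Dplus t)) h =
  rho (Dplus s) (rho (Dplus t) h) - rho (Dplus t) (rho (Dplus s) h)"
proof -
  let ?X = "graft (tcode s) (tcode t)" and ?Y = "graft (tcode t) (tcode s)"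
  let ?A = "set_mset ?X \<union> set_mset ?Y"
  have "lie_op (basis_bracket (Dplus s) (Dplus t)) h =
      (\<Sum>y\<in>?A. vscale (of_nat (count ?X y) - of_nat (count ?Y y)) (create y h))"
    unfolding basis_bracket.simps
    by (subst lie_op_Sum_any[of ?A]) (auto simp: \<beta>_count not_in_iff)
  also have "\<dots> = (\<Sum>y\<in>#?X. create y h) - (\<Sum>y\<in>#?Y. create y h)"
    by (simp add: sum_mset_vscale[of ?A] vscale_simps sum_subtractf)
  finally show ?thesis by (simp add: create_commutator)
qed

lemma cut_terms_superset:
  assumes "finite A" "set_mset (graft t s) \<subseteq> A"
  shows "cut_terms t s x = (\<Sum>r\<in>A. vscale (of_nat (count (cuts r) (t, s))) (annih r x))"
  unfolding cut_terms_def using assms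
  by (intro sum.mono_neutral_left) (auto simp: vscale_simps not_in_iff simp flip: cut_iff_graft)

lemma lie_op_minus_minus: "lie_op (basis_bracket (Dminus s) (Dminus t)) h =
  rho (Dminus s) (rho (Dminus t) h) - rho (Dminus t) (rho (Dminus s) h)"
proof -
  let ?s = "tcode s" and ?t = "tcode t"
  let ?A = "set_mset (graft ?t ?s) \<union> set_mset (graft ?s ?t)"
  have "lie_op (basis_bracket (Dminus s) (Dminus t)) h =
      (\<Sum>y\<in>?A. vscale (of_nat (count (cuts y) (?t, ?s)) - of_nat (count (cuts y) (?s, ?t))) (annih y h))"
    unfolding basis_bracket.simps
    by (subst lie_op_Sum_any[of ?A]) (auto simp: \<alpha>_count not_in_iff simp flip: cut_iff_graft)
  also have "\<dots> = cut_terms ?t ?s h - cut_terms ?s ?t h"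
    by (simp add: cut_terms_superset[of ?A] vscale_simps sum_subtractf)
  finally show ?thesis by (simp add: annih_commutator)
qed

lemma in_cut_rests: "q \<in># cut_rests s t \<longleftrightarrow> (s, q) \<in># cuts t"
  by (metis count_cut_rests count_eq_zero_iff)

lemma lie_op_minus_plus: "lie_op (bracket_minus_plus s t) h =
  rho (Dminus s) (rho (Dplus t) h) - rho (Dplus t) (rho (Dminus s) h)"
proof (cases "s = t")
  case True
  \<comment> \<open>Grafting strictly increases the size. So for equal trees the cut terms and the
    mixed terms are empty, and only the grading operator remains, in accordance with the separate
    clause of the bracket.\<close>
  have no: "tcode s \<notin># graft (tcode s) q" for q
    using msize_graft[of "tcode s" "tcode s" q] msize_pos[of q] by auto
  then have "count (cut_rests (tcode s) (tcode t)) q = 0" for q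
    using True no cut_iff_graft[of "tcode s" q "tcode s"]
    by (simp only: count_cut_rests count_eq_zero_iff not_False_eq_True)
  then have "cut_rests (tcode s) (tcode t) = {#}" by (intro multiset_eqI) simp
  moreover have "{r. tcode s \<in># graft (tcode t) r} = {}"
    using no True by simp
  ultimately show ?thesis
    using True by (simp add: bracket_minus_plus_def annih_create_commutator mixed_terms_def lie_op_single vscale_simps)
next
  case False
  let ?X = "cut_rests (tcode s) (tcode t)" and ?R = "{r. tcode s \<in># graft (tcode t) r}"
  have 1: "lie_op (Sum_any (\<lambda>r. Poly_Mapping.single (Dplus r) (of_nat (\<alpha> s t r)))) h =
      (\<Sum>y\<in>set_mset ?X. vscale (of_nat (count ?X y)) (create y h))"
    by (subst lie_op_Sum_any[of "set_mset ?X"]) (auto simp: \<alpha>_count count_cut_rests in_cut_rests)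
  have 2: "lie_op (Sum_any (\<lambda>r. Poly_Mapping.single (Dminus r) (of_nat (\<beta> s t r)))) h =
      (\<Sum>y\<in>?R. vscale (of_nat (count (graft (tcode t) y) (tcode s))) (annih y h))"
    by (subst lie_op_Sum_any[of ?R]) (auto simp: \<beta>_count not_in_iff finite_graft_inverse)
  show ?thesis
    using False
    by (simp add: bracket_minus_plus_def annih_create_commutator linear_mapD[OF linear_lie_op1] 1 2
        mixed_terms_def sum_mset_vscale[of "set_mset ?X" ?X])
qed

lemma lie_op_basis_bracket: "lie_op (basis_bracket a b) h = rho a (rho b h) - rho b (rho a h)"
proof (cases a; cases b)
  fix t assume "a = Dplus t" "b = Dgr"
  then show ?thesis
    using grade_create_commutator[of "tcode t" h] by (simp add: lie_op_single vscale_simps tsize_tcode algebra_simps)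
next
  fix t assume "a = Dgr" "b = Dplus t"
  then show ?thesis
    using grade_create_commutator[of "tcode t" h] by (simp add: lie_op_single vscale_simps tsize_tcode)
next
  fix t assume "a = Dminus t" "b = Dgr"
  then show ?thesis
    using grade_annih_commutator[of "tcode t" h] by (simp add: lie_op_single vscale_simps tsize_tcode algebra_simps)
next
  fix t assume "a = Dgr" "b = Dminus t"
  then show ?thesis
    using grade_annih_commutator[of "tcode t" h] by (simp add: lie_op_single vscale_simps tsize_tcode)
next
  fix s t assume "a = Dplus s" "b = Dplus t"
  then show ?thesis using lie_op_plus_plus by simp
next
  fix s t assume "a = Dminus s" "b = Dminus t"
  then show ?thesis using lie_op_minus_minus by simp
next
  fix s t assume "a = Dminus s" "b = Dplus t"
  then show ?thesis using lie_op_minus_plus by simp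
next
  fix s t assume "a = Dplus t" "b = Dminus s"
  then show ?thesis using lie_op_minus_plus[of s t h] by (simp add: linear_mapD[OF linear_lie_op1])
qed (simp add: linear_mapD[OF linear_lie_op1])

lemma lie_op_bracket: "lie_op (ie_bracket x y) h = lie_op x (lie_op y h) - lie_op y (lie_op x h)"
proof -
  let ?l = "Poly_Mapping.lookup"
  have "lie_op (ie_bracket x y) h = (\<Sum>a\<in>Poly_Mapping.keys x. \<Sum>b\<in>Poly_Mapping.keys y.
      vscale (?l x a * ?l y b) (rho a (rho b h) - rho b (rho a h)))"
    by (simp only: bilinear_ext_def linear_mapD[OF linear_lie_op1] lie_op_basis_bracket)
  also have "\<dots> = (\<Sum>a\<in>Poly_Mapping.keys x. \<Sum>b\<in>Poly_Mapping.keys y. vscale (?l x a * ?l y b) (rho a (rho b h)))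
     - (\<Sum>b\<in>Poly_Mapping.keys y. \<Sum>a\<in>Poly_Mapping.keys x. vscale (?l y b * ?l x a) (rho b (rho a h)))"
    by (simp add: vscale_simps(9) sum_subtractf mult.commute sum.swap[of _ "Poly_Mapping.keys y"])
  also have "\<dots> = lie_op x (lie_op y h) - lie_op y (lie_op x h)"
    by (simp only: lie_op_def lin_ext_def linear_mapD[OF linear_rho] vscale_simps(2) scalar_action_sum[OF scalar_action_vscale])
  finally show ?thesis .
qed

section \<open>A functional of a given type on forests\<close>

context
  fixes \<chi> :: "mtree \<Rightarrow> complex"
  assumes chi: "(\<Sum>r\<in>#graft s t. \<chi> r) = (\<Sum>r\<in>#graft t s. \<chi> r)"
begin

text \<open>\<open>create t (bvec G)\<close> is \<open>bvec (add_mset t G)\<close> plus forests with as many trees as \<open>G\<close>, so the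
  required identity for one chosen \<open>t \<in># F\<close> determines the value on \<open>F\<close>.\<close>

primrec psi_upto :: "nat \<Rightarrow> mtree multiset \<Rightarrow> complex" where
  "psi_upto 0 F = 1"
| "psi_upto (Suc n) F = (let t = (SOME t. t \<in># F); G = F - {#t#} in
     - \<chi> t * psi_upto n G - lin_ext (*) (psi_upto n) (dg t (bvec G)))"

definition psi :: "mtree multiset \<Rightarrow> complex" where
  "psi F = psi_upto (size F) F"

definition psi_lin :: "forest_alg \<Rightarrow> complex" where
  "psi_lin = lin_ext (*) psi"

lemmas psi_lin_simps = lin_ext_add[OF scalar_action_times, of psi, folded psi_lin_def]
  lin_ext_diff[OF scalar_action_times, of psi, folded psi_lin_def]
  lin_ext_sum[OF scalar_action_times, of psi, folded psi_lin_def]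
  lin_ext_sum_mset[OF scalar_action_times, of psi, folded psi_lin_def]
  lin_ext_vscale[OF scalar_action_times, of psi, folded psi_lin_def]
  lin_ext_minus[OF scalar_action_times, of psi, folded psi_lin_def]

lemma psi_lin_bvec: "psi_lin (bvec F) = psi F"
  by (simp add: psi_lin_def lin_ext_single[OF scalar_action_times])

text \<open>Grafting onto a tree of the forest keeps the number of trees, which is what the
  recursion for \<open>psi\<close> descends on.\<close>

lemma keys_dg: "F \<in> Poly_Mapping.keys (dg t (bvec G)) \<Longrightarrow> size F = size G"
proof -
  assume F: "F \<in> Poly_Mapping.keys (dg t (bvec G))"
  have "dg t (bvec G) = (\<Sum>c\<in>#G. \<Sum>x\<in>#graft t c. bvec (add_mset x (G - {#c#})))"
    unfolding der_monomial graft_gen_def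
    by (intro arg_cong[of _ _ sum_mset] image_mset_cong) (simp add: sum_mset_distrib_right mult_single)
  moreover have "Poly_Mapping.lookup (\<Sum>c\<in>#H. \<Sum>x\<in>#graft t c. bvec (add_mset x (G - {#c#}))) F = 0"
    if "size F \<noteq> size G" "H \<subseteq># G" for H
    using that(2)
  proof (induction H)
    case (add c H)
    then have c: "c \<in># G" "H \<subseteq># G" by (auto dest: mset_subset_eq_insertD)
    then have "size (add_mset x (G - {#c#})) = size G" for x
      by (auto dest!: multi_member_split)
    then have "F \<noteq> add_mset x (G - {#c#})" for x
      using that(1) by metis
    then have "Poly_Mapping.lookup (\<Sum>x\<in>#X. bvec (add_mset x (G - {#c#}))) F = 0" for X :: "mtree multiset"
      by (induction X) (auto simp: lookup_add lookup_single when_def)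
    then show ?case using add.IH c(2) by (simp add: lookup_add)
  qed simp
  ultimately show ?thesis using F by (auto simp: in_keys_iff)
qed

text \<open>For the tree picked in the recursion the identity holds by construction; for all other
  trees it needs the argument below.\<close>

lemma psi_step:
  assumes "F \<noteq> {#}"
  obtains t where "t \<in># F" "psi_lin (create t (bvec (F - {#t#}))) = - \<chi> t * psi (F - {#t#})"
proof -
  define t where "t = (SOME t. t \<in># F)"
  have "\<exists>t. t \<in># F" using assms by (metis multiset_nonemptyE)
  then have t: "t \<in># F" unfolding t_def by (rule someI_ex[of "\<lambda>t. t \<in># F"])
  then obtain n where n: "size F = Suc n" "size (F - {#t#}) = n"
    by (auto dest!: multi_member_split)
  let ?G = "F - {#t#}"
  have "lin_ext (*) (psi_upto n) (dg t (bvec ?G)) = psi_lin (dg t (bvec ?G))"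
    unfolding psi_lin_def lin_ext_def psi_def using keys_dg n by (intro sum.cong) auto
  then have "psi F = - \<chi> t * psi ?G - psi_lin (dg t (bvec ?G))"
    by (simp add: psi_def n Let_def flip: t_def)
  moreover have "bvec {#t#} * bvec ?G = bvec F"
    using t by (simp add: mult_single)
  ultimately have "psi_lin (create t (bvec ?G)) = - \<chi> t * psi ?G"
    by (simp add: create_def psi_lin_simps psi_lin_bvec)
  then show ?thesis using that t by blast
qed

text \<open>Independence of the tree picked in the recursion. If \<open>s\<close> was picked on
  \<open>add_mset t G\<close>, compare the two orders of applying \<open>create\<close> for
  \<open>s\<close> and \<open>t\<close>: their difference is a combination of
  \<open>create r\<close> over grafts \<open>r\<close>, on which \<open>psi_lin\<close> vanishes by
  the symmetry assumed of \<chi>.\<close>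

lemma psi_create_bvec: "psi_lin (create t (bvec G)) = - \<chi> t * psi G"
proof (induction "size G" arbitrary: G t rule: less_induct)
  case less
  \<comment> \<open>The linear form of the induction hypothesis; it is applied to
    \<open>dg s (bvec G')\<close>, a sum of forests with as many trees as \<open>G'\<close>.\<close>
  have IH: "psi_lin (create t x) = - \<chi> t * psi_lin x" if small: "\<And>F. F \<in> Poly_Mapping.keys x \<Longrightarrow> size F < size G" for t x
  proof -
    have "psi_lin (create t x) = psi_lin (create t (\<Sum>F\<in>Poly_Mapping.keys x. vscale (Poly_Mapping.lookup x F) (bvec F)))"
      using poly_expand[of x] by (simp add: single_conv_vscale[symmetric])
    also have "\<dots> = (\<Sum>F\<in>Poly_Mapping.keys x. - \<chi> t * (Poly_Mapping.lookup x F * psi F))"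
    proof -
      have "psi_lin (create t (bvec F)) = - \<chi> t * psi F" if "F \<in> Poly_Mapping.keys x" for F
        by (rule less.hyps[OF small[OF that]])
      then show ?thesis
        unfolding linear_mapD[OF linear_create] psi_lin_simps by (intro sum.cong) simp_all
    qed
    also have "\<dots> = - \<chi> t * psi_lin x"
      by (simp add: psi_lin_def lin_ext_def sum_distrib_left)
    finally show ?thesis .
  qed
  obtain s where s: "s \<in># add_mset t G"
    "psi_lin (create s (bvec (add_mset t G - {#s#}))) = - \<chi> s * psi (add_mset t G - {#s#})"
    using psi_step[of "add_mset t G"] by auto
  show ?case
  proof (cases "s = t")
    case True
    then show ?thesis using s by simp
  next
    case False
    define G' where "G' = G - {#s#}"
    have G: "G = add_mset s G'" "size G' < size G" "add_mset t G - {#s#} = add_mset t G'"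
      using s(1) False by (auto simp: G'_def dest!: multi_member_split)
    \<comment> \<open>Trades multiplication by a tree for \<open>create\<close>, whose commutators
      are known.\<close>
    have b: "bvec (add_mset t G') = create t (bvec G') - dg t (bvec G')" for t
      by (simp add: create_def mult_single)
    have IHG: "psi_lin (create t (bvec G')) = - \<chi> t * psi G'" for t
      by (rule less.hyps[OF G(2)])
    have IHdg: "psi_lin (create t (dg s (bvec G'))) = - \<chi> t * psi_lin (dg s (bvec G'))" for t s
      by (rule IH) (simp add: keys_dg G(2))
    have "create t (create s (bvec G')) = create s (create t (bvec G')) +
       ((\<Sum>r\<in>#graft t s. create r (bvec G')) - (\<Sum>r\<in>#graft s t. create r (bvec G')))"
      by (simp flip: create_commutator)
    then have "psi_lin (create t (create s (bvec G'))) = psi_lin (create s (create t (bvec G'))) +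
       ((\<Sum>r\<in>#graft t s. - \<chi> r * psi G') - (\<Sum>r\<in>#graft s t. - \<chi> r * psi G'))"
      by (simp only: psi_lin_simps IHG)
    also have "(\<Sum>r\<in>#graft t s. - \<chi> r * psi G') - (\<Sum>r\<in>#graft s t. - \<chi> r * psi G') = 0"
    proof -
      have "(\<Sum>r\<in>#A. - \<chi> r * psi G') = - (\<Sum>r\<in>#A. \<chi> r) * psi G'" for A
        by (induction A) (simp_all add: algebra_simps)
      then show ?thesis by (simp only: chi[of t s] diff_self)
    qed
    finally have 1: "psi_lin (create t (create s (bvec G'))) = psi_lin (create s (create t (bvec G')))"
      by simp
    have "psi_lin (create s (bvec (add_mset t G'))) = - \<chi> s * psi (add_mset t G')"
      using s(2) G(3) by simp
    then have "psi_lin (create s (create t (bvec G'))) - psi_lin (create s (dg t (bvec G'))) =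
        - \<chi> s * (psi_lin (create t (bvec G')) - psi_lin (dg t (bvec G')))"
      by (simp only: b linear_mapD[OF linear_create] psi_lin_simps flip: psi_lin_bvec)
    then have 2: "psi_lin (create s (create t (bvec G'))) = \<chi> s * \<chi> t * psi G'"
      by (simp add: IHdg IHG algebra_simps)
    have "psi_lin (create t (bvec G)) = psi_lin (create t (create s (bvec G'))) - psi_lin (create t (dg s (bvec G')))"
      unfolding G(1) b by (simp only: linear_mapD[OF linear_create] psi_lin_simps)
    also have "\<dots> = - \<chi> t * (psi_lin (create s (bvec G')) - psi_lin (dg s (bvec G')))"
      by (simp add: 1 2 IHdg IHG algebra_simps)
    also have "\<dots> = - \<chi> t * psi G"
      unfolding G(1) by (simp only: b psi_lin_simps flip: psi_lin_bvec)
    finally show ?thesis .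
  qed
qed

lemma psi_lin_create: "psi_lin (create t x) = - \<chi> t * psi_lin x"
proof -
  have "psi_lin (create t x) = psi_lin (create t (\<Sum>F\<in>Poly_Mapping.keys x. vscale (Poly_Mapping.lookup x F) (bvec F)))"
    using poly_expand[of x] by (simp add: single_conv_vscale[symmetric])
  also have "\<dots> = (\<Sum>F\<in>Poly_Mapping.keys x. Poly_Mapping.lookup x F * (- \<chi> t * psi F))"
    by (simp only: linear_mapD[OF linear_create] psi_lin_simps psi_create_bvec)
  also have "\<dots> = - \<chi> t * psi_lin x"
    by (simp add: psi_lin_def lin_ext_def sum_distrib_left mult.left_commute)
  finally show ?thesis .
qed

lemma psi_lin_one: "psi_lin 1 = 1"
proof -
  have "psi_lin (bvec {#}) = 1"
    unfolding psi_lin_bvec by (simp add: psi_def)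
  then show ?thesis by (simp flip: zero_multiset_def)
qed

end

section \<open>The tensor algebra and the enveloping algebra\<close>

lemma letters_zero [simp]: "letters 0 = []"
  by (simp add: zero_fword_def)

lemma letters_plus [simp]: "letters (u + v) = letters u @ letters v"
  by (simp add: plus_fword_def)

lemma tensor_carrier: "p \<in> carrier (tensor_algebra B) \<longleftrightarrow> (\<forall>w\<in>Poly_Mapping.keys p. set (letters w) \<subseteq> B)"
  by (simp add: tensor_algebra_def)

lemma tensor_carrier_UNIV [simp]: "p \<in> carrier (tensor_algebra UNIV)"
  by (simp add: tensor_carrier)

lemma tensor_closed:
  assumes "p \<in> carrier (tensor_algebra B)" "q \<in> carrier (tensor_algebra B)"
  shows "p + q \<in> carrier (tensor_algebra B)" "p * q \<in> carrier (tensor_algebra B)"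
    "- p \<in> carrier (tensor_algebra B)"
proof -
  show "p + q \<in> carrier (tensor_algebra B)"
    using assms keys_add[of p q] unfolding tensor_carrier by blast
  show "p * q \<in> carrier (tensor_algebra B)"
    unfolding tensor_carrier
  proof
    fix w assume "w \<in> Poly_Mapping.keys (p * q)"
    then obtain u v where "w = u + v" "u \<in> Poly_Mapping.keys p" "v \<in> Poly_Mapping.keys q"
      using keys_mult[of p q] by blast
    then show "set (letters w) \<subseteq> B"
      using assms unfolding tensor_carrier by fastforce
  qed
  show "- p \<in> carrier (tensor_algebra B)"
    using assms by (simp add: tensor_carrier in_keys_iff)
qed

lemma tensor_const [simp]: "0 \<in> carrier (tensor_algebra B)" "1 \<in> carrier (tensor_algebra B)"
  "Poly_Mapping.single 0 c \<in> carrier (tensor_algebra B)"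
  by (auto simp: tensor_carrier split: if_splits)

lemma tensor_sel [simp]: "x \<otimes>\<^bsub>tensor_algebra B\<^esub> y = x * y" "x \<oplus>\<^bsub>tensor_algebra B\<^esub> y = x + y"
  "\<one>\<^bsub>tensor_algebra B\<^esub> = 1" "\<zero>\<^bsub>tensor_algebra B\<^esub> = 0"
  by (simp_all add: tensor_algebra_def)

lemma ring_tensor_algebra: "Ring.ring (tensor_algebra B)"
proof (rule ringI)
  show "abelian_group (tensor_algebra B)"
  proof (rule abelian_groupI)
    fix x assume "x \<in> carrier (tensor_algebra B)"
    then show "\<exists>y\<in>carrier (tensor_algebra B). y \<oplus>\<^bsub>tensor_algebra B\<^esub> x = \<zero>\<^bsub>tensor_algebra B\<^esub>"
      using tensor_closed(3) by (intro bexI[of _ "- x"]) auto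
  qed (simp_all add: tensor_closed algebra_simps)
  show "Group.monoid (tensor_algebra B)"
    by (rule monoidI) (simp_all add: tensor_closed mult.assoc)
qed (simp_all add: algebra_simps)

lemma tensor_minus [simp]:
  "x \<in> carrier (tensor_algebra B) \<Longrightarrow> \<ominus>\<^bsub>tensor_algebra B\<^esub> x = - x"
proof -
  interpret ring "tensor_algebra B" by (rule ring_tensor_algebra)
  assume "x \<in> carrier (tensor_algebra B)"
  then show ?thesis
    using tensor_closed(3) by (intro minus_equality) auto
qed

lemma ideal_tensor_algebra:
  assumes "\<And>x. x \<in> I \<Longrightarrow> x \<in> carrier (tensor_algebra B)" "0 \<in> I"
    and "\<And>x y. x \<in> I \<Longrightarrow> y \<in> I \<Longrightarrow> x + y \<in> I" "\<And>x. x \<in> I \<Longrightarrow> - x \<in> I"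
    and "\<And>x a. x \<in> I \<Longrightarrow> a \<in> carrier (tensor_algebra B) \<Longrightarrow> a * x \<in> I"
    and "\<And>x a. x \<in> I \<Longrightarrow> a \<in> carrier (tensor_algebra B) \<Longrightarrow> x * a \<in> I"
  shows "ideal I (tensor_algebra B)"
proof (rule idealI[OF ring_tensor_algebra])
  interpret ring "tensor_algebra B" by (rule ring_tensor_algebra)
  show "subgroup I (add_monoid (tensor_algebra B))"
  proof (rule group.subgroupI[OF a_group])
    fix x assume x: "x \<in> I"
    then have "inv\<^bsub>add_monoid (tensor_algebra B)\<^esub> x = - x"
      using tensor_minus[OF assms(1)[OF x]] by (simp add: a_inv_def)
    then show "inv\<^bsub>add_monoid (tensor_algebra B)\<^esub> x \<in> I"
      using assms(4)[OF x] by simp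
  qed (use assms in auto)
qed (use assms in auto)

definition uea_relations :: "('b \<Rightarrow> 'b \<Rightarrow> ('b \<Rightarrow>\<^sub>0 complex)) \<Rightarrow> 'b set \<Rightarrow> ('b fword \<Rightarrow>\<^sub>0 complex) set" where
  "uea_relations br B = {degree_one x * degree_one y - degree_one y * degree_one x - degree_one (bilinear_ext br x y)
      | x y. x \<in> span_of B \<and> y \<in> span_of B}"

lemma degree_one_conv: "degree_one x = lin_ext vscale (\<lambda>b. bvec (FWord [b])) x"
  unfolding degree_one_def lin_ext_def
  by (intro sum.cong refl single_conv_vscale)

lemma linear_degree_one: "linear_map degree_one"
  unfolding degree_one_conv[abs_def] by (rule linear_map_lin_ext)

lemma degree_one_bvec: "degree_one (bvec b) = bvec (FWord [b])"
  by (simp add: degree_one_conv lin_ext_bvec)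

lemma keys_sum_subset: "(\<And>i. i \<in> A \<Longrightarrow> Poly_Mapping.keys (f i) \<subseteq> S) \<Longrightarrow> Poly_Mapping.keys (sum f A) \<subseteq> S"
proof (induction A rule: infinite_finite_induct)
  case (insert a A)
  then show ?case using keys_add[of "f a" "sum f A"] by auto
qed auto

lemma degree_one_carrier: "x \<in> span_of B \<Longrightarrow> degree_one x \<in> carrier (tensor_algebra B)"
proof -
  assume x: "x \<in> span_of B"
  have "Poly_Mapping.keys (degree_one x) \<subseteq> {w. set (letters w) \<subseteq> B}"
    unfolding degree_one_def
    by (rule keys_sum_subset) (use x in \<open>auto simp: span_of_def\<close>)
  then show ?thesis
    by (auto simp: tensor_carrier)
qed

lemma relations_carrier:
  assumes "\<And>x y. x \<in> span_of B \<Longrightarrow> y \<in> span_of B \<Longrightarrow> bilinear_ext br x y \<in> span_of B"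
  shows "uea_relations br B \<subseteq> carrier (tensor_algebra B)"
proof -
  have diff: "x - y \<in> carrier (tensor_algebra B)"
    if "x \<in> carrier (tensor_algebra B)" "y \<in> carrier (tensor_algebra B)" for x y
    using tensor_closed(1)[OF that(1) tensor_closed(3)[OF that(2) that(2)]] by simp
  then show ?thesis
    unfolding uea_relations_def
    by (intro subsetI, elim CollectE exE conjE, hypsubst)
      (intro diff tensor_closed(2) degree_one_carrier assms)
qed

text \<open>The way to see that a map factors through an enveloping algebra: its kernel is an ideal
  that contains the relations.\<close>

lemma uea_ideal_minimal:
  assumes "ideal I (tensor_algebra B)" "uea_relations br B \<subseteq> I"
  shows "uea_ideal br B \<subseteq> I"
proof -
  interpret ring "tensor_algebra B" by (rule ring_tensor_algebra)
  show ?thesis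
    using genideal_minimal[OF assms] by (simp add: uea_ideal_def uea_relations_def)
qed

lemma uea_ideal_ideal:
  assumes "\<And>x y. x \<in> span_of B \<Longrightarrow> y \<in> span_of B \<Longrightarrow> bilinear_ext br x y \<in> span_of B"
  shows "ideal (uea_ideal br B) (tensor_algebra B)" "uea_relations br B \<subseteq> uea_ideal br B"
proof -
  interpret ring "tensor_algebra B" by (rule ring_tensor_algebra)
  show "ideal (uea_ideal br B) (tensor_algebra B)" "uea_relations br B \<subseteq> uea_ideal br B"
    using genideal_ideal[OF relations_carrier[OF assms]] genideal_self[OF relations_carrier[OF assms]]
    by (simp_all add: uea_ideal_def uea_relations_def)
qed

lemma uea_class_eq_set: "uea_class br B p = {j + p | j. j \<in> uea_ideal br B}"
  by (auto simp: uea_class_def a_r_coset_def r_coset_def tensor_algebra_def)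

text \<open>Closure under the bracket places the relations inside \<open>tensor_algebra B\<close>,
  so that the generated ideal is an ideal of that ring.\<close>

locale closed_bracket =
  fixes br :: "'b \<Rightarrow> 'b \<Rightarrow> ('b \<Rightarrow>\<^sub>0 complex)" and B :: "'b set"
  assumes closed: "\<And>x y. x \<in> span_of B \<Longrightarrow> y \<in> span_of B \<Longrightarrow> bilinear_ext br x y \<in> span_of B"
begin

lemma ideal_J: "ideal (uea_ideal br B) (tensor_algebra B)"
  by (rule uea_ideal_ideal(1)[OF closed])

abbreviation "J \<equiv> uea_ideal br B"
abbreviation "cls \<equiv> uea_class br B"

lemma J_zero: "0 \<in> J"
  using additive_subgroup.zero_closed[OF ideal.axioms(1)[OF ideal_J]] by simp

lemma J_add: "x \<in> J \<Longrightarrow> y \<in> J \<Longrightarrow> x + y \<in> J"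
  using additive_subgroup.a_closed[OF ideal.axioms(1)[OF ideal_J]] by simp

lemma J_left: "x \<in> J \<Longrightarrow> a \<in> carrier (tensor_algebra B) \<Longrightarrow> a * x \<in> J"
  using ideal.I_l_closed[OF ideal_J] by simp

lemma J_uminus: "x \<in> J \<Longrightarrow> - x \<in> J"
  using J_left[of x "- 1"] tensor_closed(3)[OF tensor_const(2) tensor_const(2), of B] by simp

lemma J_right: "x \<in> J \<Longrightarrow> a \<in> carrier (tensor_algebra B) \<Longrightarrow> x * a \<in> J"
  using ideal.I_r_closed[OF ideal_J] by simp

lemma J_relation: "x \<in> span_of B \<Longrightarrow> y \<in> span_of B \<Longrightarrow>
    degree_one x * degree_one y - degree_one y * degree_one x - degree_one (bilinear_ext br x y) \<in> J"
  using uea_ideal_ideal(2)[OF closed] by (auto simp: uea_relations_def)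

lemma cls_eq_iff: "cls p = cls q \<longleftrightarrow> p - q \<in> J"
proof
  assume "cls p = cls q"
  moreover have "0 + p \<in> cls p" unfolding uea_class_eq_set using J_zero by blast
  ultimately show "p - q \<in> J" by (auto simp: uea_class_eq_set)
next
  assume pq: "p - q \<in> J"
  have "\<exists>j'. j + p = j' + q \<and> j' \<in> J" if "j \<in> J" for j
    using that pq by (intro exI[of _ "j + (p - q)"]) (simp add: J_add)
  moreover have "\<exists>j'. j + q = j' + p \<and> j' \<in> J" if "j \<in> J" for j
    using that J_add[OF that J_uminus[OF pq]] by (intro exI[of _ "j + - (p - q)"]) simp
  ultimately show "cls p = cls q" by (auto simp: uea_class_eq_set)
qed

lemma carrier_uea: "carrier (uea br B) = cls ` carrier (tensor_algebra B)"
  by (auto simp: uea_def FactRing_def A_RCOSETS_def RCOSETS_def uea_class_def a_r_coset_def)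

lemma uea_add:
  assumes "p \<in> carrier (tensor_algebra B)" "q \<in> carrier (tensor_algebra B)"
  shows "cls p \<oplus>\<^bsub>uea br B\<^esub> cls q = cls (p + q)"
  using abelian_subgroup.a_rcos_sum[OF abelian_subgroupI3[OF ideal.axioms(1)[OF ideal_J] ring.is_abelian_group[OF ring_tensor_algebra]] assms] by (simp add: uea_def FactRing_def uea_class_def)

lemma uea_mult:
  assumes "p \<in> carrier (tensor_algebra B)" "q \<in> carrier (tensor_algebra B)"
  shows "cls p \<otimes>\<^bsub>uea br B\<^esub> cls q = cls (p * q)"
  using ideal.rcoset_mult_add[OF ideal_J assms] by (simp add: uea_def FactRing_def uea_class_def)

end

interpretation g: closed_bracket basis_bracket UNIV
  by standard (simp add: span_of_def)

lemma n_plus_closed: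
  assumes "x \<in> n_plus" "y \<in> n_plus"
  shows "ie_bracket x y \<in> n_plus"
proof -
  have 1: "Poly_Mapping.keys (basis_bracket (Dplus s) (Dplus t)) \<subseteq> range Dplus" for s t
    unfolding basis_bracket.simps Sum_any.expand_set
    by (rule keys_sum_subset) (auto split: if_splits)
  have 2: "Poly_Mapping.keys (vscale c z) \<subseteq> Poly_Mapping.keys z" for c and z :: ie_alg
    by (auto simp: in_keys_iff lookup_vscale)
  have 3: "Poly_Mapping.keys (vscale c (basis_bracket a b)) \<subseteq> range Dplus"
    if "a \<in> range Dplus" "b \<in> range Dplus" for a b c
    using subset_trans[OF 2 1] that by blast
  have xy: "Poly_Mapping.keys x \<subseteq> range Dplus" "Poly_Mapping.keys y \<subseteq> range Dplus"
    using assms by (auto simp: n_plus_def span_of_def)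
  have "Poly_Mapping.keys (ie_bracket x y) \<subseteq> range Dplus"
    unfolding bilinear_ext_def
    by (rule keys_sum_subset, rule keys_sum_subset, rule 3) (use xy in blast)+
  then show ?thesis
    by (simp add: n_plus_def span_of_def)
qed

interpretation n: closed_bracket basis_bracket "range Dplus"
  by standard (fact n_plus_closed[unfolded n_plus_def])

lemma the_elem_image_const: "a \<in> A \<Longrightarrow> (\<And>x. x \<in> A \<Longrightarrow> f x = c) \<Longrightarrow> the_elem (f ` A) = c"
  by (metis the_elem_image_unique empty_iff)

text \<open>The part of \<open>g.J\<close> inside the smaller tensor algebra is an ideal there that
  contains its relations. Hence \<open>uea_incl\<close> is independent of representatives.\<close>

lemma n_ideal_subset: "n.J \<subseteq> g.J"
proof -
  have "n.J \<subseteq> g.J \<inter> carrier (tensor_algebra (range Dplus))"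
  proof (rule uea_ideal_minimal)
    show "ideal (g.J \<inter> carrier (tensor_algebra (range Dplus))) (tensor_algebra (range Dplus))"
      by (rule ideal_tensor_algebra)
        (auto simp: g.J_zero g.J_add g.J_uminus g.J_left g.J_right tensor_closed)
    have "uea_relations basis_bracket (range Dplus) \<subseteq> uea_relations basis_bracket UNIV"
      by (auto simp: uea_relations_def span_of_def)
    then show "uea_relations basis_bracket (range Dplus) \<subseteq> g.J \<inter> carrier (tensor_algebra (range Dplus))"
      using relations_carrier[OF n.closed] uea_ideal_ideal(2)[OF g.closed] by blast
  qed
  then show ?thesis by blast
qed

lemma uea_incl_class: "uea_incl basis_bracket (n.cls p) = g.cls p"
proof -
  have "g.cls q = g.cls p" if "q \<in> n.cls p" for q
    using that n_ideal_subset by (auto simp: uea_class_eq_set[of _ "range Dplus"] g.cls_eq_iff)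
  moreover have "0 + p \<in> n.cls p" unfolding uea_class_eq_set using n.J_zero by blast
  ultimately show ?thesis
    unfolding uea_incl_def by (rule the_elem_image_const[rotated])
qed

section \<open>Characters\<close>

definition word_value :: "(('b \<Rightarrow>\<^sub>0 complex) \<Rightarrow> complex) \<Rightarrow> 'b fword \<Rightarrow> complex" where
  "word_value \<eta> w = prod_list (map (\<lambda>b. \<eta> (bvec b)) (letters w))"

lemma word_character_conv: "word_character \<eta> = lin_ext (*) (word_value \<eta>)"
  by (simp add: word_character_def lin_ext_def fun_eq_iff word_value_def)

lemmas word_character_simps =
  lin_ext_add[OF scalar_action_times, of "word_value \<eta>" for \<eta>, folded word_character_conv]
  lin_ext_diff[OF scalar_action_times, of "word_value \<eta>" for \<eta>, folded word_character_conv]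
  lin_ext_minus[OF scalar_action_times, of "word_value \<eta>" for \<eta>, folded word_character_conv]
  lin_ext_zero[OF scalar_action_times, of "word_value \<eta>" for \<eta>, folded word_character_conv]
  lin_ext_single[OF scalar_action_times, of "word_value \<eta>" for \<eta>, folded word_character_conv]
  lin_ext_sum[OF scalar_action_times, of "word_value \<eta>" for \<eta>, folded word_character_conv]

lemma word_character_mult: "word_character \<eta> (p * q) = word_character \<eta> p * word_character \<eta> q"
proof (induction p rule: poly_induct)
  case (single k c)
  show ?case
    by (induction q rule: poly_induct)
      (simp_all add: word_character_simps distrib_left mult_single word_value_def)
qed (simp_all add: word_character_simps distrib_right)

context
  fixes \<eta> :: "ie_alg \<Rightarrow> complex"
  assumes hom: "n_plus_hom \<eta>"
begin

lemma eta_zero: "\<eta> 0 = 0"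
proof -
  have "0 \<in> n_plus" by (simp add: n_plus_def span_of_def)
  then have "\<eta> (vscale 0 0) = 0 * \<eta> 0"
    using hom unfolding n_plus_hom_def by blast
  then show ?thesis by (simp add: vscale_simps)
qed

lemma eta_expand:
  assumes "x \<in> n_plus"
  shows "\<eta> x = (\<Sum>b\<in>Poly_Mapping.keys x. Poly_Mapping.lookup x b * \<eta> (bvec b))"
proof -
  have "\<eta> (\<Sum>b\<in>S. Poly_Mapping.single b (Poly_Mapping.lookup x b)) = (\<Sum>b\<in>S. Poly_Mapping.lookup x b * \<eta> (bvec b)) \<and>
     (\<Sum>b\<in>S. Poly_Mapping.single b (Poly_Mapping.lookup x b)) \<in> n_plus"
    if "finite S" "S \<subseteq> range Dplus" for S
    using that
  proof (induction S rule: finite_induct)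
    case empty
    then show ?case by (simp add: eta_zero n_plus_def span_of_def)
  next
    case (insert b S)
    have b: "bvec b \<in> n_plus" "Poly_Mapping.single b (Poly_Mapping.lookup x b) \<in> n_plus"
      using insert.prems by (auto simp: n_plus_def span_of_def)
    have "\<eta> (Poly_Mapping.single b (Poly_Mapping.lookup x b)) = Poly_Mapping.lookup x b * \<eta> (bvec b)"
      unfolding single_conv_vscale[of b "Poly_Mapping.lookup x b"] using hom b unfolding n_plus_hom_def by blast
    moreover have "y + z \<in> n_plus" if "y \<in> n_plus" "z \<in> n_plus" for y z
      using that keys_add[of y z] by (auto simp: n_plus_def span_of_def)
    moreover have "\<eta> (y + z) = \<eta> y + \<eta> z" if "y \<in> n_plus" "z \<in> n_plus" for y z
      using that hom unfolding n_plus_hom_def by blast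
    ultimately show ?case
      using insert b by simp
  qed
  from this[of "Poly_Mapping.keys x"] show ?thesis
    using assms by (simp add: n_plus_def span_of_def flip: poly_expand)
qed

lemma word_character_degree_one: "x \<in> n_plus \<Longrightarrow> word_character \<eta> (degree_one x) = \<eta> x"
  by (subst eta_expand) (simp_all add: degree_one_def word_character_simps word_value_def)

text \<open>The character is multiplicative, and on a relation it reduces to minus \<eta> of a
  bracket, which is 0.\<close>

lemma word_character_n_ideal: "p \<in> n.J \<Longrightarrow> word_character \<eta> p = 0"
proof -
  have "n.J \<subseteq> {p \<in> carrier (tensor_algebra (range Dplus)). word_character \<eta> p = 0}"
  proof (rule uea_ideal_minimal)
    show "ideal {p \<in> carrier (tensor_algebra (range Dplus)). word_character \<eta> p = 0} (tensor_algebra (range Dplus))"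
      by (rule ideal_tensor_algebra) (auto simp: word_character_simps word_character_mult tensor_closed)
    show "uea_relations basis_bracket (range Dplus) \<subseteq>
        {p \<in> carrier (tensor_algebra (range Dplus)). word_character \<eta> p = 0}"
    proof
      fix p assume p: "p \<in> uea_relations basis_bracket (range Dplus)"
      then obtain x y where xy: "x \<in> n_plus" "y \<in> n_plus"
        "p = degree_one x * degree_one y - degree_one y * degree_one x - degree_one (ie_bracket x y)"
        by (auto simp: uea_relations_def n_plus_def)
      have "\<eta> (ie_bracket x y) = 0"
        using hom xy unfolding n_plus_hom_def by blast
      then have "word_character \<eta> p = 0"
        using xy n_plus_closed by (simp add: word_character_simps word_character_mult word_character_degree_one)
      then show "p \<in> {p \<in> carrier (tensor_algebra (range Dplus)). word_character \<eta> p = 0}"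
        using p relations_carrier[OF n.closed] by auto
    qed
  qed
  then show "p \<in> n.J \<Longrightarrow> word_character \<eta> p = 0" by blast
qed

lemma uea_character_class: "uea_character \<eta> (n.cls p) = word_character \<eta> p"
proof -
  have "word_character \<eta> q = word_character \<eta> p" if "q \<in> n.cls p" for q
  proof -
    obtain j where "q = j + p" "j \<in> n.J"
      using \<open>q \<in> n.cls p\<close> by (auto simp: uea_class_eq_set)
    then show ?thesis
      by (simp add: word_character_simps(1) word_character_n_ideal)
  qed
  moreover have "0 + p \<in> n.cls p" unfolding uea_class_eq_set using n.J_zero by blast
  ultimately show ?thesis
    unfolding uea_character_def by (rule the_elem_image_const[rotated])
qed

end

section \<open>The standard Whittaker module\<close>

lemma cosets_free_Abelian_group:
  "H #>\<^bsub>free_Abelian_group S\<^esub> f = {k + f | k. k \<in> H}"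
  by (auto simp: r_coset_def)

context
  fixes \<eta> :: "ie_alg \<Rightarrow> complex"
  assumes hom: "n_plus_hom \<eta>"
begin

abbreviation "tpairs \<equiv> carrier U_g \<times> (UNIV :: complex set)"
abbreviation "tfree \<equiv> free_Abelian_group tpairs"
abbreviation "TR \<equiv> tensor_relations U_n_plus U_g right_mult complex_ring (eta_mult \<eta>)"
abbreviation "TK \<equiv> tensor_kernel U_n_plus U_g right_mult complex_ring (eta_mult \<eta>)"
abbreviation "chi \<equiv> word_character \<eta>"

lemma TK_eq: "TK = generate tfree TR"
  by (simp add: tensor_kernel_def complex_ring_def)

lemma U_g_elem: "m \<in> carrier U_g \<longleftrightarrow> (\<exists>p. m = g.cls p)"
  by (auto simp: g.carrier_uea)

lemma U_n_elem: "a \<in> carrier U_n_plus \<longleftrightarrow> (\<exists>q\<in>carrier (tensor_algebra (range Dplus)). a = n.cls q)"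
  by (auto simp: n.carrier_uea)

lemma right_mult_cls: "right_mult (g.cls p) (n.cls q) = g.cls (p * q)"
  by (simp add: right_mult_def uea_incl_class g.uea_mult)

lemma eta_mult_cls: "eta_mult \<eta> (n.cls q) z = chi q * z"
  by (simp add: eta_mult_def uea_character_class[OF hom])

lemma TR_iff: "f \<in> TR \<longleftrightarrow>
    (\<exists>p p' z. f = frag_of (g.cls (p + p'), z) - frag_of (g.cls p, z) - frag_of (g.cls p', z)) \<or>
    (\<exists>p z z'. f = frag_of (g.cls p, z + z') - frag_of (g.cls p, z) - frag_of (g.cls p, z')) \<or>
    (\<exists>p q z. q \<in> carrier (tensor_algebra (range Dplus)) \<and> f = frag_of (g.cls (p * q), z) - frag_of (g.cls p, chi q * z))"
    (is "_ \<longleftrightarrow> ?A f \<or> ?B f \<or> ?C f")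
proof -
  note cr [simp] = complex_ring_def
  have "(\<exists>m m' n. f = frag_of (m \<oplus>\<^bsub>U_g\<^esub> m', n) - frag_of (m, n) - frag_of (m', n) \<and>
      m \<in> carrier U_g \<and> m' \<in> carrier U_g \<and> n \<in> carrier complex_ring) \<longleftrightarrow> ?A f"
  proof
    assume "\<exists>m m' n. f = frag_of (m \<oplus>\<^bsub>U_g\<^esub> m', n) - frag_of (m, n) - frag_of (m', n) \<and>
      m \<in> carrier U_g \<and> m' \<in> carrier U_g \<and> n \<in> carrier complex_ring"
    then obtain p p' n where "f = frag_of (g.cls p \<oplus>\<^bsub>U_g\<^esub> g.cls p', n) - frag_of (g.cls p, n) - frag_of (g.cls p', n)"
      unfolding U_g_elem by blast
    then show "?A f" using g.uea_add[of p p'] by auto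
  next
    assume "?A f"
    then obtain p p' z where "f = frag_of (g.cls p \<oplus>\<^bsub>U_g\<^esub> g.cls p', z) - frag_of (g.cls p, z) - frag_of (g.cls p', z)"
      using g.uea_add by auto
    moreover have "g.cls p \<in> carrier U_g" "g.cls p' \<in> carrier U_g" "z \<in> carrier complex_ring"
      using U_g_elem by auto
    ultimately show "\<exists>m m' n. f = frag_of (m \<oplus>\<^bsub>U_g\<^esub> m', n) - frag_of (m, n) - frag_of (m', n) \<and>
      m \<in> carrier U_g \<and> m' \<in> carrier U_g \<and> n \<in> carrier complex_ring" by blast
  qed
  moreover have "(\<exists>m n n'. f = frag_of (m, n \<oplus>\<^bsub>complex_ring\<^esub> n') - frag_of (m, n) - frag_of (m, n') \<and>
      m \<in> carrier U_g \<and> n \<in> carrier complex_ring \<and> n' \<in> carrier complex_ring) \<longleftrightarrow> ?B f"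
    by (simp add: U_g_elem) blast
  moreover have "(\<exists>m a n. f = frag_of (right_mult m a, n) - frag_of (m, eta_mult \<eta> a n) \<and>
      m \<in> carrier U_g \<and> a \<in> carrier U_n_plus \<and> n \<in> carrier complex_ring) \<longleftrightarrow> ?C f"
  proof
    assume "\<exists>m a n. f = frag_of (right_mult m a, n) - frag_of (m, eta_mult \<eta> a n) \<and>
      m \<in> carrier U_g \<and> a \<in> carrier U_n_plus \<and> n \<in> carrier complex_ring"
    then obtain p q n where "q \<in> carrier (tensor_algebra (range Dplus))"
      "f = frag_of (right_mult (g.cls p) (n.cls q), n) - frag_of (g.cls p, eta_mult \<eta> (n.cls q) n)"
      unfolding U_g_elem U_n_elem by blast
    then show "?C f" unfolding right_mult_cls eta_mult_cls by blast
  next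
    assume "?C f"
    then obtain p q n where q: "q \<in> carrier (tensor_algebra (range Dplus))"
      "f = frag_of (right_mult (g.cls p) (n.cls q), n) - frag_of (g.cls p, eta_mult \<eta> (n.cls q) n)"
      unfolding right_mult_cls eta_mult_cls by blast
    moreover have "g.cls p \<in> carrier U_g" "n.cls q \<in> carrier U_n_plus" "n \<in> carrier complex_ring"
      using U_g_elem U_n_elem q by auto
    ultimately show "\<exists>m a n. f = frag_of (right_mult m a, n) - frag_of (m, eta_mult \<eta> a n) \<and>
      m \<in> carrier U_g \<and> a \<in> carrier U_n_plus \<and> n \<in> carrier complex_ring" by blast
  qed
  ultimately show ?thesis
    unfolding tensor_relations_def Un_iff mem_Collect_eq by blast
qed

lemma TR_sub: "TR \<subseteq> carrier tfree"
proof
  fix f assume "f \<in> TR"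
  then have "Poly_Mapping.keys f \<subseteq> tpairs"
    unfolding TR_iff
  proof (elim disjE exE conjE)
    fix p p' z assume f: "f = frag_of (g.cls (p + p'), z) - frag_of (g.cls p, z) - frag_of (g.cls p', z)"
    show ?thesis unfolding f
      by (intro order.trans[OF keys_diff] Un_least) (auto simp: U_g_elem)
  next
    fix p z z' assume f: "f = frag_of (g.cls p, z + z') - frag_of (g.cls p, z) - frag_of (g.cls p, z')"
    show ?thesis unfolding f
      by (intro order.trans[OF keys_diff] Un_least) (auto simp: U_g_elem)
  next
    fix p q z assume f: "f = frag_of (g.cls (p * q), z) - frag_of (g.cls p, chi q * z)"
    show ?thesis unfolding f
      by (intro order.trans[OF keys_diff] Un_least) (auto simp: U_g_elem)
  qed
  then show "f \<in> carrier tfree" by simp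
qed

lemma TK_carrier: "f \<in> TK \<Longrightarrow> f \<in> carrier tfree"
  unfolding TK_eq using group.generate_in_carrier[OF group_free_Abelian_group TR_sub] .

lemma inv_F: "f \<in> carrier tfree \<Longrightarrow> inv\<^bsub>tfree\<^esub> f = - f"
  by (intro inv_free_Abelian_group) simp

lemma TK_zero: "0 \<in> TK"
  unfolding TK_eq using generate.one[of tfree TR] by simp

lemma TK_add: "f \<in> TK \<Longrightarrow> g \<in> TK \<Longrightarrow> f + g \<in> TK"
  unfolding TK_eq using generate.eng[of f tfree TR g] by simp

lemma TK_uminus: "f \<in> TK \<Longrightarrow> - f \<in> TK"
  using group.generate_m_inv_closed[OF group_free_Abelian_group TR_sub, of f] inv_F[OF TK_carrier, of f]
  by (simp add: TK_eq)

lemma TK_diff: "f \<in> TK \<Longrightarrow> g \<in> TK \<Longrightarrow> f - g \<in> TK"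
  using TK_add[OF _ TK_uminus] by fastforce

lemma TK_incl: "f \<in> TR \<Longrightarrow> f \<in> TK"
  unfolding TK_eq by (rule generate.incl)

lemma TK_induct [consumes 1, case_names zero incl add uminus]:
  assumes "f \<in> TK" "P 0" "\<And>f. f \<in> TR \<Longrightarrow> P f" "\<And>f g. P f \<Longrightarrow> P g \<Longrightarrow> P (f + g)" "\<And>f. P f \<Longrightarrow> P (- f)"
  shows "P f"
  using assms(1) unfolding TK_eq
proof (induction rule: generate.induct)
  case (inv h)
  then show ?case using assms(3,5) inv_F TR_sub by auto
qed (use assms in auto)

definition tcls :: "(ie_uea \<times> complex \<Rightarrow>\<^sub>0 int) \<Rightarrow> (ie_uea \<times> complex \<Rightarrow>\<^sub>0 int) set" where
  "tcls f = TK #>\<^bsub>tfree\<^esub> f"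

lemma tcls_eq_set: "tcls f = {k + f | k. k \<in> TK}"
  unfolding tcls_def by (rule cosets_free_Abelian_group)

lemma tcls_self: "f \<in> tcls f"
  unfolding tcls_eq_set using TK_zero by force

lemma tcls_eq_iff: "tcls f = tcls g \<longleftrightarrow> f - g \<in> TK"
proof
  assume "tcls f = tcls g"
  then have "f \<in> tcls g" using tcls_self by blast
  then show "f - g \<in> TK" by (auto simp: tcls_eq_set)
next
  assume fg: "f - g \<in> TK"
  have sub: "tcls f \<subseteq> tcls g" if "f - g \<in> TK" for f g
  proof
    fix x assume "x \<in> tcls f"
    then obtain k where "k \<in> TK" "x = (k + (f - g)) + g" by (auto simp: tcls_eq_set)
    then show "x \<in> tcls g" using TK_add that unfolding tcls_eq_set by blast
  qed
  have "g - f \<in> TK" using TK_uminus[OF fg] by simp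
  then show "tcls f = tcls g" using sub fg by blast
qed

lemma tensor_group:
  "carrier (whittaker_tensor \<eta>) = tcls ` carrier tfree"
  "\<one>\<^bsub>whittaker_tensor \<eta>\<^esub> = tcls 0"
  "tcls f \<otimes>\<^bsub>whittaker_tensor \<eta>\<^esub> tcls g = tcls (f + g)"
proof -
  have W: "whittaker_tensor \<eta> = tfree Mod TK"
    by (simp add: whittaker_tensor_def tensor_product_def complex_ring_def)
  show "carrier (whittaker_tensor \<eta>) = tcls ` carrier tfree"
    by (auto simp: W FactGroup_def RCOSETS_def tcls_def simp del: carrier_free_Abelian_group_iff)
  show "\<one>\<^bsub>whittaker_tensor \<eta>\<^esub> = tcls 0"
    by (simp add: W FactGroup_def tcls_eq_set)
  have "tcls f <#>\<^bsub>tfree\<^esub> tcls g = tcls (f + g)"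
  proof
    show "tcls f <#>\<^bsub>tfree\<^esub> tcls g \<subseteq> tcls (f + g)"
    proof
      fix x assume "x \<in> tcls f <#>\<^bsub>tfree\<^esub> tcls g"
      then obtain k l where "k \<in> TK" "l \<in> TK" "x = (k + f) + (l + g)"
        by (auto simp: set_mult_def tcls_eq_set)
      then have "x = (k + l) + (f + g)" "k + l \<in> TK" by (simp_all add: TK_add)
      then show "x \<in> tcls (f + g)" unfolding tcls_eq_set by blast
    qed
    show "tcls (f + g) \<subseteq> tcls f <#>\<^bsub>tfree\<^esub> tcls g"
    proof
      fix x assume "x \<in> tcls (f + g)"
      then obtain k where "k \<in> TK" "x = (k + f) + g" by (auto simp: tcls_eq_set add.assoc)
      then have "k + f \<in> tcls f" "x = (k + f) \<otimes>\<^bsub>tfree\<^esub> g" by (auto simp: tcls_eq_set)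
      then show "x \<in> tcls f <#>\<^bsub>tfree\<^esub> tcls g" unfolding set_mult_def using tcls_self by blast
    qed
  qed
  then show "tcls f \<otimes>\<^bsub>whittaker_tensor \<eta>\<^esub> tcls g = tcls (f + g)"
    by (simp add: W FactGroup_def)
qed

text \<open>The result of applying \<open>p\<close> to the canonical generator. Every vector has
  this form, so the module is handled from here on as a quotient of the tensor algebra.\<close>

definition \<Psi> :: "(ie_basis fword \<Rightarrow>\<^sub>0 complex) \<Rightarrow> (ie_uea \<times> complex \<Rightarrow>\<^sub>0 int) set" where
  "\<Psi> p = tcls (frag_of (g.cls p, 1))"

lemma frag_of_carrier: "frag_of (g.cls p, z) \<in> carrier tfree"
  by (auto simp: U_g_elem)

lemma TK_relations:
  "frag_of (g.cls (p + p'), z) - frag_of (g.cls p, z) - frag_of (g.cls p', z) \<in> TK"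
  "frag_of (g.cls p, z + z') - frag_of (g.cls p, z) - frag_of (g.cls p, z') \<in> TK"
  "q \<in> carrier (tensor_algebra (range Dplus)) \<Longrightarrow> frag_of (g.cls (p * q), z) - frag_of (g.cls p, chi q * z) \<in> TK"
  by (rule TK_incl, unfold TR_iff, blast)+

lemma \<Psi>_add: "\<Psi> (p + q) = \<Psi> p \<otimes>\<^bsub>whittaker_tensor \<eta>\<^esub> \<Psi> q"
  unfolding \<Psi>_def tensor_group tcls_eq_iff using TK_relations(1)[of p q 1] by (simp add: diff_diff_add)

lemma \<Psi>_zero: "\<Psi> 0 = tcls 0"
  unfolding \<Psi>_def tcls_eq_iff using TK_uminus[OF TK_relations(1)[of 0 0 1]] by simp

text \<open>Moved across the tensor sign, \<open>q\<close> and the constant \<open>chi q\<close>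
  have the same effect on the second factor.\<close>

lemma \<Psi>_right: "q \<in> carrier (tensor_algebra (range Dplus)) \<Longrightarrow> \<Psi> (p * q) = \<Psi> (p * Poly_Mapping.single 0 (chi q))"
proof -
  assume q: "q \<in> carrier (tensor_algebra (range Dplus))"
  have "chi (Poly_Mapping.single 0 c) = c" for c
    by (simp add: word_character_simps word_value_def)
  then have "frag_of (g.cls (p * Poly_Mapping.single 0 (chi q)), 1) - frag_of (g.cls p, chi q * 1) \<in> TK"
    using TK_relations(3)[of "Poly_Mapping.single 0 (chi q)" p 1] by simp
  then show ?thesis
    unfolding \<Psi>_def tcls_eq_iff using TK_diff[OF TK_relations(3)[OF q, of p 1]] by fastforce
qed

lemma \<Psi>_surj:
  assumes "x \<in> carrier (whittaker_tensor \<eta>)"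
  obtains p where "x = \<Psi> p"
proof -
  obtain f where f: "x = tcls f" "Poly_Mapping.keys f \<subseteq> tpairs"
    using assms by (auto simp: tensor_group)
  have "\<exists>p. f - frag_of (g.cls p, 1) \<in> TK"
    using f(2)
  proof (induction f rule: frag_induction)
    case zero
    then show ?case
      using \<Psi>_zero[symmetric] unfolding \<Psi>_def tcls_eq_iff by blast
  next
    case (one x)
    then obtain p z where x: "x = (g.cls p, z)" by (auto simp: U_g_elem)
    \<comment> \<open>The scalar \<open>z\<close> is itself an element of the smaller enveloping
      algebra and can be moved into the first factor.\<close>
    have "frag_of (g.cls (p * Poly_Mapping.single 0 z), 1) - frag_of (g.cls p, z) \<in> TK"
      using TK_relations(3)[of "Poly_Mapping.single 0 z" p 1] by (simp add: word_character_simps word_value_def)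
    from TK_uminus[OF this] show ?case unfolding x by auto
  next
    case (diff a b)
    then obtain p q where pq: "a - frag_of (g.cls p, 1) \<in> TK" "b - frag_of (g.cls q, 1) \<in> TK" by blast
    have "frag_of (g.cls (p - q + q), 1) - frag_of (g.cls (p - q), 1) - frag_of (g.cls q, 1) \<in> TK"
      by (rule TK_relations(1))
    then have "frag_of (g.cls p, 1) - frag_of (g.cls (p - q), 1) - frag_of (g.cls q, 1) \<in> TK" by simp
    from TK_add[OF TK_diff[OF pq] this] have "a - b - frag_of (g.cls (p - q), 1) \<in> TK"
      by (simp add: algebra_simps)
    then show ?case by blast
  qed
  then show ?thesis using that f(1) unfolding \<Psi>_def by (metis tcls_eq_iff)
qed

lemma \<Psi>_carrier: "\<Psi> p \<in> carrier (whittaker_tensor \<eta>)"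
  unfolding \<Psi>_def tensor_group using frag_of_carrier by blast

lemma \<Psi>_ideal: "p - q \<in> g.J \<Longrightarrow> \<Psi> p = \<Psi> q"
  unfolding \<Psi>_def by (simp flip: g.cls_eq_iff)

text \<open>Left multiplication commutes with the right action, so it maps relations to relations,
  and the coset extracted by \<open>the_elem\<close> is unique.\<close>

lemma U_act_\<Psi>: "U_act \<eta> (g.cls u) (\<Psi> p) = \<Psi> (u * p)"
proof -
  define T where "T = frag_extend (\<lambda>(m, n). frag_of (g.cls u \<otimes>\<^bsub>U_g\<^esub> m, n :: complex))"
  have T_of: "T (frag_of (g.cls q, z)) = frag_of (g.cls (u * q), z)" for q z
    by (simp add: T_def frag_extend_of g.uea_mult)
  have T_add: "T (x + y) = T x + T y" and T_diff: "T (x - y) = T x - T y" and T_minus: "T (- x) = - T x" for x y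
    by (simp_all add: T_def frag_extend_add frag_extend_diff frag_extend_minus)
  have TTK: "T k \<in> TK" if "k \<in> TK" for k
    using that
  proof (induction rule: TK_induct)
    case zero
    then show ?case by (simp add: T_def TK_zero)
  next
    case (incl f)
    then show ?case
      unfolding TR_iff
    proof (elim disjE exE conjE)
      fix p p' z assume "f = frag_of (g.cls (p + p'), z) - frag_of (g.cls p, z) - frag_of (g.cls p', z)"
      then show ?thesis
        using TK_relations(1)[of "u * p" "u * p'" z] by (simp add: T_diff T_of distrib_left)
    next
      fix p z z' assume "f = frag_of (g.cls p, z + z') - frag_of (g.cls p, z) - frag_of (g.cls p, z')"
      then show ?thesis
        using TK_relations(2)[of "u * p" z z'] by (simp add: T_diff T_of)
    next
      fix p q z assume "q \<in> carrier (tensor_algebra (range Dplus))" "f = frag_of (g.cls (p * q), z) - frag_of (g.cls p, chi q * z)"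
      then show ?thesis
        using TK_relations(3)[of q "u * p" z] by (simp add: T_diff T_of mult.assoc)
    qed
  qed (simp_all add: T_add T_minus TK_add TK_uminus)
  have "tcls (T f) = \<Psi> (u * p)" if "f \<in> \<Psi> p" for f
  proof -
    obtain k where k: "k \<in> TK" "f = k + frag_of (g.cls p, 1)"
      using \<open>f \<in> \<Psi> p\<close> by (auto simp: \<Psi>_def tcls_eq_set)
    then have "T f = T k + frag_of (g.cls (u * p), 1)" by (simp add: T_add T_of)
    then show ?thesis
      using TTK[OF k(1)] by (simp add: \<Psi>_def tcls_eq_iff)
  qed
  moreover have "frag_of (g.cls p, 1) \<in> \<Psi> p" unfolding \<Psi>_def by (rule tcls_self)
  ultimately have "the_elem ((\<lambda>f. tcls (T f)) ` \<Psi> p) = \<Psi> (u * p)"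
    by (rule the_elem_image_const[rotated])
  then show ?thesis
    by (simp add: U_act_def tensor_map_left_def tcls_def T_def complex_ring_def)
qed

abbreviation (input) "wmod \<equiv> whittaker_module \<eta>"
abbreviation "cst c \<equiv> (Poly_Mapping.single 0 c :: ie_basis fword \<Rightarrow>\<^sub>0 complex)"

lemma V_ops:
  "x \<in> carrier wmod \<longleftrightarrow> (\<exists>p. x = \<Psi> p)"
  "\<zero>\<^bsub>wmod\<^esub> = \<Psi> 0" "\<Psi> p \<oplus>\<^bsub>wmod\<^esub> \<Psi> q = \<Psi> (p + q)" "c \<odot>\<^bsub>wmod\<^esub> \<Psi> p = \<Psi> (cst c * p)"
  "act wmod a (\<Psi> p) = \<Psi> (degree_one a * p)"
proof -
  show "x \<in> carrier wmod \<longleftrightarrow> (\<exists>p. x = \<Psi> p)" for x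
    using \<Psi>_surj[of x] \<Psi>_carrier by (auto simp: whittaker_module_def)
qed (simp_all add: whittaker_module_def U_act_\<Psi> \<Psi>_zero tensor_group \<Psi>_add[symmetric])

lemma cring_complex: "cring complex_ring"
proof (rule cringI)
  show "abelian_group complex_ring"
  proof (rule abelian_groupI)
    fix x assume "x \<in> carrier complex_ring"
    show "\<exists>y\<in>carrier complex_ring. y \<oplus>\<^bsub>complex_ring\<^esub> x = \<zero>\<^bsub>complex_ring\<^esub>"
      by (intro bexI[of _ "- x"]) (auto simp: complex_ring_def)
  qed (auto simp: complex_ring_def)
  show "comm_monoid complex_ring"
    by (rule comm_monoidI) (auto simp: complex_ring_def)
qed (auto simp: complex_ring_def algebra_simps)

lemma abelian_group_V: "abelian_group wmod"
proof (rule abelian_groupI)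
  fix x assume "x \<in> carrier wmod"
  then obtain p where "x = \<Psi> p" by (auto simp: V_ops)
  then have "\<Psi> (- p) \<oplus>\<^bsub>wmod\<^esub> x = \<zero>\<^bsub>wmod\<^esub>" by (simp add: V_ops)
  then show "\<exists>y\<in>carrier wmod. y \<oplus>\<^bsub>wmod\<^esub> x = \<zero>\<^bsub>wmod\<^esub>" using V_ops(1) by blast
qed (auto simp: V_ops(1) V_ops(2-) algebra_simps)

lemma minus_V: "\<Psi> p \<ominus>\<^bsub>wmod\<^esub> \<Psi> q = \<Psi> (p - q)"
proof -
  interpret abelian_group wmod by (rule abelian_group_V)
  have "\<ominus>\<^bsub>wmod\<^esub> \<Psi> q = \<Psi> (- q)"
    by (rule minus_equality) (auto simp: V_ops)
  then show ?thesis by (simp add: a_minus_def V_ops)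
qed

lemma is_lie_module_V: "is_lie_module basis_bracket wmod"
proof -
  have "Module.module complex_ring wmod"
  proof (rule moduleI[OF cring_complex abelian_group_V])
    fix a b x y assume xy: "x \<in> carrier wmod" "y \<in> carrier wmod"
    then obtain p q where pq: "x = \<Psi> p" "y = \<Psi> q" by (auto simp: V_ops)
    show "a \<odot>\<^bsub>wmod\<^esub> x \<in> carrier wmod" using pq by (auto simp: V_ops)
    show "(a \<oplus>\<^bsub>complex_ring\<^esub> b) \<odot>\<^bsub>wmod\<^esub> x = a \<odot>\<^bsub>wmod\<^esub> x \<oplus>\<^bsub>wmod\<^esub> b \<odot>\<^bsub>wmod\<^esub> x"
      by (simp add: pq V_ops complex_ring_def single_add distrib_right)
    show "a \<odot>\<^bsub>wmod\<^esub> (x \<oplus>\<^bsub>wmod\<^esub> y) = a \<odot>\<^bsub>wmod\<^esub> x \<oplus>\<^bsub>wmod\<^esub> a \<odot>\<^bsub>wmod\<^esub> y"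
      by (simp add: pq V_ops distrib_left)
    show "(a \<otimes>\<^bsub>complex_ring\<^esub> b) \<odot>\<^bsub>wmod\<^esub> x = a \<odot>\<^bsub>wmod\<^esub> (b \<odot>\<^bsub>wmod\<^esub> x)"
      by (simp add: pq V_ops complex_ring_def mult_single flip: mult.assoc)
    show "\<one>\<^bsub>complex_ring\<^esub> \<odot>\<^bsub>wmod\<^esub> x = x"
      by (simp add: pq V_ops complex_ring_def)
  qed
  moreover have "act wmod (ie_bracket x y) (\<Psi> p) = act wmod x (act wmod y (\<Psi> p)) \<ominus>\<^bsub>wmod\<^esub> act wmod y (act wmod x (\<Psi> p))" for x y p
  proof -
    have "degree_one x * degree_one y - degree_one y * degree_one x - degree_one (ie_bracket x y) \<in> g.J"
      by (rule g.J_relation) (simp_all add: span_of_def)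
    from g.J_uminus[OF g.J_right[OF this, of p]] show ?thesis
      unfolding V_ops minus_V by (intro \<Psi>_ideal) (simp add: algebra_simps)
  qed
  moreover have "degree_one x * (cst c * p) = cst c * (degree_one x * p)" for x c p
    by (metis single_zero_commute mult.assoc)
  moreover have "(\<forall>v\<in>carrier wmod. P v) \<longleftrightarrow> (\<forall>p. P (\<Psi> p))" for P
    by (metis V_ops(1))
  moreover have "\<Psi> p \<in> carrier wmod" for p using V_ops(1) by blast
  ultimately show ?thesis
    unfolding is_lie_module_def
    by (simp add: V_ops(2-) distrib_left distrib_right linear_mapD[OF linear_degree_one] vscale_conv_mult mult.assoc)
qed


text \<open>The antipode turns the left module of forests into a right module; \<open>\<Lambda>_op\<close> is the resulting
  right action of a word.\<close>

definition \<Lambda>_op :: "ie_basis fword \<Rightarrow> forest_alg \<Rightarrow> forest_alg" where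
  "\<Lambda>_op w h = fold (\<lambda>b h. - rho b h) (letters w) h"

definition alg_op :: "(ie_basis fword \<Rightarrow>\<^sub>0 complex) \<Rightarrow> forest_alg \<Rightarrow> forest_alg" where
  "alg_op p h = lin_ext vscale (\<lambda>w. \<Lambda>_op w h) p"

lemma linear_\<Lambda>_op: "linear_map (\<Lambda>_op w)"
proof -
  have "linear_map (\<lambda>h. fold (\<lambda>b h. - rho b h) bs h)" for bs
  proof (induction bs)
    case (Cons b bs)
    have "linear_map (\<lambda>h. - rho b h)"
      using linear_rho[of b] by (simp add: linear_map_def vscale_simps)
    from linear_map_comp[OF Cons this] show ?case by simp
  qed (simp add: linear_map_def)
  then show ?thesis by (simp add: \<Lambda>_op_def[abs_def])
qed

lemma linear_alg_op1: "linear_map (\<lambda>p. alg_op p h)"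
  unfolding alg_op_def by (rule linear_map_lin_ext)

lemma linear_alg_op2: "linear_map (alg_op p)"
  unfolding alg_op_def lin_ext_def by (intro linear_map_sum linear_map_vscale linear_\<Lambda>_op)

lemma alg_op_bvec: "alg_op (bvec w) h = \<Lambda>_op w h"
  by (simp add: alg_op_def lin_ext_bvec)

lemma linear_mult_left: "linear_map (\<lambda>p. p * q :: 'k::monoid_add \<Rightarrow>\<^sub>0 complex)"
  by (simp add: linear_map_def distrib_right vscale_mult_left)

text \<open>The fold applies the first letter first, so products act in reverse order.\<close>

lemma alg_op_mult: "alg_op (p * q) h = alg_op q (alg_op p h)"
proof (rule linear_map_eqI[of "\<lambda>p. alg_op (p * q) h" "\<lambda>p. alg_op q (alg_op p h)"])
  show "linear_map (\<lambda>p. alg_op (p * q) h)"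
    by (rule linear_map_comp[OF linear_alg_op1 linear_mult_left])
  show "linear_map (\<lambda>p. alg_op q (alg_op p h))"
    by (rule linear_map_comp[OF linear_alg_op2 linear_alg_op1])
  fix u
  show "alg_op (bvec u * q) h = alg_op q (alg_op (bvec u) h)"
  proof (rule linear_map_eqI[of "\<lambda>q. alg_op (bvec u * q) h" "\<lambda>q. alg_op q (alg_op (bvec u) h)"])
    show "linear_map (\<lambda>q. alg_op (bvec u * q) h)"
      by (rule linear_map_comp[OF linear_alg_op1 linear_map_mult])
    show "linear_map (\<lambda>q. alg_op q (alg_op (bvec u) h))"
      by (rule linear_alg_op1)
    fix v
    show "alg_op (bvec u * bvec v) h = alg_op (bvec v) (alg_op (bvec u) h)"
      unfolding bvec_add[symmetric] alg_op_bvec by (simp add: \<Lambda>_op_def)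
  qed
qed

lemma alg_op_degree_one: "alg_op (degree_one x) h = - lie_op x h"
proof (rule linear_map_eqI[of "\<lambda>x. alg_op (degree_one x) h" "\<lambda>x. - lie_op x h"])
  show "linear_map (\<lambda>x. alg_op (degree_one x) h)"
    by (rule linear_map_comp[OF linear_alg_op1 linear_degree_one])
  show "linear_map (\<lambda>x. - lie_op x h)"
    using linear_lie_op1[of h] by (simp add: linear_map_def vscale_simps)
  fix b
  show "alg_op (degree_one (bvec b)) h = - lie_op (bvec b) h"
    by (simp add: degree_one_bvec alg_op_bvec \<Lambda>_op_def lie_op_single vscale_simps)
qed

text \<open>The reversed order and the sign on each letter compensate: \<open>x y - y x\<close> acts
  as minus the commutator of \<open>lie_op x\<close> and \<open>lie_op y\<close>, and the bracket as
  minus \<open>lie_op\<close> of it.\<close>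

lemma alg_op_ideal: "p \<in> g.J \<Longrightarrow> alg_op p h = 0"
proof -
  have "g.J \<subseteq> {p. \<forall>h. alg_op p h = 0}"
  proof (rule uea_ideal_minimal)
    show "ideal {p. \<forall>h. alg_op p h = 0} (tensor_algebra UNIV)"
      by (rule ideal_tensor_algebra)
        (auto simp: alg_op_mult linear_mapD[OF linear_alg_op1] linear_mapD[OF linear_alg_op2])
    show "uea_relations basis_bracket UNIV \<subseteq> {p. \<forall>h. alg_op p h = 0}"
    proof
      fix p assume "p \<in> uea_relations basis_bracket UNIV"
      then obtain x y where "p = degree_one x * degree_one y - degree_one y * degree_one x - degree_one (ie_bracket x y)"
        by (auto simp: uea_relations_def)
      then have "alg_op p h = 0" for h
        by (simp add: linear_mapD[OF linear_alg_op1] alg_op_mult alg_op_degree_one lie_op_bracket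
            linear_mapD[OF linear_lie_op2])
      then show "p \<in> {p. \<forall>h. alg_op p h = 0}" by simp
    qed
  qed
  then show "p \<in> g.J \<Longrightarrow> alg_op p h = 0" by blast
qed

definition tchar :: "mtree \<Rightarrow> complex" where
  "tchar y = \<eta> (bvec (Dplus (tdecode y)))"

text \<open>The vanishing of \<eta> on \<open>[D_s\<^sup>+, D_t\<^sup>+]\<close>, read through
  \<beta>; it is the hypothesis under which \<open>psi\<close> was analysed.\<close>

lemma tchar_graft: "(\<Sum>r\<in>#graft s t. tchar r) = (\<Sum>r\<in>#graft t s. tchar r)"
proof -
  let ?s = "tdecode s" and ?t = "tdecode t" and ?X = "graft s t" and ?Y = "graft t s"
  let ?A = "set_mset ?X \<union> set_mset ?Y"
  let ?x = "basis_bracket (Dplus ?s) (Dplus ?t)"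
  have n: "bvec (Dplus r) \<in> n_plus" for r by (simp add: n_plus_def span_of_def)
  have br: "ie_bracket (bvec (Dplus ?s)) (bvec (Dplus ?t)) = ?x"
    by (simp add: bilinear_ext_def vscale_simps del: basis_bracket.simps)
  have "\<eta> ?x = 0"
    using hom n unfolding n_plus_hom_def br[symmetric] by blast
  have lift: "lin_ext (*) (\<lambda>b. \<eta> (bvec b)) ?x = \<eta> ?x"
    using eta_expand[OF hom, of ?x] n_plus_closed[OF n n, of ?s ?t] unfolding br lin_ext_def by simp
  note l = scalar_action_times
  have "?x = (\<Sum>y\<in>?A. vscale (of_nat (count ?X y) - of_nat (count ?Y y)) (bvec (Dplus (tdecode y))))"
    unfolding basis_bracket.simps by (subst Sum_any_trees[of ?A]) (auto simp: \<beta>_count not_in_iff)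
  then have "\<eta> ?x = (\<Sum>y\<in>?A. (of_nat (count ?X y) - of_nat (count ?Y y)) * tchar y)"
    unfolding lift[symmetric]
    by (simp only: lin_ext_sum[OF l] lin_ext_vscale[OF l] lin_ext_single[OF l] tchar_def mult_1)
  moreover have cnt: "(\<Sum>r\<in>#X. tchar r) = (\<Sum>y\<in>A. of_nat (count X y) * tchar y)"
    if "finite A" "set_mset X \<subseteq> A" for X A
    using that(2)
  proof (induction X)
    case (add x X)
    have "(\<Sum>y\<in>A. of_nat (count (add_mset x X) y) * tchar y) =
      (\<Sum>y\<in>A. (if y = x then tchar x else 0) + of_nat (count X y) * tchar y)"
      by (intro sum.cong) (auto simp: algebra_simps)
    then show ?case using add that(1) by (simp add: sum.distrib)
  qed simp
  ultimately have "(\<Sum>y\<in>?A. of_nat (count ?X y) * tchar y) = (\<Sum>y\<in>?A. of_nat (count ?Y y) * tchar y)"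
    using \<open>\<eta> ?x = 0\<close> by (simp add: left_diff_distrib sum_subtractf del: basis_bracket.simps)
  moreover have "(\<Sum>r\<in>#?X. tchar r) = (\<Sum>y\<in>?A. of_nat (count ?X y) * tchar y)"
    "(\<Sum>r\<in>#?Y. tchar r) = (\<Sum>y\<in>?A. of_nat (count ?Y y) * tchar y)"
    by (rule cnt; simp)+
  ultimately show ?thesis by (simp only:)
qed

text \<open>A matrix coefficient: the functional \<open>psi\<close> evaluated on the empty forest
  moved by \<open>p\<close>. It transforms by the character under right multiplication by the
  positive part, hence descends to the Whittaker module.\<close>

definition \<Lambda> :: "(ie_basis fword \<Rightarrow>\<^sub>0 complex) \<Rightarrow> complex" where
  "\<Lambda> p = psi_lin tchar (alg_op p 1)"

lemma \<Lambda>_add: "\<Lambda> (p + q) = \<Lambda> p + \<Lambda> q" and \<Lambda>_vscale: "\<Lambda> (vscale c p) = c * \<Lambda> p"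
  and \<Lambda>_diff: "\<Lambda> (p - q) = \<Lambda> p - \<Lambda> q" and \<Lambda>_zero: "\<Lambda> 0 = 0"
  by (simp_all add: \<Lambda>_def linear_mapD[OF linear_alg_op1] psi_lin_def[OF tchar_graft] lin_ext_add[OF scalar_action_times]
      lin_ext_vscale[OF scalar_action_times] lin_ext_diff[OF scalar_action_times] lin_ext_zero[OF scalar_action_times])

lemma \<Lambda>_ideal: "p \<in> g.J \<Longrightarrow> \<Lambda> p = 0"
  using \<Lambda>_zero by (simp add: \<Lambda>_def alg_op_ideal linear_mapD[OF linear_alg_op1])

lemma \<Lambda>_one: "\<Lambda> 1 = 1"
proof -
  have "alg_op (bvec 0) 1 = 1" unfolding alg_op_bvec by (simp add: \<Lambda>_op_def)
  then show ?thesis by (simp add: \<Lambda>_def psi_lin_one[OF tchar_graft])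
qed

text \<open>The antipode sign cancels the sign in \<open>psi_lin_create\<close>; for this reason
  \<open>psi\<close> was built with eigenvalue minus \<chi>.\<close>

lemma \<Lambda>_letter: "\<Lambda> (p * bvec (FWord [Dplus t])) = \<eta> (bvec (Dplus t)) * \<Lambda> p"
proof -
  have "alg_op (p * bvec (FWord [Dplus t])) 1 = - create (tcode t) (alg_op p 1)"
    by (simp add: alg_op_mult alg_op_bvec[of "FWord [Dplus t]"] \<Lambda>_op_def)
  then have "\<Lambda> (p * bvec (FWord [Dplus t])) = - psi_lin tchar (create (tcode t) (alg_op p 1))"
    by (simp add: \<Lambda>_def psi_lin_def[OF tchar_graft] lin_ext_minus[OF scalar_action_times])
  moreover have "tchar (tcode t) = \<eta> (bvec (Dplus t))" by (simp add: tchar_def)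
  ultimately show ?thesis
    by (simp add: psi_lin_create[OF tchar_graft] \<Lambda>_def)
qed

lemma \<Lambda>_right:
  assumes "q \<in> carrier (tensor_algebra (range Dplus))"
  shows "\<Lambda> (p * q) = chi q * \<Lambda> p"
proof -
  have word: "\<Lambda> (p * bvec w) = word_value \<eta> w * \<Lambda> p" if "set (letters w) \<subseteq> range Dplus" for p w
  proof -
    have "\<Lambda> (p * bvec (FWord bs)) = prod_list (map (\<lambda>b. \<eta> (bvec b)) bs) * \<Lambda> p" if "set bs \<subseteq> range Dplus" for bs
      using that
    proof (induction bs arbitrary: p rule: rev_induct)
      case Nil
      have "FWord [] = (0 :: ie_basis fword)" by (simp add: zero_fword_def)
      then show ?case by simp
    next
      case (snoc b bs)
      then obtain t where b: "b = Dplus t" by auto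
      have "FWord (bs @ [b]) = FWord bs + FWord [b]" by (simp add: plus_fword_def)
      then have "p * bvec (FWord (bs @ [b])) = p * bvec (FWord bs) * bvec (FWord [b])"
        by (simp add: mult.assoc mult_single)
      then show ?case using snoc by (simp add: b \<Lambda>_letter)
    qed
    from this[of "letters w"] that show ?thesis
      by (cases w) (simp add: word_value_def)
  qed
  have fin: "\<Lambda> (sum f A) = (\<Sum>i\<in>A. \<Lambda> (f i))" for f :: "'i \<Rightarrow> ie_basis fword \<Rightarrow>\<^sub>0 complex" and A
    by (induction A rule: infinite_finite_induct) (auto simp: \<Lambda>_zero \<Lambda>_add)
  have "\<Lambda> (p * q) = \<Lambda> (p * (\<Sum>w\<in>Poly_Mapping.keys q. Poly_Mapping.single w (Poly_Mapping.lookup q w)))"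
    using poly_expand[of q] by simp
  also have "\<dots> = (\<Sum>w\<in>Poly_Mapping.keys q. Poly_Mapping.lookup q w * \<Lambda> (p * bvec w))"
    unfolding sum_distrib_left fin
    by (intro sum.cong refl) (simp only: single_conv_vscale[of _ "Poly_Mapping.lookup _ _"] vscale_mult_right \<Lambda>_vscale)
  also have "\<dots> = (\<Sum>w\<in>Poly_Mapping.keys q. Poly_Mapping.lookup q w * (word_value \<eta> w * \<Lambda> p))"
    using assms by (intro sum.cong refl) (simp add: word tensor_carrier)
  finally show ?thesis
    by (simp add: word_character_conv lin_ext_def sum_distrib_right mult.assoc)
qed

text \<open>\<open>\<Lambda>\<close> induces an additive map on the free group that kills all tensor
  relations but takes different values on the generator and on 0.\<close>

lemma \<Psi>_one_nonzero: "\<Psi> 1 \<noteq> \<Psi> 0"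
proof
  assume eq: "\<Psi> 1 = \<Psi> 0"
  \<comment> \<open>The choice of representative is harmless, since \<open>\<Lambda>\<close>
    vanishes on the ideal.\<close>
  define L where "L m = \<Lambda> (SOME p. g.cls p = m)" for m
  have L: "L (g.cls p) = \<Lambda> p" for p
  proof -
    have "g.cls (SOME q. g.cls q = g.cls p) = g.cls p" by (rule someI) (rule refl)
    then have "\<Lambda> ((SOME q. g.cls q = g.cls p) - p) = 0"
      unfolding g.cls_eq_iff by (rule \<Lambda>_ideal)
    then show ?thesis by (simp add: L_def \<Lambda>_diff)
  qed
  define T where "T f = (\<Sum>x\<in>Poly_Mapping.keys f. of_int (Poly_Mapping.lookup f x) * (L (fst x) * snd x))"
    for f :: "ie_uea \<times> complex \<Rightarrow>\<^sub>0 int"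
  have T_add: "T (f + g) = T f + T g" for f g
    unfolding T_def by (rule setsum_keys_plus_distrib) (auto simp: distrib_right)
  have T_zero: "T 0 = 0" by (simp add: T_def)
  have T_minus: "T (- f) = - T f" for f
    using T_add[of f "- f"] T_zero by (simp add: eq_neg_iff_add_eq_0 add.commute)
  have T_diff: "T (f - g) = T f - T g" for f g
    using T_add[of f "- g"] T_minus[of g] by simp
  have T_of: "T (frag_of (g.cls p, z)) = \<Lambda> p * z" for p z
    by (simp add: T_def L)
  have "T f = 0" if "f \<in> TK" for f
    using that
  proof (induction rule: TK_induct)
    case (incl f)
    then show ?case
      unfolding TR_iff
      by (elim disjE exE conjE; simp only: T_diff T_of \<Lambda>_add \<Lambda>_right)
        (simp_all (no_asm) add: algebra_simps)
  qed (simp_all add: T_zero T_add T_minus)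
  moreover have "frag_of (g.cls 1, 1) - frag_of (g.cls 0, 1) \<in> TK"
    using eq by (simp add: \<Psi>_def tcls_eq_iff)
  ultimately have "T (frag_of (g.cls 1, 1) - frag_of (g.cls 0, 1)) = 0" by blast
  then show False by (simp add: T_diff T_of \<Lambda>_one \<Lambda>_zero)
qed

end

section \<open>Hanging a tree below a vertex of given depth\<close>

text \<open>In \<open>hang n r x z\<close> the tree \<open>z\<close> is \<open>r\<close> with
  \<open>x\<close> joined to a vertex of depth \<open>n\<close>; a derivation spells out the path
  from the root to that vertex.\<close>

inductive hang :: "nat \<Rightarrow> mtree \<Rightarrow> mtree \<Rightarrow> mtree \<Rightarrow> bool" where
  base: "hang 0 (Node G) x (Node (add_mset x G))"
| step: "hang n c x c' \<Longrightarrow> hang (Suc n) (Node (add_mset c F)) x (Node (add_mset c' F))"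

lemma mheight_branch: "c \<in># F \<Longrightarrow> mheight c < mheight (Node F)"
proof -
  assume "c \<in># F"
  then have "Suc (mheight c) \<le> Max (insert 0 (Suc ` set_mset (image_mset mheight F)))"
    by (intro Max_ge) auto
  then show ?thesis by simp
qed

lemma hang_height: "hang n r x z \<Longrightarrow> n < mheight z"
proof (induction rule: hang.induct)
  case (base G x)
  then show ?case using mheight_branch[of x "add_mset x G"] by (simp del: mheight.simps)
next
  case (step n c x c' F)
  then show ?case using mheight_branch[of c' "add_mset c' F"] by (simp del: mheight.simps)
qed

lemma hang_graft: "hang n r x z \<Longrightarrow> z \<in># graft x r"
  by (induction rule: hang.induct) (auto simp: image_iff)

lemma hang_size: "hang n r x z \<Longrightarrow> msize z = msize x + msize r"
  using hang_graft msize_graft by blast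

lemma hang_exists: "\<exists>z. hang (mheight r) r x z"
proof (induction r)
  case (Node F)
  let ?A = "insert 0 (Suc ` mheight ` set_mset F)"
  have eq: "mheight (Node F) = Max ?A" by simp
  have "Max ?A \<in> ?A" by (rule Max_in) auto
  then show ?case
  proof
    assume "Max ?A = 0"
    then show ?thesis using hang.base eq by metis
  next
    assume "Max ?A \<in> Suc ` mheight ` set_mset F"
    then obtain c where c: "c \<in># F" "Max ?A = Suc (mheight c)" by auto
    then obtain z where "hang (mheight c) c x z" using Node by blast
    from hang.step[OF this, of "F - {#c#}"] show ?thesis
      using c eq by (auto simp del: mheight.simps)
  qed
qed

lemma cuts_NodeE:
  assumes "(p, q) \<in># cuts (Node F)"
  obtains "p \<in># F" "q = Node (F - {#p#})"
    | c q' where "c \<in># F" "(p, q') \<in># cuts c" "q = Node (add_mset q' (F - {#c#}))"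
  using assms by (auto simp: in_Union_mset_iff)

lemma cuts_NodeI:
  assumes "c \<in># F" "(p, q) \<in># cuts c"
  shows "(p, Node (add_mset q (F - {#c#}))) \<in># cuts (Node F)"
proof -
  obtain F' where F': "F = add_mset c F'"
    using assms(1) by (auto dest: multi_member_split)
  have "(p, Node (add_mset q F')) \<in> (\<lambda>(p, q). (p, Node (add_mset q F'))) ` set_mset (cuts c)"
    using assms(2) by force
  then show ?thesis by (simp add: F')
qed

text \<open>The four alternatives are the possible positions of the removed edge: the new edge, an
  edge inside \<open>x\<close>, an edge of \<open>r\<close> off the path to the hanging vertex, or
  an edge on that path. In the last case the pruned part properly contains \<open>x\<close>.\<close>

lemma hang_cuts:
  assumes "hang n r x z" "(p, q) \<in># cuts z"
  shows "(p = x \<and> q = r) \<or> (\<exists>x'. (p, x') \<in># cuts x \<and> hang n r x' q) \<or>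
    (\<exists>r'. (p, r') \<in># cuts r \<and> hang n r' x q) \<or> (msize q < msize r \<and> msize x < msize p)"
  using assms
proof (induction arbitrary: p q rule: hang.induct)
  case (base G x)
  let ?F = "add_mset x G"
  consider "p \<in># ?F" "q = Node (?F - {#p#})"
    | c q' where "c \<in># ?F" "(p, q') \<in># cuts c" "q = Node (add_mset q' (?F - {#c#}))"
    using cuts_NodeE[OF base] by blast
  then show ?case
  proof cases
    case 1
    show ?thesis
    proof (cases "p = x")
      case True
      then show ?thesis using 1 by simp
    next
      case False
      then have "p \<in># G" using 1 by auto
      then have "(p, Node (G - {#p#})) \<in># cuts (Node G)" "q = Node (add_mset x (G - {#p#}))"
        using 1 False by auto
      then show ?thesis using hang.base by blast
    qed
  next
    case 2
    show ?thesis
    proof (cases "c = x")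
      case True
      then have "q = Node (add_mset q' G)" using 2 by simp
      then show ?thesis using 2 True hang.base by blast
    next
      case False
      then have c: "c \<in># G" using 2 by auto
      then have "(p, Node (add_mset q' (G - {#c#}))) \<in># cuts (Node G)" 
        using 2 c by (intro cuts_NodeI)
      moreover have "q = Node (add_mset x (add_mset q' (G - {#c#})))"
        using 2 False by (simp add: add_mset_commute)
      ultimately show ?thesis using hang.base by blast
    qed
  qed
next
  case (step n c x c' F)
  let ?F = "add_mset c' F"
  note sz = hang_size[OF step.hyps]
  consider "p \<in># ?F" "q = Node (?F - {#p#})"
    | b q' where "b \<in># ?F" "(p, q') \<in># cuts b" "q = Node (add_mset q' (?F - {#b#}))"
    using cuts_NodeE[OF step.prems] by blast
  then show ?case
  proof cases
    case 1
    show ?thesis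
    proof (cases "p = c'")
      case True
      then show ?thesis using 1 sz by simp
    next
      case False
      then have "p \<in># F" using 1 by auto
      then have "(p, Node (add_mset c (F - {#p#}))) \<in># cuts (Node (add_mset c F))"
        using multi_member_split[of p F] by (auto simp: add_mset_commute)
      moreover have "q = Node (add_mset c' (F - {#p#}))" using 1 False by simp
      ultimately show ?thesis using hang.step[OF step.hyps] by blast
    qed
  next
    case 2
    show ?thesis
    proof (cases "b = c'")
      case True
      then have q: "q = Node (add_mset q' F)" "(p, q') \<in># cuts c'" using 2 by simp_all
      from step.IH[OF q(2)] show ?thesis
      proof (elim disjE exE conjE)
        assume "p = x" "q' = c"
        then show ?thesis using q by simp
      next
        fix x' assume "(p, x') \<in># cuts x" "hang n c x' q'"
        then show ?thesis using q hang.step by blast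
      next
        fix r' assume "(p, r') \<in># cuts c" "hang n r' x q'"
        moreover from this have "(p, Node (add_mset r' F)) \<in># cuts (Node (add_mset c F))"
          using cuts_NodeI[of c "add_mset c F" p r'] by simp
        ultimately show ?thesis using q hang.step by blast
      next
        assume "msize q' < msize c" "msize x < msize p"
        then show ?thesis using q by simp
      qed
    next
      case False
      then have b: "b \<in># F" using 2 by auto
      then obtain F' where F': "F = add_mset b F'" by (auto dest: multi_member_split)
      have "(p, Node (add_mset q' (add_mset c F'))) \<in># cuts (Node (add_mset b (add_mset c F')))"
        using 2 cuts_NodeI[of b "add_mset b (add_mset c F')" p q'] by simp
      moreover have "q = Node (add_mset c' (add_mset q' F'))"
        using 2 False F' by (simp add: add_mset_commute)
      moreover have "hang (Suc n) (Node (add_mset q' (add_mset c F'))) x (Node (add_mset c' (add_mset q' F')))"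
        using hang.step[OF step.hyps, of "add_mset q' F'"] by (simp add: add_mset_commute)
      ultimately show ?thesis
        unfolding F' add_mset_commute[of c b] by blast
    qed
  qed
qed

section \<open>The kernel of the projection onto the Whittaker module\<close>

type_synonym ie_free = "ie_basis fword \<Rightarrow>\<^sub>0 complex"

text \<open>Letters are indexed by codes, so that \<open>graft\<close> and \<open>cuts\<close>
  describe their brackets.\<close>

definition Xp :: "mtree \<Rightarrow> ie_free" where "Xp z = bvec (FWord [Dplus (tdecode z)])"
definition Xm :: "mtree \<Rightarrow> ie_free" where "Xm z = bvec (FWord [Dminus (tdecode z)])"
definition Xd :: ie_free where "Xd = bvec (FWord [Dgr])"

lemma letter_cases: "bvec (FWord [b]) = (case b of Dgr \<Rightarrow> Xd | Dplus t \<Rightarrow> Xp (tcode t) | Dminus t \<Rightarrow> Xm (tcode t))"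
  by (cases b) (simp_all add: Xp_def Xm_def Xd_def)

lemma J_commutator:
  "bvec (FWord [a]) * bvec (FWord [b]) - bvec (FWord [b]) * bvec (FWord [a]) - degree_one (basis_bracket a b) \<in> g.J"
proof -
  have "ie_bracket (bvec a) (bvec b) = basis_bracket a b"
    by (simp add: bilinear_ext_def vscale_simps)
  then show ?thesis
    using g.J_relation[of "bvec a" "bvec b"] by (simp add: degree_one_bvec span_of_def)
qed

definition mixed_bracket :: "mtree \<Rightarrow> mtree \<Rightarrow> ie_free" where
  "mixed_bracket s z = (if s = z then Xd else (\<Sum>q\<in>#cut_rests s z. Xp q) +
     (\<Sum>r | s \<in># graft z r. vscale (of_nat (count (graft z r) s)) (Xm r)))"

lemma degree_one_mixed: "degree_one (bracket_minus_plus (tdecode s) (tdecode z)) = mixed_bracket s z"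
proof (cases "s = z")
  case True
  then show ?thesis by (simp add: bracket_minus_plus_def mixed_bracket_def degree_one_bvec Xd_def)
next
  case False
  then have ne: "tdecode s \<noteq> tdecode z" by (metis tcode_tdecode)
  let ?X = "cut_rests s z" and ?R = "{r. s \<in># graft z r}"
  have 1: "Sum_any (\<lambda>r. Poly_Mapping.single (Dplus r) (of_nat (\<alpha> (tdecode s) (tdecode z) r))) =
      (\<Sum>y\<in>set_mset ?X. vscale (of_nat (count ?X y)) (bvec (Dplus (tdecode y))))"
    by (subst Sum_any_trees[of "set_mset ?X"]) (auto simp: \<alpha>_count count_cut_rests in_cut_rests)
  have 2: "Sum_any (\<lambda>r. Poly_Mapping.single (Dminus r) (of_nat (\<beta> (tdecode s) (tdecode z) r))) =
      (\<Sum>y\<in>?R. vscale (of_nat (count (graft z y) s)) (bvec (Dminus (tdecode y))))"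
    by (subst Sum_any_trees[of ?R]) (auto simp: \<beta>_count not_in_iff finite_graft_inverse)
  show ?thesis
    using False ne
    by (simp add: bracket_minus_plus_def mixed_bracket_def 1 2 linear_mapD[OF linear_degree_one]
        degree_one_bvec Xp_def Xm_def sum_mset_vscale[of "set_mset ?X" ?X])
qed

lemma Xp_Xm: "Xp z * Xm s - (Xm s * Xp z - mixed_bracket s z) \<in> g.J"
  using J_commutator[of "Dplus (tdecode z)" "Dminus (tdecode s)"]
  by (simp add: Xp_def Xm_def degree_one_mixed linear_mapD[OF linear_degree_one] algebra_simps)

definition minus_bracket :: "mtree \<Rightarrow> mtree \<Rightarrow> ie_free" where
  "minus_bracket s t = (\<Sum>r\<in>set_mset (graft t s) \<union> set_mset (graft s t).
     vscale (of_nat (count (cuts r) (t, s)) - of_nat (count (cuts r) (s, t))) (Xm r))"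

lemma Xm_Xm: "Xm s * Xm t - (Xm t * Xm s + minus_bracket s t) \<in> g.J"
proof -
  have "degree_one (basis_bracket (Dminus (tdecode s)) (Dminus (tdecode t))) = minus_bracket s t"
    unfolding basis_bracket.simps
    by (subst Sum_any_trees[of "set_mset (graft t s) \<union> set_mset (graft s t)"])
      (auto simp: \<alpha>_count not_in_iff minus_bracket_def linear_mapD[OF linear_degree_one] degree_one_bvec Xm_def
        simp flip: cut_iff_graft)
  then show ?thesis
    using J_commutator[of "Dminus (tdecode s)" "Dminus (tdecode t)"]
    by (simp add: Xm_def algebra_simps)
qed

lemma Xd_Xm: "Xd * Xm t - (Xm t * Xd - vscale (of_nat (msize t)) (Xm t)) \<in> g.J"
  using J_commutator[of Dgr "Dminus (tdecode t)"]
  by (simp add: Xd_def Xm_def tsize_tcode single_conv_vscale[of _ "- _"] linear_mapD[OF linear_degree_one]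
      degree_one_bvec vscale_simps algebra_simps)

lemma Xp_Xd: "Xp z * Xd - (Xd - Poly_Mapping.single 0 (of_nat (msize z))) * Xp z \<in> g.J"
  using J_commutator[of "Dplus (tdecode z)" Dgr]
  by (simp add: Xd_def Xp_def tsize_tcode single_conv_vscale[of _ "- _"] linear_mapD[OF linear_degree_one]
      degree_one_bvec vscale_simps algebra_simps vscale_conv_mult)

section \<open>Polynomials in the grading element\<close>

text \<open>Evaluation of a polynomial at the letter \<open>d\<close>, by Horner's scheme.\<close>

definition pd :: "complex poly \<Rightarrow> ie_free" where
  "pd P = fold_coeffs (\<lambda>a q. cst a + Xd * q) P 0"

lemma pd_zero [simp]: "pd 0 = 0"
  by (simp add: pd_def)

lemma pd_pCons: "pd (pCons a P) = cst a + Xd * pd P"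
  by (cases "P = 0 \<and> a = 0") (auto simp: pd_def)

lemma pd_add: "pd (P + Q) = pd P + pd Q"
  by (induction P Q rule: poly_induct2) (simp_all add: pd_pCons single_add distrib_left)

lemma pd_smult: "pd (smult c P) = vscale c (pd P)"
  by (induction P) (simp_all add: pd_pCons vscale_simps vscale_conv_mult[of c "cst _"] mult_single vscale_mult_right)

lemma pd_diff: "pd (P - Q) = pd P - pd Q"
  using pd_add[of "P - Q" Q] by simp

text \<open>The substitution \<open>P(x - n)\<close>: since
  \<open>D_z\<^sup>+ d = (d - |z|) D_z\<^sup>+\<close>, it is the price of moving
  \<open>D_z\<^sup>+\<close> to the right of \<open>P(d)\<close>.\<close>

definition shift :: "nat \<Rightarrow> complex poly \<Rightarrow> complex poly" where
  "shift n P = pcompose P [:- of_nat n, 1:]"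

lemma shift_eq_0 [simp]: "shift n P = 0 \<longleftrightarrow> P = 0"
  by (simp add: shift_def pcompose_eq_0_iff)

lemma Xp_pd: "Xp z * pd P - pd (shift (msize z) P) * Xp z \<in> g.J"
proof (induction P)
  case 0
  then show ?case by (simp add: shift_def g.J_zero)
next
  case (pCons a P)
  let ?n = "of_nat (msize z) :: complex" and ?Q = "pd P" and ?R = "pd (shift (msize z) P)"
  have "shift (msize z) (pCons a P) = [:a:] + (smult (- ?n) (shift (msize z) P) + pCons 0 (shift (msize z) P))"
    by (simp add: shift_def pcompose_pCons)
  then have "pd (shift (msize z) (pCons a P)) = cst a + (Xd - cst ?n) * ?R"
    by (simp add: pd_add pd_smult pd_diff pd_pCons vscale_simps vscale_conv_mult left_diff_distrib)
  then have "Xp z * pd (pCons a P) - pd (shift (msize z) (pCons a P)) * Xp z =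
      (Xp z * Xd - (Xd - cst ?n) * Xp z) * ?Q + (Xd - cst ?n) * (Xp z * ?Q - ?R * Xp z)"
    by (simp only: pd_pCons distrib_left distrib_right left_diff_distrib right_diff_distrib mult.assoc
        single_zero_commute[of a "Xp z"]) (simp add: algebra_simps)
  moreover have "(Xp z * Xd - (Xd - cst ?n) * Xp z) * ?Q \<in> g.J"
    by (rule g.J_right[OF Xp_Xd]) simp
  moreover have "(Xd - cst ?n) * (Xp z * ?Q - ?R * Xp z) \<in> g.J"
    by (rule g.J_left[OF pCons.IH]) simp
  ultimately show ?case by (simp add: g.J_add)
qed

section \<open>A filtration of the Whittaker module\<close>

text \<open>The degree is lexicographic in (total size, number of letters): in all relations used below a
  letter is gained only if the total size drops, so the factor 3 makes one integer suffice.\<close>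

definition dgr :: "mtree \<Rightarrow> int" where
  "dgr t = 3 * int (msize t) + 1"

definition dgl :: "mtree list \<Rightarrow> int" where
  "dgl ts = sum_list (map dgr ts)"

lemma dgl_simps [simp]: "dgl [] = 0" "dgl (t # ts) = dgr t + dgl ts"
  by (simp_all add: dgl_def)

lemma dgl_append [simp]: "dgl (ts @ us) = dgl ts + dgl us"
  by (simp add: dgl_def)

lemma dgr_pos: "0 < dgr t"
  by (simp add: dgr_def)

lemma dgl_nonneg: "0 \<le> dgl ts"
  using dgr_pos by (induction ts) (auto intro: add_nonneg_nonneg less_imp_le)

lemma dgl_mset: "mset ts = mset us \<Longrightarrow> dgl ts = dgl us"
  unfolding dgl_def by (metis mset_map sum_mset_sum_list)

definition vec :: "mtree list \<Rightarrow> complex poly \<Rightarrow> ie_free" where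
  "vec ts P = prod_list (map Xm ts) * pd P"

lemma vec_Nil [simp]: "vec [] P = pd P"
  by (simp add: vec_def)

lemma vec_Cons: "vec (t # ts) P = Xm t * vec ts P"
  by (simp add: vec_def mult.assoc)

lemma vec_add: "vec ts (P + Q) = vec ts P + vec ts Q"
  by (simp add: vec_def pd_add distrib_left)

lemma vec_smult: "vec ts (smult c P) = vscale c (vec ts P)"
  by (simp add: vec_def pd_smult vscale_mult_right)

locale whittaker_type =
  fixes \<eta> :: "ie_alg \<Rightarrow> complex" and t0 :: mtree
  assumes hom: "n_plus_hom \<eta>"
    and chi0: "tchar \<eta> t0 \<noteq> 0"
    and chi_high: "\<And>z. mheight t0 < mheight z \<Longrightarrow> tchar \<eta> z = 0"
begin

abbreviation "\<chi> \<equiv> tchar \<eta>"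

definition K :: "ie_free set" where
  "K = {p. \<Psi> \<eta> p = \<Psi> \<eta> 0}"

lemma K_zero [simp]: "0 \<in> K"
  by (simp add: K_def)

lemma K_add: "p \<in> K \<Longrightarrow> q \<in> K \<Longrightarrow> p + q \<in> K"
  unfolding K_def using \<Psi>_add[OF hom, of p q] \<Psi>_add[OF hom, of 0 0] by simp

lemma K_left: "p \<in> K \<Longrightarrow> a * p \<in> K"
  unfolding K_def using U_act_\<Psi>[OF hom, of a p] U_act_\<Psi>[OF hom, of a 0] by simp

lemma K_uminus: "p \<in> K \<Longrightarrow> - p \<in> K"
  using K_left[of p "- 1"] by simp

lemma K_diff: "p \<in> K \<Longrightarrow> q \<in> K \<Longrightarrow> p - q \<in> K"
  using K_add[OF _ K_uminus] by fastforce

lemma K_J: "p \<in> g.J \<Longrightarrow> p \<in> K"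
  unfolding K_def using \<Psi>_ideal[OF hom, of p 0] by simp

lemma K_J_right: "p \<in> g.J \<Longrightarrow> p * a \<in> K"
  using K_J[OF g.J_right[of p a]] by simp

lemma K_vscale: "p \<in> K \<Longrightarrow> vscale c p \<in> K"
  by (simp add: vscale_conv_mult K_left)

lemma K_iff: "\<Psi> \<eta> p = \<Psi> \<eta> q \<longleftrightarrow> p - q \<in> K"
proof
  assume "\<Psi> \<eta> p = \<Psi> \<eta> q"
  then have "\<Psi> \<eta> (p + - q) = \<Psi> \<eta> (q + - q)"
    by (simp only: \<Psi>_add[OF hom])
  then show "p - q \<in> K" by (simp add: K_def)
next
  assume "p - q \<in> K"
  then have "\<Psi> \<eta> ((p - q) + q) = \<Psi> \<eta> (0 + q)"
    by (simp only: \<Psi>_add[OF hom] K_def mem_Collect_eq)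
  then show "\<Psi> \<eta> p = \<Psi> \<eta> q" by simp
qed

lemma K_Xp: "Xp z - cst (\<chi> z) \<in> K"
proof -
  have "Xp z \<in> carrier (tensor_algebra (range Dplus))"
    by (auto simp: Xp_def tensor_carrier)
  from \<Psi>_right[OF hom this, of 1]
  have "\<Psi> \<eta> (Xp z) = \<Psi> \<eta> (cst (word_character \<eta> (Xp z)))" by simp
  moreover have "word_character \<eta> (Xp z) = \<chi> z"
    by (simp add: Xp_def word_character_simps word_value_def tchar_def[OF hom])
  ultimately show ?thesis by (simp add: K_iff)
qed

lemma K_one: "1 \<notin> K"
  using \<Psi>_one_nonzero[OF hom] by (simp add: K_def)

text \<open>A linear span without a rule for scalars: in \<open>vec ts P\<close> they are absorbed
  by the polynomial, and \<open>K\<close> is already closed under them.\<close>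

inductive_set FF :: "int \<Rightarrow> ie_free set" for N :: int where
  K: "k \<in> K \<Longrightarrow> k \<in> FF N"
| vec: "dgl ts \<le> N \<Longrightarrow> vec ts P \<in> FF N"
| add: "p \<in> FF N \<Longrightarrow> q \<in> FF N \<Longrightarrow> p + q \<in> FF N"

lemma FF_mono: "p \<in> FF N \<Longrightarrow> N \<le> M \<Longrightarrow> p \<in> FF M"
  by (induction rule: FF.induct) (auto intro: FF.intros)

lemma FF_vscale: "p \<in> FF N \<Longrightarrow> vscale c p \<in> FF N"
proof (induction rule: FF.induct)
  case (vec ts P)
  then show ?case using FF.vec[of ts N "smult c P"] by (simp add: vec_smult)
qed (auto intro: FF.intros K_vscale simp: vscale_simps)

lemma FF_uminus: "p \<in> FF N \<Longrightarrow> - p \<in> FF N"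
  using FF_vscale[of p N "- 1"] by (simp add: vscale_simps)

lemma FF_diff: "p \<in> FF N \<Longrightarrow> q \<in> FF N \<Longrightarrow> p - q \<in> FF N"
  using FF.add[OF _ FF_uminus] by fastforce

lemma FF_zero [simp]: "0 \<in> FF N"
  by (simp add: FF.K)

lemma FF_sum: "(\<And>i. i \<in> A \<Longrightarrow> f i \<in> FF N) \<Longrightarrow> sum f A \<in> FF N"
  by (induction A rule: infinite_finite_induct) (auto intro: FF.add)

lemma FF_sum_mset: "(\<And>i. i \<in># A \<Longrightarrow> f i \<in> FF N) \<Longrightarrow> (\<Sum>i\<in>#A. f i) \<in> FF N"
  by (induction A) (auto intro: FF.add)

lemma FF_K_add: "p \<in> FF N \<Longrightarrow> q - p \<in> K \<Longrightarrow> q \<in> FF N"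
  using FF.add[of p N "q - p"] FF.K[of "q - p" N] by simp

lemma FF_diff_cancel: "p - q \<in> FF N \<Longrightarrow> q \<in> FF N \<Longrightarrow> p \<in> FF N"
  using FF.add[of "p - q" N q] by simp

text \<open>Degrees are nonnegative, so this is where all reductions by degree end.\<close>

lemma FF_neg: "p \<in> FF N \<Longrightarrow> N < 0 \<Longrightarrow> p \<in> K"
proof (induction rule: FF.induct)
  case (vec ts P)
  then show ?case using dgl_nonneg[of ts] by simp
qed (simp_all add: K_add)

lemma Xm_FF: "p \<in> FF N \<Longrightarrow> Xm t * p \<in> FF (N + dgr t)"
proof (induction rule: FF.induct)
  case (vec ts P)
  then show ?case using FF.vec[of "t # ts" "N + dgr t" P] by (simp add: vec_Cons)
qed (auto intro: FF.intros K_left simp: distrib_left)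

lemma Xd_vec: "Xd * vec ts P \<in> FF (dgl ts)"
proof (induction ts)
  case Nil
  have "Xd * pd P = vec [] (pCons 0 P)" by (simp add: pd_pCons)
  then show ?case using FF.vec[of "[]" 0] by simp
next
  case (Cons t ts)
  let ?m = "vec ts P"
  have "Xd * Xm t * ?m - (Xm t * Xd - vscale (of_nat (msize t)) (Xm t)) * ?m \<in> K"
    using K_J_right[OF Xd_Xm] by (simp add: left_diff_distrib)
  moreover have "(Xm t * Xd - vscale (of_nat (msize t)) (Xm t)) * ?m \<in> FF (dgl (t # ts))"
    unfolding left_diff_distrib vscale_mult_left mult.assoc
    using Xm_FF[OF Cons, of t] Xm_FF[OF FF.vec[of ts "dgl ts" P], of t]
    by (intro FF_diff FF_vscale) (simp_all add: add.commute)
  ultimately show ?case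
    using FF_K_add by (simp add: vec_Cons mult.assoc)
qed

lemma Xm_vec: "Xm t * vec ts P \<in> FF (dgr t + dgl ts)"
  using FF.vec[of "t # ts"] by (simp add: vec_Cons)

lemma minus_bracket_vec: "minus_bracket s t * vec ts P \<in> FF (dgr s + dgr t + dgl ts - 1)"
  unfolding minus_bracket_def sum_distrib_right vscale_mult_left
proof (intro FF_sum FF_vscale)
  fix r assume "r \<in> set_mset (graft t s) \<union> set_mset (graft s t)"
  \<comment> \<open>Two letters are replaced by one of the same total size.\<close>
  then have "dgr r = dgr s + dgr t - 1"
    using msize_graft by (auto simp: dgr_def)
  then show "Xm r * vec ts P \<in> FF (dgr s + dgr t + dgl ts - 1)"
    by (intro FF_mono[OF Xm_vec]) simp
qed

lemma swap_vec: "vec (s # t # ts) P - vec (t # s # ts) P \<in> FF (dgl (s # t # ts) - 1)"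
proof -
  have "(Xm s * Xm t - (Xm t * Xm s + minus_bracket s t)) * vec ts P \<in> K"
    by (rule K_J_right[OF Xm_Xm])
  then have "vec (s # t # ts) P - vec (t # s # ts) P - minus_bracket s t * vec ts P \<in> K"
    by (simp add: vec_Cons algebra_simps)
  then show ?thesis
    using FF_K_add[OF minus_bracket_vec] by (simp add: algebra_simps)
qed

lemma move_vec: "vec (s # us @ ts) P - vec (us @ s # ts) P \<in> FF (dgl (s # us @ ts) - 1)"
proof (induction us)
  case (Cons t us)
  have "vec (t # s # us @ ts) P - vec (t # us @ s # ts) P \<in> FF (dgl (s # us @ ts) - 1 + dgr t)"
    using Xm_FF[OF Cons, of t] by (simp add: vec_Cons right_diff_distrib)
  then have "vec (t # s # us @ ts) P - vec (t # us @ s # ts) P \<in> FF (dgl (s # t # us @ ts) - 1)"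
    by (rule FF_mono) simp
  from FF.add[OF swap_vec[of s t "us @ ts" P] this] show ?case by simp
qed simp

text \<open>Up to lower terms the letters \<open>Xm\<close> behave like commuting variables; leading
  terms can therefore be indexed by multisets.\<close>

lemma perm_vec: "mset ts = mset us \<Longrightarrow> vec ts P - vec us P \<in> FF (dgl ts - 1)"
proof (induction ts arbitrary: us)
  case (Cons s ts)
  then obtain as bs where us: "us = as @ s # bs"
    by (metis in_set_conv_decomp set_mset_mset union_single_eq_member mset.simps(2))
  then have m: "mset ts = mset (as @ bs)" using Cons.prems by simp
  then have "Xm s * (vec ts P - vec (as @ bs) P) \<in> FF (dgl ts - 1 + dgr s)"
    by (intro Xm_FF Cons.IH)
  then have "vec (s # ts) P - vec (s # as @ bs) P \<in> FF (dgl (s # ts) - 1)"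
    by (simp add: vec_Cons right_diff_distrib algebra_simps)
  moreover have "vec (s # as @ bs) P - vec us P \<in> FF (dgl (s # ts) - 1)"
    using move_vec[of s as bs P] dgl_mset[OF m] by (simp add: us)
  ultimately show ?case using FF.add by fastforce
qed simp

section \<open>The action of the creation operators\<close>

text \<open>\<open>Z\<close> is closed under cutting and contains \<open>t0\<close> with a tree hung at a vertex of maximal depth; apart
  from \<open>t0\<close> itself, the character can be nonzero only on members of \<open>Z\<close> smaller than \<open>t0\<close>.\<close>

definition Z :: "mtree set" where
  "Z = {z. (\<exists>r x. hang (mheight t0) r x z \<and> (msize r < msize t0 \<or> r = t0)) \<or> msize z < msize t0 \<or> z = t0}"

text \<open>In the order of \<open>hang_cuts\<close>: only \<open>r\<close> is left, a smaller tree
  hangs on \<open>r\<close>, the same tree hangs on something smaller than \<open>t0\<close>, or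
  what is left is itself smaller than \<open>t0\<close>.\<close>

lemma Z_cut: "z \<in> Z \<Longrightarrow> (p, q) \<in># cuts z \<Longrightarrow> q \<in> Z"
proof -
  assume z: "z \<in> Z" and c: "(p, q) \<in># cuts z"
  have lt: "msize q < msize z" if "(p, q) \<in># cuts z" for p q z
    using that msize_graft[of z p q] msize_pos[of p] by (simp add: cut_iff_graft)
  from z consider r x where "hang (mheight t0) r x z" "msize r < msize t0 \<or> r = t0"
    | "msize z < msize t0 \<or> z = t0" by (auto simp: Z_def)
  then show "q \<in> Z"
  proof cases
    case 1
    from hang_cuts[OF 1(1) c] show ?thesis
    proof (elim disjE exE conjE)
      assume "p = x" "q = r" then show ?thesis using 1(2) by (auto simp: Z_def)
    next
      fix x' assume "hang (mheight t0) r x' q" then show ?thesis using 1(2) by (auto simp: Z_def)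
    next
      fix r' assume "(p, r') \<in># cuts r" "hang (mheight t0) r' x q"
      moreover from this have "msize r' < msize t0" using lt 1(2) by fastforce
      ultimately show ?thesis by (auto simp: Z_def)
    next
      assume "msize q < msize r" then show ?thesis using 1(2) by (auto simp: Z_def)
    qed
  next
    case 2
    then show ?thesis using lt[OF c] by (auto simp: Z_def)
  qed
qed

text \<open>A tree with something hung at depth \<open>mheight t0\<close> is higher than
  \<open>t0\<close>, so its character vanishes.\<close>

lemma Z_chi: "z \<in> Z \<Longrightarrow> \<chi> z \<noteq> 0 \<Longrightarrow> z \<noteq> t0 \<Longrightarrow> msize z < msize t0"
  using hang_height chi_high by (auto simp: Z_def)

lemma t0_size: "1 \<le> int (msize t0)"
  using msize_pos[of t0] by linarith

definition St :: "mtree \<Rightarrow> mtree" where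
  "St t = (SOME z. hang (mheight t0) t0 t z)"

lemma hang_St: "hang (mheight t0) t0 t (St t)"
  unfolding St_def using hang_exists by (rule someI_ex)

lemma St_Z: "St t \<in> Z"
  using hang_St by (auto simp: Z_def)

lemma St_chi: "\<chi> (St t) = 0"
  using hang_height[OF hang_St] chi_high by blast

lemma St_size: "msize (St t) = msize t + msize t0"
  using hang_size[OF hang_St] .

lemma St_neq: "St t \<noteq> t0"
  using St_chi chi0 by metis

text \<open>Only the new edge can leave \<open>t0\<close>: a remainder with something still hung at
  depth \<open>mheight t0\<close> is too high, and a cut on the path to the hanging vertex leaves
  too few vertices.\<close>

lemma St_cut: "(p, t0) \<in># cuts (St t) \<longleftrightarrow> p = t"
proof
  assume "(p, t0) \<in># cuts (St t)"
  then show "p = t"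
    using hang_cuts[OF hang_St] hang_height by blast
next
  assume "p = t"
  then show "(p, t0) \<in># cuts (St t)"
    using hang_graft[OF hang_St] cut_iff_graft by simp
qed

text \<open>The creation letter passes the polynomial, shifting it, and becomes a scalar on the
  generator.\<close>

lemma Xp_vec_Nil: "Xp z * pd P - vscale (\<chi> z) (pd (shift (msize z) P)) \<in> K"
proof -
  let ?R = "pd (shift (msize z) P)"
  have "?R * (Xp z - cst (\<chi> z)) \<in> K" by (rule K_left[OF K_Xp])
  then have "Xp z * pd P - ?R * Xp z + ?R * (Xp z - cst (\<chi> z)) \<in> K"
    by (rule K_add[OF K_J[OF Xp_pd]])
  then show ?thesis
    by (simp add: right_diff_distrib vscale_conv_mult single_zero_commute)
qed

lemma Xp_vec_Cons: "Xp z * vec (s # ts) P - (Xm s * (Xp z * vec ts P) - mixed_bracket s z * vec ts P) \<in> K"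
  using K_J_right[OF Xp_Xm[of z s], of "vec ts P"] by (simp add: vec_Cons left_diff_distrib mult.assoc)

text \<open>What remains are letters \<open>Xm r\<close> with \<open>|s| = |z| + |r|\<close>: the
  number of letters is kept and the size drops by \<open>|z|\<close>.\<close>

lemma mixed_rest:
  assumes "s \<noteq> z"
  shows "(mixed_bracket s z - (\<Sum>q\<in>#cut_rests s z. Xp q)) * vec ts P \<in> FF (dgl ts + dgr s - 3 * int (msize z))"
proof -
  have "Xm r * vec ts P \<in> FF (dgl ts + dgr s - 3 * int (msize z))" if "s \<in># graft z r" for r
    using Xm_vec[of r ts P] msize_graft[OF that] by (simp add: dgr_def algebra_simps)
  then show ?thesis
    using assms
    by (simp add: mixed_bracket_def sum_distrib_right vscale_mult_left) (intro FF_sum FF_vscale, simp)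
qed

lemma cut_rests_size: "q \<in># cut_rests s z \<Longrightarrow> msize z = msize s + msize q"
  using msize_graft[of z s q] by (simp add: in_cut_rests cut_iff_graft)

text \<open>Moving \<open>Xp z\<close> past the letter of \<open>s\<close> creates
  \<open>Xp q\<close> for remainders \<open>q\<close> of \<open>z\<close>, again in
  \<open>Z\<close>. At the right end such a letter becomes the scalar \<open>\<chi> q\<close>,
  nonzero only if \<open>q = t0\<close> or \<open>|q| < |t0|\<close>; this explains the allowance
  \<open>3|t0| - 3|z|\<close>, with a unit to spare unless \<open>z = t0\<close>. The two claims are
  proved together, since remainders of other trees can be \<open>t0\<close>.\<close>

lemma Xp_vec:
  assumes "z \<in> Z"
  shows "z \<noteq> t0 \<Longrightarrow> Xp z * vec ts P \<in> FF (dgl ts - 3 * int (msize z) + 3 * int (msize t0) - 1)"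
    and "z = t0 \<Longrightarrow> Xp z * vec ts P - vscale (\<chi> t0) (vec ts (shift (msize t0) P)) \<in> FF (dgl ts - 1)"
  using assms
proof (induction ts arbitrary: z)
  case Nil
  {
    case 1
    show ?case
    proof (cases "\<chi> z = 0")
      case True
      then show ?thesis using Xp_vec_Nil[of z P] by (auto simp: vscale_simps intro: FF.K)
    next
      case False
      then have "msize z < msize t0" using Z_chi 1 by blast
      then have "vscale (\<chi> z) (vec [] (shift (msize z) P)) \<in> FF (- 3 * int (msize z) + 3 * int (msize t0) - 1)"
        by (intro FF_vscale FF.vec) simp
      then show ?thesis using FF_K_add[OF _ Xp_vec_Nil] by simp
    qed
  next
    case 2
    then show ?case using Xp_vec_Nil[of z P] by (auto intro: FF.K)
  }
next
  case (Cons s ts)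
  have R: "mixed_bracket s z * vec ts P \<in> FF (dgl (s # ts) - 3 * int (msize z) + 3 * int (msize t0) - 1)"
    if z: "z \<in> Z" for z
  proof (cases "s = z")
    case True
    then have "mixed_bracket s z * vec ts P = Xd * vec ts P" by (simp add: mixed_bracket_def)
    then show ?thesis
      using FF_mono[OF Xd_vec] True by (simp add: dgr_def)
  next
    case False
    have "Xp q * vec ts P \<in> FF (dgl (s # ts) - 3 * int (msize z) + 3 * int (msize t0) - 1)"
      if q: "q \<in># cut_rests s z" for q
    proof -
      have qZ: "q \<in> Z" using Z_cut[OF z, of s q] q by (simp add: in_cut_rests)
      \<comment> \<open>One unit weaker than the induction hypothesis, so as to include
        \<open>q = t0\<close>. The lost letter restores the unit: \<open>dgl ts - 3|q|\<close>
        equals \<open>dgl (s # ts) - 3|z| - 1\<close>.\<close>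
      have "Xp q * vec ts P \<in> FF (dgl ts - 3 * int (msize q) + 3 * int (msize t0))"
      proof (cases "q = t0")
        case True
        have "vscale (\<chi> t0) (vec ts (shift (msize t0) P)) \<in> FF (dgl ts)"
          by (intro FF_vscale FF.vec) simp
        moreover have "Xp q * vec ts P - vscale (\<chi> t0) (vec ts (shift (msize t0) P)) \<in> FF (dgl ts)"
          using Cons.IH(2)[OF True qZ] by (rule FF_mono) simp
        ultimately show ?thesis using FF_diff_cancel True by simp
      next
        case False
        show ?thesis by (rule FF_mono[OF Cons.IH(1)[OF False qZ]]) simp
      qed
      then show ?thesis using cut_rests_size[OF q] by (simp add: dgr_def algebra_simps)
    qed
    then have "(\<Sum>q\<in>#cut_rests s z. Xp q) * vec ts P \<in> FF (dgl (s # ts) - 3 * int (msize z) + 3 * int (msize t0) - 1)"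
      unfolding sum_mset_distrib_right by (intro FF_sum_mset) simp
    moreover have "(mixed_bracket s z - (\<Sum>q\<in>#cut_rests s z. Xp q)) * vec ts P
        \<in> FF (dgl (s # ts) - 3 * int (msize z) + 3 * int (msize t0) - 1)"
      using mixed_rest[OF False, of ts P] by (rule FF_mono) (use t0_size in simp)
    ultimately show ?thesis
      using FF.add by (fastforce simp: left_diff_distrib)
  qed
  {
    case 1
    have "Xm s * (Xp z * vec ts P) \<in> FF (dgl (s # ts) - 3 * int (msize z) + 3 * int (msize t0) - 1)"
      using Xm_FF[OF Cons.IH(1)[OF 1], of s] by (simp add: algebra_simps)
    from FF_K_add[OF FF_diff[OF this R[OF 1(2)]] Xp_vec_Cons] show ?case by simp
  next
    case 2
    have "Xm s * (Xp z * vec ts P - vscale (\<chi> t0) (vec ts (shift (msize t0) P))) \<in> FF (dgl (s # ts) - 1)"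
      using Xm_FF[OF Cons.IH(2)[OF 2], of s] by (simp add: algebra_simps)
    then have "Xm s * (Xp z * vec ts P) - vscale (\<chi> t0) (vec (s # ts) (shift (msize t0) P)) \<in> FF (dgl (s # ts) - 1)"
      by (simp add: right_diff_distrib vscale_mult_right vec_Cons)
    moreover have "mixed_bracket s z * vec ts P \<in> FF (dgl (s # ts) - 1)"
      using R[OF 2(2)] 2(1) by simp
    ultimately have "Xm s * (Xp z * vec ts P) - mixed_bracket s z * vec ts P
        - vscale (\<chi> t0) (vec (s # ts) (shift (msize t0) P)) \<in> FF (dgl (s # ts) - 1)"
      using FF_diff by (fastforce simp: algebra_simps)
    then show ?case
      by (rule FF_K_add) (use Xp_vec_Cons[of z s ts P] in \<open>simp add: algebra_simps\<close>)
  }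
qed

end

text \<open>A fixed ordering for each monomial; by \<open>perm_vec\<close> any other ordering
  changes only lower terms.\<close>

definition lst :: "'a multiset \<Rightarrow> 'a list" where
  "lst M = (SOME ts. mset ts = M)"

lemma mset_lst [simp]: "mset (lst M) = M"
  unfolding lst_def using ex_mset by (rule someI_ex)

lemma lst_empty [simp]: "lst {#} = []"
  using mset_lst[of "{#}"] by (simp del: mset_lst)

definition dgm :: "mtree multiset \<Rightarrow> int" where
  "dgm M = dgl (lst M)"

lemma dgm_mset: "dgm (mset ts) = dgl ts"
  unfolding dgm_def by (rule dgl_mset) simp

lemma dgm_add: "dgm (add_mset t M) = dgr t + dgm M"
  using dgm_mset[of "t # lst M"] by (simp add: dgm_def)

lemma dgm_remove: "t \<in># M \<Longrightarrow> dgm (M - {#t#}) = dgm M - dgr t"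
  using dgm_add[of t "M - {#t#}"] by simp

lemma dgm_eq_0: "dgm M = 0 \<longleftrightarrow> M = {#}"
proof (cases M)
  case (add t N)
  then show ?thesis
    using dgm_add[of t N] dgr_pos[of t] dgl_nonneg[of "lst N"] by (simp add: dgm_def)
qed (simp add: dgm_def)

section \<open>Leading terms and their reduction\<close>

context whittaker_type
begin

text \<open>The number \<open>\<alpha>(t, S_t, t0)\<close> times the character at \<open>t0\<close>:
  the scalar by which \<open>[D_t\<^sup>-, D^+]\<close>, with \<open>D^+\<close> at
  \<open>S_t\<close>, acts to leading order.\<close>

definition kap :: "mtree \<Rightarrow> complex" where
  "kap t = of_nat (count (cuts (St t)) (t, t0)) * \<chi> t0"

lemma kap_nonzero: "kap t \<noteq> 0"
  using chi0 St_cut[of t t] by (simp add: kap_def)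

lemma perm_lst: "vec ts P - vec (lst (mset ts)) P \<in> FF (dgl ts - 1)"
  by (rule perm_vec) simp

text \<open>By \<open>Xp_vec\<close> a remainder contributes to the leading order only if it is
  \<open>t0\<close>, and by \<open>St_cut\<close> this forces the letter \<open>s\<close> to be
  \<open>t\<close>. The term in \<open>d\<close> and the annihilation letters are of lower degree
  because \<open>S_t\<close> has \<open>|t0|\<close> vertices more than \<open>t\<close>.\<close>

lemma mixed_St:
  "mixed_bracket s (St t) * vec ts P - vscale (if s = t then kap t else 0) (vec ts (shift (msize t0) P))
    \<in> FF (dgl (s # ts) - 3 * int (msize t) - 2)"
proof (cases "s = St t")
  case True
  then have "msize s = msize t + msize t0" by (simp add: St_size)
  then have "s \<noteq> t" "dgr s = 3 * int (msize t) + 3 * int (msize t0) + 1"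
    using msize_pos[of t0] by (auto simp: dgr_def simp del: msize_pos)
  then show ?thesis
    using True FF_mono[OF Xd_vec] t0_size by (simp add: mixed_bracket_def vscale_simps)
next
  case False
  let ?T = "dgl (s # ts) - 3 * int (msize t) - 2"
  have "(mixed_bracket s (St t) - (\<Sum>q\<in>#cut_rests s (St t). Xp q)) * vec ts P \<in> FF ?T"
    using mixed_rest[OF False] by (rule FF_mono) (use St_size[of t] t0_size in simp)
  \<comment> \<open>Stated for any multiset of remainders, so that induction over the multiset is
    possible.\<close>
  moreover have "(\<Sum>q\<in>#Y. Xp q * vec ts P) - vscale (of_nat (count Y t0) * \<chi> t0) (vec ts (shift (msize t0) P)) \<in> FF ?T"
    if "set_mset Y \<subseteq> set_mset (cut_rests s (St t))" for Y
    using that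
  proof (induction Y)
    case (add q Y)
    let ?v = "vec ts (shift (msize t0) P)"
    have q: "q \<in># cut_rests s (St t)" using add.prems by simp
    then have qZ: "q \<in> Z" using Z_cut[OF St_Z] by (simp add: in_cut_rests)
    have sz: "msize t + msize t0 = msize s + msize q" using cut_rests_size[OF q] St_size[of t] by simp
    have "Xp q * vec ts P - vscale (if q = t0 then \<chi> t0 else 0) ?v \<in> FF ?T"
    proof (cases "q = t0")
      case True
      then show ?thesis
        using FF_mono[OF Xp_vec(2)[OF qZ True, of ts P], of ?T] sz by (simp add: dgr_def)
    next
      case False
      then show ?thesis
        using FF_mono[OF Xp_vec(1)[OF qZ False, of ts P], of ?T] sz by (simp add: dgr_def vscale_simps)
    qed
    from FF.add[OF this add.IH] add.prems show ?case
      by (auto simp: vscale_simps distrib_right algebra_simps split: if_splits)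
  qed (simp add: vscale_simps)
  from this[of "cut_rests s (St t)"]
  have "(\<Sum>q\<in>#cut_rests s (St t). Xp q) * vec ts P - vscale (if s = t then kap t else 0) (vec ts (shift (msize t0) P)) \<in> FF ?T"
    using St_cut[of s t] by (auto simp: sum_mset_distrib_right count_cut_rests kap_def not_in_iff vscale_simps split: if_splits)
  ultimately show ?thesis
    using FF.add by (fastforce simp: left_diff_distrib)
qed

text \<open>Modulo lower terms \<open>Xp (St t)\<close> acts as a nonzero multiple of \<open>d/dXm t\<close>, composed with a shift
  of the polynomial.\<close>

lemma St_vec:
  "Xp (St t) * vec ts P + vscale (of_nat (count (mset ts) t) * kap t)
      (vec (lst (mset ts - {#t#})) (shift (msize t0) P)) \<in> FF (dgl ts - 3 * int (msize t) - 2)"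
proof (induction ts)
  case Nil
  then show ?case using Xp_vec_Nil[of "St t" P] by (simp add: St_chi vscale_simps FF.K)
next
  case (Cons s ts)
  let ?M = "mset ts" and ?Q = "shift (msize t0) P" and ?T = "dgl (s # ts) - 3 * int (msize t) - 2"
  let ?c = "of_nat (count ?M t) * kap t"
  have 1: "Xm s * (Xp (St t) * vec ts P) + vscale ?c (vec (s # lst (?M - {#t#})) ?Q) \<in> FF ?T"
    using FF_mono[OF Xm_FF[OF Cons, of s], of ?T] by (simp add: distrib_left vscale_mult_right vec_Cons)
  have 2: "vscale ?c (vec (s # lst (?M - {#t#})) ?Q) - vscale ?c (vec (lst (add_mset s ?M - {#t#})) ?Q) \<in> FF ?T"
  proof (cases "t \<in># ?M")
    case True
    then have "add_mset s (?M - {#t#}) = add_mset s ?M - {#t#}" by simp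
    then have "vec (s # lst (?M - {#t#})) ?Q - vec (lst (add_mset s ?M - {#t#})) ?Q \<in> FF (dgl (s # lst (?M - {#t#})) - 1)"
      using perm_lst[of "s # lst (?M - {#t#})" ?Q] by simp
    moreover have "dgl (s # lst (?M - {#t#})) - 1 = ?T"
      using dgm_remove[OF True] dgm_mset[of ts] by (simp add: dgm_def dgr_def)
    ultimately have d: "vec (s # lst (?M - {#t#})) ?Q - vec (lst (add_mset s ?M - {#t#})) ?Q \<in> FF ?T"
      by (simp only:)
    show ?thesis using FF_vscale[OF d, of ?c] by (simp only: vscale_simps(9))
  next
    case False
    then have "count ?M t = 0" by (metis count_eq_zero_iff)
    then show ?thesis by (simp only: of_nat_0 mult_zero_left vscale_simps(5) diff_self FF_zero)
  qed
  have 3: "vscale (if s = t then kap t else 0) (vec ts ?Q)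
      - vscale (if s = t then kap t else 0) (vec (lst (add_mset s ?M - {#t#})) ?Q) \<in> FF ?T"
  proof (cases "s = t")
    case True
    show ?thesis
      by (rule FF_mono[of _ "dgl ts - 1"])
        (use True FF_vscale[OF perm_lst[of ts ?Q], of "kap t"] in \<open>simp_all add: vscale_simps dgr_def\<close>)
  qed (simp add: vscale_simps)
  \<comment> \<open>The Leibniz rule for the derivative by \<open>t\<close>: the old letters
    contribute the first summand, the new letter the second.\<close>
  have c: "of_nat (count (add_mset s ?M) t) * kap t = ?c + (if s = t then kap t else 0)"
    by (simp add: algebra_simps)
  define w where "w = vec (lst (add_mset s ?M - {#t#})) ?Q"
  define B where "B = mixed_bracket s (St t) * vec ts P"
  define A where "A = Xm s * (Xp (St t) * vec ts P)"
  note 1 = 1[folded A_def] and 2 = 2[folded w_def] and 3 = 3[folded w_def]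
    and 4 = mixed_St[of s t ts P, folded B_def]
  have "A - B + vscale (?c + (if s = t then kap t else 0)) w =
      (A + vscale ?c (vec (s # lst (?M - {#t#})) ?Q))
      - (vscale ?c (vec (s # lst (?M - {#t#})) ?Q) - vscale ?c w)
      - (B - vscale (if s = t then kap t else 0) (vec ts ?Q))
      - (vscale (if s = t then kap t else 0) (vec ts ?Q) - vscale (if s = t then kap t else 0) w)"
    unfolding vscale_simps(1) by simp
  then have "A - B + vscale (?c + (if s = t then kap t else 0)) w \<in> FF ?T"
    using FF_diff[OF FF_diff[OF FF_diff[OF 1 2] 4] 3] by (simp only:)
  moreover have "Xp (St t) * vec (s # ts) P + vscale (?c + (if s = t then kap t else 0)) w
      - (A - B + vscale (?c + (if s = t then kap t else 0)) w) \<in> K"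
    using Xp_vec_Cons[of "St t" s ts P] by (simp add: A_def B_def)
  ultimately have "Xp (St t) * vec (s # ts) P + vscale (?c + (if s = t then kap t else 0)) w \<in> FF ?T"
    by (rule FF_K_add)
  then show ?case
    unfolding mset.simps c w_def .
qed

lemma St_FF: "p \<in> FF N \<Longrightarrow> Xp (St t) * p \<in> FF (N - dgr t)"
proof (induction rule: FF.induct)
  case (vec ts P)
  then show ?case
    using FF_mono[OF Xp_vec(1)[OF St_Z St_neq, of t ts P], of "N - dgr t"] St_size[of t] by (simp add: dgr_def)
qed (auto intro: FF.intros K_left simp: distrib_left)

definition comb :: "mtree multiset set \<Rightarrow> (mtree multiset \<Rightarrow> complex poly) \<Rightarrow> ie_free" where
  "comb S c = (\<Sum>M\<in>S. vec (lst M) (c M))"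

text \<open>Removing one \<open>t\<close> is injective on the monomials that contain
  \<open>t\<close>, so leading coefficients cannot cancel: the one at \<open>M0\<close> is only
  shifted and multiplied by a nonzero number.\<close>

lemma St_comb:
  assumes S: "finite S" "M0 \<in> S" "c M0 \<noteq> 0" "t \<in># M0" "\<And>M. M \<in> S \<Longrightarrow> dgm M = N" and y: "y \<in> FF (N - 1)"
  obtains S' c' M' y' where "finite S'" "M' \<in> S'" "c' M' \<noteq> 0" "\<And>M. M \<in> S' \<Longrightarrow> dgm M = N - dgr t"
    "y' \<in> FF (N - dgr t - 1)" "Xp (St t) * (comb S c + y) = comb S' c' + y'"
proof -
  let ?R = "{M \<in> S. t \<in># M}" and ?h = "\<lambda>M. M - {#t#}"
  define S' where "S' = ?h ` ?R"
  \<comment> \<open>The minus sign is that of \<open>[D\<^sup>+, D\<^sup>-]\<close> against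
    \<open>[D\<^sup>-, D\<^sup>+]\<close>; the count is the exponent brought down by
    differentiation.\<close>
  define c' where "c' G = smult (- of_nat (count (add_mset t G) t) * kap t) (shift (msize t0) (c (add_mset t G)))" for G
  define k where "k M = of_nat (count M t) * kap t" for M
  have inj: "inj_on ?h ?R"
    by (rule inj_on_inverseI[of _ "add_mset t"]) simp
  have "comb S' c' = (\<Sum>M\<in>?R. vec (lst (?h M)) (c' (?h M)))"
    unfolding comb_def S'_def by (simp add: sum.reindex[OF inj])
  also have "\<dots> = (\<Sum>M\<in>?R. - vscale (k M) (vec (lst (?h M)) (shift (msize t0) (c M))))"
  proof (intro sum.cong refl)
    fix M assume "M \<in> ?R"
    then have "c' (?h M) = smult (- k M) (shift (msize t0) (c M))"
      by (simp add: c'_def k_def)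
    then show "vec (lst (?h M)) (c' (?h M)) = - vscale (k M) (vec (lst (?h M)) (shift (msize t0) (c M)))"
      by (simp only: vec_smult vscale_simps(7))
  qed
  also have "\<dots> = (\<Sum>M\<in>S. - vscale (k M) (vec (lst (?h M)) (shift (msize t0) (c M))))"
    using S(1) by (intro sum.mono_neutral_left) (auto simp: k_def not_in_iff vscale_simps)
  finally have comb: "comb S' c' = (\<Sum>M\<in>S. - vscale (k M) (vec (lst (?h M)) (shift (msize t0) (c M))))" .
  define y' where "y' = Xp (St t) * (comb S c + y) - comb S' c'"
  have "y' = (\<Sum>M\<in>S. Xp (St t) * vec (lst M) (c M) + vscale (k M) (vec (lst (?h M)) (shift (msize t0) (c M)))) + Xp (St t) * y"
    by (simp add: y'_def comb) (simp add: comb_def distrib_left sum_distrib_left sum.distrib sum_negf)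
  moreover have "Xp (St t) * vec (lst M) (c M) + vscale (k M) (vec (lst (?h M)) (shift (msize t0) (c M)))
      \<in> FF (N - dgr t - 1)" if "M \<in> S" for M
    using St_vec[of t "lst M" "c M"] S(5)[OF that] by (simp add: k_def dgm_def dgr_def algebra_simps)
  moreover have "Xp (St t) * y \<in> FF (N - dgr t - 1)"
    using St_FF[OF y, of t] by (simp add: algebra_simps)
  ultimately have "y' \<in> FF (N - dgr t - 1)"
    by (simp add: FF.add FF_sum)
  moreover have "?h M0 \<in> S'" "c' (?h M0) \<noteq> 0"
    using S kap_nonzero[of t] by (auto simp: S'_def c'_def)
  moreover have "dgm M = N - dgr t" if "M \<in> S'" for M
    using that S(5) dgm_remove by (auto simp: S'_def)
  moreover have "Xp (St t) * (comb S c + y) = comb S' c' + y'" by (simp add: y'_def)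
  ultimately show ?thesis using that[of S' "?h M0" c' y'] S(1) by (simp add: S'_def)
qed

text \<open>Leading coefficients cancel in the finite difference. If it vanished, the polynomial
  would be periodic, take one value infinitely often and be constant.\<close>

lemma shift_diff:
  assumes "degree P > 0" "n > 0"
  shows "shift n P - P \<noteq> 0" "degree (shift n P - P) < degree P"
proof -
  have deg: "degree (shift n P) = degree P" "lead_coeff (shift n P) = lead_coeff P"
    using lead_coeff_comp[of "[:- of_nat n, 1:]" P] by (simp_all add: shift_def degree_pcompose)
  then have "coeff (shift n P - P) (degree P) = 0" by simp
  moreover have "degree (shift n P - P) \<le> degree P"
    using deg by (intro degree_diff_le) auto
  ultimately show "degree (shift n P - P) < degree P"
    using assms(1) by (metis degree_0 le_neq_implies_less leading_coeff_0_iff)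
  show "shift n P - P \<noteq> 0"
  proof
    assume "shift n P - P = 0"
    then have eq: "poly P (x - of_nat n) = poly P x" for x
    proof -
      have "shift n P = P" using \<open>shift n P - P = 0\<close> by simp
      then have "poly (shift n P) x = poly P x" by simp
      then show ?thesis by (simp add: shift_def poly_pcompose)
    qed
    have "poly P (- of_nat (k * n)) = poly P 0" for k
    proof (induction k)
      case (Suc k)
      have "- of_nat (Suc k * n) = - of_nat (k * n) - (of_nat n :: complex)"
        by (simp add: algebra_simps)
      then show ?case by (simp only: eq Suc.IH)
    qed simp
    then have "range (\<lambda>k. - of_nat (k * n) :: complex) \<subseteq> {x. poly (P - [:poly P 0:]) x = 0}"
      by auto
    moreover have "inj (\<lambda>k. - of_nat (k * n) :: complex)"
      using assms(2) by (auto intro!: injI simp flip: of_nat_mult)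
    then have "infinite (range (\<lambda>k. - of_nat (k * n) :: complex))"
      by (rule range_inj_infinite)
    ultimately have "P - [:poly P 0:] = 0"
      using poly_roots_finite[of "P - [:poly P 0:]"] finite_subset by blast
    then have "P = [:poly P 0:]" by simp
    then have "degree P = 0" by (metis degree_pCons_0)
    then show False using assms(1) by simp
  qed
qed

lemma Xp_t0_pd: "(Xp t0 - cst (\<chi> t0)) * pd P - vscale (\<chi> t0) (pd (shift (msize t0) P - P)) \<in> K"
  using Xp_vec_Nil[of t0 P] by (simp add: left_diff_distrib pd_diff vscale_simps vscale_conv_mult[of _ "pd P"])

text \<open>\<open>Xp t0\<close> minus its eigenvalue turns \<open>P\<close> into a nonzero multiple
  of its finite difference; iterating reaches a nonzero constant.\<close>

lemma pd_generates: "P \<noteq> 0 \<Longrightarrow> \<exists>q. q * pd P - 1 \<in> K"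
proof (induction "degree P" arbitrary: P rule: less_induct)
  case less
  show ?case
  proof (cases "degree P = 0")
    case True
    then obtain a where a: "P = [:a:]" by (auto elim: degree_eq_zeroE)
    then have "cst (1 / a) * pd P = 1"
      using less.prems by (simp add: pd_pCons mult_single)
    then show ?thesis by (intro exI[of _ "cst (1 / a)"]) simp
  next
    case False
    let ?D = "shift (msize t0) P - P"
    obtain q where q: "q * pd ?D - 1 \<in> K"
      using less.hyps[of ?D] shift_diff[of P "msize t0"] False by auto
    let ?x = "\<chi> t0"
    define A where "A = Xp t0 - cst ?x"
    have "vscale (1 / ?x) q * (A * pd P - vscale ?x (pd ?D)) \<in> K"
      unfolding A_def by (rule K_left[OF Xp_t0_pd])
    moreover have "vscale (1 / ?x) q * (A * pd P - vscale ?x (pd ?D)) = vscale (1 / ?x) q * A * pd P - q * pd ?D"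
      using chi0 by (simp add: right_diff_distrib vscale_mult_left vscale_mult_right vscale_simps(2)[symmetric] vscale_simps(4) mult.assoc)
    ultimately have "vscale (1 / ?x) q * A * pd P - q * pd ?D \<in> K" by simp
    from K_add[OF this q] show ?thesis
      by (intro exI[of _ "vscale (1 / ?x) q * A"]) simp
  qed
qed

text \<open>Each step differentiates by a letter of a monomial with nonzero coefficient. At degree 0
  only the empty monomial is left, a nonzero polynomial in \<open>d\<close> modulo
  \<open>K\<close>.\<close>

lemma comb_generates:
  assumes "finite S" "M0 \<in> S" "c M0 \<noteq> 0" "\<And>M. M \<in> S \<Longrightarrow> dgm M = int n" "y \<in> FF (int n - 1)"
  shows "\<exists>q. q * (comb S c + y) - 1 \<in> K"
  using assms
proof (induction n arbitrary: S c M0 y rule: less_induct)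
  case (less n)
  show ?case
  proof (cases "n = 0")
    case True
    then have "M = {#}" if "M \<in> S" for M using less.prems(4)[OF that] dgm_eq_0 by simp
    then have S: "S = {{#}}" "M0 = {#}" using less.prems(2) by auto
    then obtain q where q: "q * pd (c {#}) - 1 \<in> K" using pd_generates less.prems(3) by blast
    have "y \<in> K" using FF_neg[OF less.prems(5)] True by simp
    from K_add[OF q K_left[OF this, of q]] show ?thesis
      by (intro exI[of _ q]) (simp add: comb_def S distrib_left algebra_simps)
  next
    case False
    then have "M0 \<noteq> {#}" using less.prems(2,4) dgm_eq_0[of M0] by auto
    then obtain t where t: "t \<in># M0" by (metis multiset_nonemptyE)
    obtain S' c' M' y' where
      *: "finite S'" "M' \<in> S'" "c' M' \<noteq> 0" "\<And>M. M \<in> S' \<Longrightarrow> dgm M = int n - dgr t"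
      "y' \<in> FF (int n - dgr t - 1)" "Xp (St t) * (comb S c + y) = comb S' c' + y'"
      by (rule St_comb[where c = c, OF less.prems(1-3) t less.prems(4,5)]) blast+
    have "0 \<le> dgm M'" by (simp add: dgm_def dgl_nonneg)
    then have m: "int n - dgr t = int (nat (int n - dgr t))" "nat (int n - dgr t) < n"
      using *(2,4) dgr_pos[of t] False by auto
    from less.IH[where c = c', OF m(2) *(1-3)] *(4,5)
    obtain q where "q * (comb S' c' + y') - 1 \<in> K" unfolding m(1)[symmetric] by blast
    then show ?thesis
      using *(6) by (intro exI[of _ "q * Xp (St t)"]) (simp add: mult.assoc)
  qed
qed

lemma FF_decompose:
  assumes "p \<in> FF N"
  shows "\<exists>S c y. finite S \<and> (\<forall>M\<in>S. dgm M = N) \<and> y \<in> FF (N - 1) \<and> p = comb S c + y"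
  using assms
proof (induction rule: FF.induct)
  case (K k)
  then show ?case by (intro exI[of _ "{}"] exI[of _ "\<lambda>_. 0"] exI[of _ k]) (simp add: comb_def FF.K)
next
  case (vec ts P)
  show ?case
  proof (cases "dgl ts = N")
    case True
    then show ?thesis
      using perm_lst[of ts P]
      by (intro exI[of _ "{mset ts}"] exI[of _ "\<lambda>_. P"] exI[of _ "vec ts P - vec (lst (mset ts)) P"])
        (simp add: comb_def dgm_mset)
  next
    case False
    then have "vec ts P \<in> FF (N - 1)" using vec by (intro FF.vec) simp
    then show ?thesis by (intro exI[of _ "{}"] exI[of _ "\<lambda>_. 0"] exI[of _ "vec ts P"]) (simp add: comb_def)
  qed
next
  case (add p q)
  then obtain S c y T d z where
    *: "finite S" "\<forall>M\<in>S. dgm M = N" "y \<in> FF (N - 1)" "p = comb S c + y"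
       "finite T" "\<forall>M\<in>T. dgm M = N" "z \<in> FF (N - 1)" "q = comb T d + z" by blast
  let ?c = "\<lambda>M. if M \<in> S then c M else 0" and ?d = "\<lambda>M. if M \<in> T then d M else 0"
  have z0: "vec ts 0 = 0" for ts by (simp add: vec_def)
  have "comb (S \<union> T) ?c = comb S c" "comb (S \<union> T) ?d = comb T d"
    using *(1,5) z0 unfolding comb_def by (auto intro!: sum.mono_neutral_cong_right)
  then have "comb (S \<union> T) (\<lambda>M. ?c M + ?d M) = comb S c + comb T d"
    unfolding comb_def by (simp only: vec_add sum.distrib)
  then have "p + q = comb (S \<union> T) (\<lambda>M. ?c M + ?d M) + (y + z)"
    using * by (simp add: algebra_simps)
  then show ?case
    using * FF.add by (intro exI[of _ "S \<union> T"] exI[of _ "\<lambda>M. ?c M + ?d M"] exI[of _ "y + z"]) auto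
qed

text \<open>A leading part with all coefficients zero is dropped and the degree lowered; this stops
  before the degree gets negative, where only \<open>K\<close> would remain.\<close>

lemma FF_normal_form:
  assumes "p \<in> FF (int n)" "p \<notin> K"
  shows "\<exists>m S c M0 y. finite S \<and> M0 \<in> S \<and> c M0 \<noteq> 0 \<and> (\<forall>M\<in>S. dgm M = int m) \<and> y \<in> FF (int m - 1) \<and> p = comb S c + y"
  using assms
proof (induction n rule: less_induct)
  case (less n)
  obtain S c y where *: "finite S" "\<forall>M\<in>S. dgm M = int n" "y \<in> FF (int n - 1)" "p = comb S c + y"
    using FF_decompose[OF less.prems(1)] by blast
  show ?case
  proof (cases "\<exists>M\<in>S. c M \<noteq> 0")
    case True
    then show ?thesis using * by blast
  next
    case False
    then have "comb S c = 0" by (simp add: comb_def vec_def)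
    then have p: "p \<in> FF (int n - 1)" using * by simp
    show ?thesis
    proof (cases n)
      case 0
      then show ?thesis using FF_neg[OF p] less.prems by simp
    next
      case (Suc k)
      then show ?thesis using less.IH[of k] p less.prems by simp
    qed
  qed
qed

section \<open>The vectors \<open>vec ts P\<close> span the module\<close>

definition FU :: "ie_free set" where
  "FU = (\<Union>n. FF (int n))"

lemma FF_FU: "p \<in> FF N \<Longrightarrow> p \<in> FU"
proof -
  assume "p \<in> FF N"
  then have "p \<in> FF (int (nat N))" by (rule FF_mono) simp
  then show ?thesis unfolding FU_def by blast
qed

lemma FU_add: "p \<in> FU \<Longrightarrow> q \<in> FU \<Longrightarrow> p + q \<in> FU"
proof -
  assume "p \<in> FU" "q \<in> FU"
  then obtain n m where "p \<in> FF (int n)" "q \<in> FF (int m)" by (auto simp: FU_def)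
  then have "p \<in> FF (int (max n m))" "q \<in> FF (int (max n m))" by (auto elim: FF_mono)
  then show ?thesis using FF_FU FF.add by blast
qed

lemma FU_vscale: "p \<in> FU \<Longrightarrow> vscale c p \<in> FU"
  unfolding FU_def using FF_vscale by blast

lemma FU_uminus: "p \<in> FU \<Longrightarrow> - p \<in> FU"
  unfolding FU_def using FF_uminus by blast

lemma FU_sum_mset: "(\<And>i. i \<in># A \<Longrightarrow> f i \<in> FU) \<Longrightarrow> (\<Sum>i\<in>#A. f i) \<in> FU"
  by (induction A) (auto intro: FU_add FF_FU[OF FF_zero])

lemma FU_K: "k \<in> K \<Longrightarrow> k \<in> FU"
  using FF_FU FF.K by blast

lemma FU_vec: "vec ts P \<in> FU"
  by (rule FF_FU[OF FF.vec[OF order_refl]])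

lemma Xm_FU: "p \<in> FU \<Longrightarrow> Xm t * p \<in> FU"
  using Xm_FF FF_FU unfolding FU_def by blast

text \<open>For arbitrary \<open>z\<close> there is no control of the degree as in
  \<open>Xp_vec\<close>; for spanning it suffices that the creation letter can be moved to the right
  end, by induction on the list.\<close>

lemma Xp_vec_FU: "Xp z * vec ts P \<in> FU"
proof (induction ts arbitrary: z)
  case Nil
  have "vscale (\<chi> z) (vec [] (shift (msize z) P)) \<in> FU" by (intro FU_vscale FU_vec)
  from FU_add[OF FU_K[OF Xp_vec_Nil[of z P]] this] show ?case by simp
next
  case (Cons s ts)
  have "mixed_bracket s z * vec ts P \<in> FU"
  proof (cases "s = z")
    case True
    then show ?thesis using FF_FU[OF Xd_vec] by (simp add: mixed_bracket_def)
  next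
    case False
    have "(\<Sum>q\<in>#cut_rests s z. Xp q) * vec ts P \<in> FU"
      unfolding sum_mset_distrib_right by (rule FU_sum_mset) (rule Cons)
    from FU_add[OF FF_FU[OF mixed_rest[OF False, of ts P]] this] show ?thesis
      by (simp add: left_diff_distrib)
  qed
  then have "Xm s * (Xp z * vec ts P) + - (mixed_bracket s z * vec ts P) \<in> FU"
    by (intro FU_add FU_uminus Xm_FU Cons)
  from FU_add[OF FU_K[OF Xp_vec_Cons[of z s ts P]] this] show ?case by simp
qed

lemma letter_FU:
  assumes "p \<in> FU"
  shows "bvec (FWord [b]) * p \<in> FU"
proof -
  obtain n where "p \<in> FF (int n)" using assms by (auto simp: FU_def)
  then show ?thesis
  proof (induction rule: FF.induct)
    case (vec ts P)
    show ?case
      unfolding letter_cases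
      by (cases b) (simp_all add: FF_FU[OF Xd_vec] Xp_vec_FU FF_FU[OF Xm_vec])
  qed (auto intro: FU_K K_left FU_add simp: distrib_left)
qed

lemma all_FU: "p \<in> FU"
proof (induction p rule: poly_induct)
  case zero
  then show ?case by (rule FU_K) simp
next
  case (single w c)
  have "bvec (FWord bs) \<in> FU" for bs
  proof (induction bs)
    case Nil
    have "bvec (FWord []) = vec [] [:1:]"
      by (simp add: pd_pCons flip: zero_fword_def)
    then show ?case using FU_vec by metis
  next
    case (Cons b bs)
    have "bvec (FWord (b # bs)) = bvec (FWord [b]) * bvec (FWord bs)"
      by (simp add: mult_single plus_fword_def)
    then show ?case using letter_FU[OF Cons] by simp
  qed
  from FU_vscale[OF this[of "letters w"], of c] show ?case
    by (simp add: single_conv_vscale[of w c])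
qed (rule FU_add)

lemma normal_form:
  assumes "p \<notin> K"
  obtains m S c M0 y where "finite S" "M0 \<in> S" "c M0 \<noteq> 0" "\<And>M. M \<in> S \<Longrightarrow> dgm M = int m"
    "y \<in> FF (int m - 1)" "p = comb S c + y"
proof -
  obtain n where "p \<in> FF (int n)" using all_FU[of p] by (auto simp: FU_def)
  from FF_normal_form[OF this assms] show ?thesis using that by blast
qed

lemma generates:
  assumes "p \<notin> K"
  shows "\<exists>q. q * p - 1 \<in> K"
proof -
  obtain m S c M0 y where *: "finite S" "M0 \<in> S" "c M0 \<noteq> 0" "\<And>M. M \<in> S \<Longrightarrow> dgm M = int m"
    "y \<in> FF (int m - 1)" "p = comb S c + y" by (rule normal_form[OF assms]) blast
  show ?thesis unfolding *(6) by (rule comb_generates[where c = c, OF *(1-5)])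
qed

text \<open>In positive degree some \<open>Xp (St t)\<close> would annihilate the vector, its
  character being zero, and yet send it to a combination with a nonzero leading coefficient, which
  generates 1. In degree 0 the same conflict arises from \<open>Xp t0\<close> minus its eigenvalue,
  unless the polynomial is constant.\<close>

lemma whittaker_scalar:
  assumes "\<And>z. Xp z * p - vscale (\<chi> z) p \<in> K"
  shows "\<exists>c. p - cst c \<in> K"
proof (cases "p \<in> K")
  case True
  then show ?thesis by (intro exI[of _ 0]) simp
next
  case False
  then obtain m S c M0 y where *: "finite S" "M0 \<in> S" "c M0 \<noteq> 0" "\<And>M. M \<in> S \<Longrightarrow> dgm M = int m"
    "y \<in> FF (int m - 1)" "p = comb S c + y" by (rule normal_form) blast
  show ?thesis
  proof (cases "m = 0")
    case True
    then have "M = {#}" if "M \<in> S" for M using *(4)[OF that] dgm_eq_0 by simp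
    then have S: "S = {{#}}" "M0 = {#}" using *(2) by auto
    have y: "y \<in> K" using FF_neg[OF *(5)] True by simp
    let ?P = "c {#}"
    have p: "p = pd ?P + y" using *(6) by (simp add: comb_def S)
    show ?thesis
    proof (cases "degree ?P = 0")
      case True
      then obtain a where "?P = [:a:]" by (auto elim: degree_eq_zeroE)
      then have "p - cst a = y" using p by (simp add: pd_pCons)
      then show ?thesis using y by blast
    next
      case False
      let ?D = "shift (msize t0) ?P - ?P"
      have "?D \<noteq> 0" using shift_diff(1)[of ?P "msize t0"] False by simp
      then obtain q where q: "q * pd ?D - 1 \<in> K" using pd_generates by blast
      have "(Xp t0 - cst (\<chi> t0)) * p \<in> K"
        using assms[of t0] by (simp add: left_diff_distrib vscale_conv_mult)
      from K_diff[OF this K_left[OF y, of "Xp t0 - cst (\<chi> t0)"]] have "(Xp t0 - cst (\<chi> t0)) * pd ?P \<in> K" by (simp add: p distrib_left)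
      from K_diff[OF this Xp_t0_pd[of ?P]] have "vscale (\<chi> t0) (pd ?D) \<in> K" by simp
      from K_vscale[OF this, of "1 / \<chi> t0"] have "pd ?D \<in> K"
        using chi0 by (simp add: vscale_simps(2)[symmetric] vscale_simps(4))
      from K_diff[OF K_left[OF this, of q] q] have "1 \<in> K" by simp
      then show ?thesis using K_one by simp
    qed
  next
    case False
    then have "M0 \<noteq> {#}" using *(2,4) dgm_eq_0[of M0] by auto
    then obtain t where t: "t \<in># M0" by (metis multiset_nonemptyE)
    obtain S' c' M' y' where
      **: "finite S'" "M' \<in> S'" "c' M' \<noteq> 0" "\<And>M. M \<in> S' \<Longrightarrow> dgm M = int m - dgr t"
      "y' \<in> FF (int m - dgr t - 1)" "Xp (St t) * (comb S c + y) = comb S' c' + y'"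
      by (rule St_comb[where c = c, OF *(1-3) t *(4,5)]) blast+
    have "0 \<le> dgm M'" by (simp add: dgm_def dgl_nonneg)
    then have m: "int m - dgr t = int (nat (int m - dgr t))"
      using **(2,4) by auto
    obtain q where q: "q * (comb S' c' + y') - 1 \<in> K"
      using comb_generates[where c = c', OF **(1-3), of "nat (int m - dgr t)" y'] **(4,5)
      unfolding m[symmetric] by blast
    have "Xp (St t) * p \<in> K" using assms[of "St t"] by (simp add: St_chi vscale_simps)
    then have "comb S' c' + y' \<in> K" using **(6) *(6) by simp
    from K_diff[OF K_left[OF this, of q] q] have "1 \<in> K" by simp
    then show ?thesis using K_one by simp
  qed
qed

end

section \<open>Whittaker vectors and simplicity\<close>

context whittaker_type
begin

text \<open>Stability under the Lie algebra extends letter by letter to words, hence to left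
  multiplication by the whole tensor algebra.\<close>

lemma submodule_vectors:
  assumes "lie_submodule W (whittaker_module \<eta>)"
  shows "W \<subseteq> range (\<Psi> \<eta>)" "\<Psi> \<eta> 0 \<in> W" "\<Psi> \<eta> p \<in> W \<Longrightarrow> \<Psi> \<eta> (q * p) \<in> W"
proof -
  let ?V = "whittaker_module \<eta>"
  have sub: "submodule W complex_ring ?V"
    using assms unfolding lie_submodule_def by (rule conjunct1)
  have act: "act ?V x w \<in> W" if "w \<in> W" for x w
    using assms that unfolding lie_submodule_def by blast
  interpret submodule W complex_ring ?V by (rule sub)
  show "W \<subseteq> range (\<Psi> \<eta>)"
  proof
    fix w assume "w \<in> W"
    then have "w \<in> carrier ?V" using subset by auto
    then show "w \<in> range (\<Psi> \<eta>)" using V_ops(1)[OF hom, of w] by simp blast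
  qed
  show Wzero: "\<Psi> \<eta> 0 \<in> W"
    using one_closed V_ops(2)[OF hom] by simp
  have Wadd: "\<Psi> \<eta> (p + q) \<in> W" if "\<Psi> \<eta> p \<in> W" "\<Psi> \<eta> q \<in> W" for p q
    using m_closed[OF that] V_ops(3)[OF hom] by simp
  have smult: "\<Psi> \<eta> (vscale c p) \<in> W" if "\<Psi> \<eta> p \<in> W" for c p
    using smult_closed[OF _ that, of c] V_ops(4)[OF hom] by (simp add: complex_ring_def vscale_conv_mult)
  have letter: "\<Psi> \<eta> (bvec (FWord [b]) * p) \<in> W" if "\<Psi> \<eta> p \<in> W" for b p
    using act[OF that, of "bvec b"] V_ops(5)[OF hom] by (simp add: degree_one_bvec)
  show "\<Psi> \<eta> (q * p) \<in> W" if p: "\<Psi> \<eta> p \<in> W"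
  proof (induction q rule: poly_induct)
    case zero
    show ?case using Wzero by simp
  next
    case (add x y)
    show ?case unfolding distrib_right by (rule Wadd) (rule add)+
  next
    case (single w c)
    have "\<Psi> \<eta> (bvec (FWord bs) * p) \<in> W" for bs
    proof (induction bs)
      case Nil
      then show ?case using p by (simp flip: zero_fword_def)
    next
      case (Cons b bs)
      have "bvec (FWord (b # bs)) * p = bvec (FWord [b]) * (bvec (FWord bs) * p)"
        by (simp add: mult_single plus_fword_def flip: mult.assoc)
      then show ?case using letter[OF Cons] by simp
    qed
    from smult[OF this[of "letters w"], of c] show ?case
      by (simp add: single_conv_vscale[of w c] vscale_mult_left)
  qed
qed

lemma simple: "simple_lie_module basis_bracket (whittaker_module \<eta>)"
  unfolding simple_lie_module_def
proof (intro conjI allI impI)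
  let ?V = "whittaker_module \<eta>"
  show "is_lie_module basis_bracket ?V" by (rule is_lie_module_V[OF hom])
  have carrier: "carrier ?V = range (\<Psi> \<eta>)"
    by (rule Set.set_eqI) (simp only: V_ops(1)[OF hom] image_iff bex_UNIV)
  show "carrier ?V \<noteq> {\<zero>\<^bsub>?V\<^esub>}"
    using \<Psi>_one_nonzero[OF hom] V_ops(2)[OF hom] carrier by auto
  fix W assume W: "lie_submodule W ?V"
  show "W = {\<zero>\<^bsub>?V\<^esub>} \<or> W = carrier ?V"
  proof (cases "W = {\<Psi> \<eta> 0}")
    case True
    then show ?thesis using V_ops(2)[OF hom] by simp
  next
    case False
    then obtain p where p: "\<Psi> \<eta> p \<in> W" "\<Psi> \<eta> p \<noteq> \<Psi> \<eta> 0"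
      using submodule_vectors(1,2)[OF W] by blast
    then have "p \<notin> K" by (simp add: K_def)
    then obtain q where "q * p - 1 \<in> K" using generates by blast
    then have "\<Psi> \<eta> (q * p) = \<Psi> \<eta> 1" by (simp add: K_iff)
    then have one: "\<Psi> \<eta> 1 \<in> W" using submodule_vectors(3)[OF W p(1), of q] by simp
    have "\<Psi> \<eta> r \<in> W" for r using submodule_vectors(3)[OF W one, of r] by simp
    then show ?thesis using submodule_vectors(1)[OF W] carrier by auto
  qed
qed

lemma whittaker_vectors_eq:
  "whittaker_vectors \<eta> (whittaker_module \<eta>) = {c \<odot>\<^bsub>whittaker_module \<eta>\<^esub> \<Psi> \<eta> 1 | c. True}"
proof
  let ?V = "whittaker_module \<eta>"
  show "whittaker_vectors \<eta> ?V \<subseteq> {c \<odot>\<^bsub>?V\<^esub> \<Psi> \<eta> 1 | c. True}"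
  proof
    fix v assume "v \<in> whittaker_vectors \<eta> ?V"
    then obtain p where v: "v = \<Psi> \<eta> p" and w: "\<And>x. x \<in> n_plus \<Longrightarrow> act ?V x v = \<eta> x \<odot>\<^bsub>?V\<^esub> v"
      by (auto simp: whittaker_vectors_def V_ops(1)[OF hom])
    have "Xp z * p - vscale (\<chi> z) p \<in> K" for z
    proof -
      have "bvec (Dplus (tdecode z)) \<in> n_plus" by (simp add: n_plus_def span_of_def)
      from w[OF this] have "\<Psi> \<eta> (Xp z * p) = \<Psi> \<eta> (cst (\<chi> z) * p)"
        by (simp add: v V_ops[OF hom] degree_one_bvec Xp_def tchar_def[OF hom])
      then show ?thesis by (simp add: K_iff vscale_conv_mult)
    qed
    then obtain c where "p - cst c \<in> K" using whittaker_scalar by blast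
    then have "v = c \<odot>\<^bsub>?V\<^esub> \<Psi> \<eta> 1"
      by (simp add: v V_ops[OF hom] K_iff)
    then show "v \<in> {c \<odot>\<^bsub>?V\<^esub> \<Psi> \<eta> 1 | c. True}" by blast
  qed
  show "{c \<odot>\<^bsub>?V\<^esub> \<Psi> \<eta> 1 | c. True} \<subseteq> whittaker_vectors \<eta> ?V"
  proof
    fix v assume "v \<in> {c \<odot>\<^bsub>?V\<^esub> \<Psi> \<eta> 1 | c. True}"
    then obtain c where v: "v = \<Psi> \<eta> (cst c)" by (auto simp: V_ops[OF hom])
    have "act ?V x v = \<eta> x \<odot>\<^bsub>?V\<^esub> v" if x: "x \<in> n_plus" for x
    proof -
      have "degree_one x \<in> carrier (tensor_algebra (range Dplus))"
        using degree_one_carrier x by (simp add: n_plus_def)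
      from \<Psi>_right[OF hom this, of "cst c"]
      have "\<Psi> \<eta> (cst c * degree_one x) = \<Psi> \<eta> (cst c * cst (\<eta> x))"
        by (simp only: word_character_degree_one[OF hom x])
      then show ?thesis
        by (simp only: v V_ops[OF hom] single_zero_commute[of c])
    qed
    then show "v \<in> whittaker_vectors \<eta> ?V"
      using v by (auto simp: whittaker_vectors_def V_ops(1)[OF hom])
  qed
qed

lemma one_dimensional_whittaker:
  "one_dimensional (whittaker_vectors \<eta> (whittaker_module \<eta>)) (whittaker_module \<eta>)"
proof -
  let ?V = "whittaker_module \<eta>" and ?W = "whittaker_vectors \<eta> (whittaker_module \<eta>)"
  interpret module complex_ring ?V
    using is_lie_module_V[OF hom] by (simp add: is_lie_module_def)
  have W: "?W = range (\<lambda>c. \<Psi> \<eta> (cst c))"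
    unfolding whittaker_vectors_eq by (auto simp: V_ops[OF hom])
  have "submodule ?W complex_ring ?V"
  proof (rule submoduleI)
    show "?W \<subseteq> carrier ?V" by (auto simp: whittaker_vectors_def)
    show "\<zero>\<^bsub>?V\<^esub> \<in> ?W"
      unfolding W V_ops(2)[OF hom] by (intro range_eqI[of _ _ 0]) simp
    fix a b assume ab: "a \<in> ?W"
    then obtain c where c: "a = \<Psi> \<eta> (cst c)" unfolding W by blast
    have "\<ominus>\<^bsub>?V\<^esub> a = \<Psi> \<eta> (cst (- c))"
      unfolding c by (rule minus_equality) (auto simp: V_ops[OF hom] single_uminus)
    then show "\<ominus>\<^bsub>?V\<^esub> a \<in> ?W" unfolding W by blast
    { assume "b \<in> ?W"
      then obtain d where "b = \<Psi> \<eta> (cst d)" unfolding W by blast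
      then have "a \<oplus>\<^bsub>?V\<^esub> b = \<Psi> \<eta> (cst (c + d))" by (simp add: c V_ops[OF hom] single_add)
      then show "a \<oplus>\<^bsub>?V\<^esub> b \<in> ?W" unfolding W by blast }
  next
    fix a x assume "x \<in> ?W"
    then obtain d where "x = \<Psi> \<eta> (cst d)" unfolding W by blast
    then have "a \<odot>\<^bsub>?V\<^esub> x = \<Psi> \<eta> (cst (a * d))" by (simp add: V_ops[OF hom] mult_single)
    then show "a \<odot>\<^bsub>?V\<^esub> x \<in> ?W" unfolding W by blast
  qed
  moreover have "\<Psi> \<eta> 1 \<in> ?W"
    unfolding W by (intro range_eqI[of _ _ 1]) simp
  moreover have "\<Psi> \<eta> 1 \<noteq> \<zero>\<^bsub>?V\<^esub>" using \<Psi>_one_nonzero[OF hom] V_ops(2)[OF hom] by simp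
  ultimately show ?thesis
    unfolding one_dimensional_def using whittaker_vectors_eq by blast
qed

end

text \<open>A nonzero \<eta> is nonzero on some basis vector, and the depth bound limits the heights
  of the trees where it is nonzero, so one of maximal height exists.\<close>

lemma exists_extremal_tree:
  assumes "n_plus_hom \<eta>" "\<exists>x\<in>n_plus. \<eta> x \<noteq> 0" "depth_bounded \<eta>"
  obtains t0 where "whittaker_type \<eta> t0"
proof -
  obtain x where x: "x \<in> n_plus" "\<eta> x \<noteq> 0" using assms(2) by blast
  have "\<exists>b\<in>Poly_Mapping.keys x. \<eta> (bvec b) \<noteq> 0"
  proof (rule ccontr)
    assume "\<not> ?thesis"
    then have "(\<Sum>b\<in>Poly_Mapping.keys x. Poly_Mapping.lookup x b * \<eta> (bvec b)) = 0"
      by (intro sum.neutral) auto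
    then show False using eta_expand[OF assms(1) x(1)] x(2) by simp
  qed
  then obtain t where "\<eta> (bvec (Dplus t)) \<noteq> 0"
    using x(1) by (auto simp: n_plus_def span_of_def)
  then have t: "tchar \<eta> (tcode t) \<noteq> 0" by (simp add: tchar_def[OF assms(1)])
  obtain M where M: "\<And>t. M \<le> depth t \<Longrightarrow> \<eta> (bvec (Dplus t)) = 0"
    using assms(3) by (auto simp: depth_bounded_def)
  have bound: "mheight z < M" if "tchar \<eta> z \<noteq> 0" for z
  proof (rule ccontr)
    assume "\<not> mheight z < M"
    then have "M \<le> depth (tdecode z)"
      using mheight_le_depth[of "tdecode z"] by simp
    then show False
      using M that by (simp add: tchar_def[OF assms(1)])
  qed
  obtain t0 where "tchar \<eta> t0 \<noteq> 0" "\<And>z. tchar \<eta> z \<noteq> 0 \<Longrightarrow> mheight z \<le> mheight t0"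
    using ex_has_greatest_nat[of "\<lambda>z. tchar \<eta> z \<noteq> 0" "tcode t" mheight M] t bound less_imp_le by blast
  then have "whittaker_type \<eta> t0"
    using assms(1) by unfold_locales (use leD in blast)+
  then show ?thesis by (rule that)
qed

theorem theorem3p8:
  fixes \<eta> :: "ie_alg \<Rightarrow> complex"
  assumes hom: "n_plus_hom \<eta>"
    and nonzero: "\<exists>x\<in>n_plus. \<eta> x \<noteq> 0"
    and bounded: "depth_bounded \<eta>"
  shows "one_dimensional (whittaker_vectors \<eta> (whittaker_module \<eta>)) (whittaker_module \<eta>) \<and>
         simple_lie_module basis_bracket (whittaker_module \<eta>)"
proof -
  obtain t0 where "whittaker_type \<eta> t0" by (rule exists_extremal_tree[OF assms])
  then show ?thesis
    using whittaker_type.one_dimensional_whittaker whittaker_type.simple by blast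
qed

end
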